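(* Let $n\ge m\ge 1$ be integers, $\nu>0$, let $\mathbf{T}_1\sim\mathcal{MT}_{m\times n}^\beta(\nu,\mathbf{0},\mathbf{I}_m,\mathbf{I}_n)$ and let $\mathbf{F}_1=\mathbf{T}_1\mathbf{T}_1^{*}\in\mathfrak{P}_m^\beta$. Then the density of $\mathbf{F}_1$ is $$\frac{\Gamma_1^\beta[\beta(\nu+mn)/2]}{\Gamma_1^\beta[\beta\nu/2]\,\Gamma_m^\beta[\beta n/2]}\,|\mathbf{F}_1|^{\beta(n-m+1)/2-1}\,(1+\operatorname{tr}\mathbf{F}_1)^{-\beta(\nu+mn)/2},\qquad \mathbf{F}_1\in\mathfrak{P}_m^\beta.$$
   Context: Let $\beta\in\{1,2,4\}$ and let $\mathfrak{F}$ be the real numbers ($\beta=1$), the complex numbers ($\beta=2$) or the quaternions ($\beta=4$). $\mathfrak{F}^{m\times n}$ is the set of $m\times n$ matrices over $\mathfrak{F}$, and $\mathbf{A}^{*}$ is the conjugate transpose. $\mathfrak{P}_p^\beta$ is the cone of $p\times p$ positive definite Hermitian ($\mathbf{A}=\mathbf{A}^*$) matrices over $\mathfrak{F}$; for $\mathbf{A}\in\mathfrak{P}_p^\beta$, $|\mathbf{A}|$ is the product of its $p$ (positive real) eigenvalues. Densities on $\mathfrak{F}^{m\times n}$ are with respect to Lebesgue measure in the $\beta mn$ real components of the entries. Densities on $\mathfrak{P}_p^\beta$ are with respect to the product of the Lebesgue measures of the $p$ real diagonal entries and of the $\beta$ real components of each entry above the diagonal. $\Gamma_m^\beta[a]=\pi^{m(m-1)\beta/4}\prod_{i=1}^m\Gamma(a-(i-1)\beta/2)$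 for $a>(m-1)\beta/2$; in particular $\Gamma_1^\beta[a]=\Gamma(a)$. $\mathbf{T}_1\sim\mathcal{MT}_{m\times n}^\beta(\nu,\mathbf{0},\mathbf{I}_m,\mathbf{I}_n)$ (standard matrix multivariate $T$ distribution, scale parameter $\rho=1$) means that $\mathbf{T}_1\in\mathfrak{F}^{m\times n}$ has density $$\frac{\Gamma_1^\beta[\beta(\nu+mn)/2]}{\pi^{\beta mn/2}\,\Gamma_1^\beta[\beta\nu/2]}\bigl[1+\operatorname{tr}\mathbf{T}_1\mathbf{T}_1^{*}\bigr]^{-\beta(\nu+mn)/2}.$$ The distribution of $\mathbf{F}_1$ is called the matrix multivariate beta type II distribution. *)

theory Defs
  imports "HOL-Analysis.Analysis" "HOL-Probability.Probability"
begin

section \<open>Quaternions\<close>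

datatype quat = Quat (qre: real) (qi: real) (qj: real) (qk: real)

lemma quat_eq_iff: "x = y \<longleftrightarrow> qre x = qre y \<and> qi x = qi y \<and> qj x = qj y \<and> qk x = qk y"
  by (cases x; cases y) auto

instantiation quat :: ab_group_add
begin

definition zero_quat :: quat where "0 = Quat 0 0 0 0"
definition "x + y = Quat (qre x + qre y) (qi x + qi y) (qj x + qj y) (qk x + qk y)" for x y :: quat
definition "- x = Quat (- qre x) (- qi x) (- qj x) (- qk x)" for x :: quat
definition "x - y = Quat (qre x - qre y) (qi x - qi y) (qj x - qj y) (qk x - qk y)" for x y :: quat

instance
  by standard
    (simp_all add: quat_eq_iff zero_quat_def plus_quat_def uminus_quat_def minus_quat_def)

end

lemma quat_add_sel [simp]:
  "qre 0 = 0" "qi 0 = 0" "qj 0 = 0" "qk 0 = 0"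
  "qre (x + y) = qre x + qre y" "qi (x + y) = qi x + qi y"
  "qj (x + y) = qj x + qj y" "qk (x + y) = qk x + qk y"
  "qre (- x) = - qre x" "qi (- x) = - qi x" "qj (- x) = - qj x" "qk (- x) = - qk x"
  "qre (x - y) = qre x - qre y" "qi (x - y) = qi x - qi y"
  "qj (x - y) = qj x - qj y" "qk (x - y) = qk x - qk y"
  by (simp_all add: zero_quat_def plus_quat_def uminus_quat_def minus_quat_def)

instantiation quat :: real_vector
begin

definition "r *\<^sub>R x = Quat (r * qre x) (r * qi x) (r * qj x) (r * qk x)" for x :: quat

instance
  by standard (simp_all add: quat_eq_iff scaleR_quat_def algebra_simps)

end

lemma quat_scaleR_sel [simp]:
  "qre (r *\<^sub>R x) = r * qre x" "qi (r *\<^sub>R x) = r * qi x"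
  "qj (r *\<^sub>R x) = r * qj x" "qk (r *\<^sub>R x) = r * qk x"
  by (simp_all add: scaleR_quat_def)

instantiation quat :: real_inner
begin

definition "inner x y = qre x * qre y + qi x * qi y + qj x * qj y + qk x * qk y" for x y :: quat
definition "norm x = sqrt (inner x x)" for x :: quat
definition "sgn x = x /\<^sub>R norm x" for x :: quat
definition "dist x y = norm (x - y)" for x y :: quat
definition "(uniformity :: (quat \<times> quat) filter) = (INF e\<in>{0<..}. principal {(x, y). dist x y < e})"
definition "open (U :: quat set) \<longleftrightarrow> (\<forall>x\<in>U. eventually (\<lambda>(x', y). x' = x \<longrightarrow> y \<in> U) uniformity)"

instance
proof
  fix x y z :: quat and r :: real and U :: "quat set"
  show "sgn x = x /\<^sub>R norm x" by (rule sgn_quat_def)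
  show "dist x y = norm (x - y)" by (rule dist_quat_def)
  show "(uniformity :: (quat \<times> quat) filter) = (INF e\<in>{0<..}. principal {(x, y). dist x y < e})"
    by (rule uniformity_quat_def)
  show "open U \<longleftrightarrow> (\<forall>x\<in>U. eventually (\<lambda>(x', y). x' = x \<longrightarrow> y \<in> U) uniformity)"
    by (rule open_quat_def)
  show "inner x y = inner y x" "inner (x + y) z = inner x z + inner y z"
    "inner (r *\<^sub>R x) y = r * inner x y" "0 \<le> inner x x"
    by (simp_all add: inner_quat_def algebra_simps)
  show "inner x x = 0 \<longleftrightarrow> x = 0"
    by (simp add: inner_quat_def quat_eq_iff add_nonneg_eq_0_iff)
  show "norm x = sqrt (inner x x)" by (rule norm_quat_def)
qed

end

instantiation quat :: real_div_algebra
begin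

definition one_quat :: quat where "1 = Quat 1 0 0 0"
definition "x * y = Quat
  (qre x * qre y - qi x * qi y - qj x * qj y - qk x * qk y)
  (qre x * qi y + qi x * qre y + qj x * qk y - qk x * qj y)
  (qre x * qj y - qi x * qk y + qj x * qre y + qk x * qi y)
  (qre x * qk y + qi x * qj y - qj x * qi y + qk x * qre y)" for x y :: quat
definition "inverse x = Quat (qre x) (- qi x) (- qj x) (- qk x) /\<^sub>R inner x x" for x :: quat
definition "x div y = x * inverse y" for x y :: quat

instance
proof
  fix x y z :: quat and r :: real
  show "x * y * z = x * (y * z)" "1 * x = x" "x * 1 = x"
    "(x + y) * z = x * z + y * z" "x * (y + z) = x * y + x * z"
    "(0::quat) \<noteq> 1" "r *\<^sub>R x * y = r *\<^sub>R (x * y)" "x * r *\<^sub>R y = r *\<^sub>R (x * y)"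
    by (simp_all add: quat_eq_iff times_quat_def one_quat_def algebra_simps)
  show "x div y = x * inverse y" by (rule divide_quat_def)
  show "inverse (0::quat) = 0" by (simp add: inverse_quat_def)
  assume "x \<noteq> 0"
  then have n: "inner x x \<noteq> 0" by simp
  let ?c = "Quat (qre x) (- qi x) (- qj x) (- qk x)"
  have "?c * x = inner x x *\<^sub>R 1" "x * ?c = inner x x *\<^sub>R 1"
    by (simp_all add: quat_eq_iff times_quat_def one_quat_def inner_quat_def algebra_simps)
  moreover have "(r *\<^sub>R u) * v = r *\<^sub>R (u * v)" "u * (r *\<^sub>R v) = r *\<^sub>R (u * v)" for r and u v :: quat
    by (simp_all add: quat_eq_iff times_quat_def algebra_simps)
  ultimately show "inverse x * x = 1" "x * inverse x = 1"
    using n by (simp_all add: inverse_quat_def)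
qed

end

lemma quat_mult_sel [simp]:
  "qre 1 = 1" "qi 1 = 0" "qj 1 = 0" "qk 1 = 0"
  "qre (x * y) = qre x * qre y - qi x * qi y - qj x * qj y - qk x * qk y"
  "qi (x * y) = qre x * qi y + qi x * qre y + qj x * qk y - qk x * qj y"
  "qj (x * y) = qre x * qj y - qi x * qk y + qj x * qre y + qk x * qi y"
  "qk (x * y) = qre x * qk y + qi x * qj y - qj x * qi y + qk x * qre y"
  by (simp_all add: one_quat_def times_quat_def)

instance quat :: real_normed_div_algebra
proof
  fix x y :: quat
  have "inner (x * y) (x * y) = inner x x * inner y y"
    by (simp add: inner_quat_def algebra_simps)
  then show "norm (x * y) = norm x * norm y"
    by (simp add: norm_quat_def real_sqrt_mult)
qed

instantiation quat :: euclidean_space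
begin

definition "Basis = {Quat 1 0 0 0, Quat 0 1 0 0, Quat 0 0 1 0, Quat 0 0 0 1}"

instance
proof
  fix x u v :: quat
  show "(Basis :: quat set) \<noteq> {}" "finite (Basis :: quat set)"
    by (simp_all add: Basis_quat_def)
  show "u \<in> Basis \<Longrightarrow> v \<in> Basis \<Longrightarrow> inner u v = (if u = v then 1 else 0)"
    by (simp only: Basis_quat_def insert_iff empty_iff inner_quat_def) (elim disjE; simp)
  show "(\<forall>u\<in>Basis. inner x u = 0) \<longleftrightarrow> x = 0"
    by (simp add: Basis_quat_def inner_quat_def) (metis quat_eq_iff quat_add_sel(1-4))
qed

end

lemma DIM_quat [simp]: "DIM(quat) = 4"
  by (simp add: Basis_quat_def)


section \<open>The three division algebras\<close>

text \<open>The common interface of \<^typ>\<open>real\<close>, \<^typ>\<open>complex\<close> and \<^typ>\<open>quat\<close>. In each of them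
  the basis consists of the usual units, so that \<^const>\<open>lborel\<close> is Lebesgue measure in the real
  components, and \<open>DIM('a)\<close> is 1, 2 and 4, respectively.\<close>

class conj_div_algebra = real_normed_div_algebra + euclidean_space +
  fixes hconj :: "'a \<Rightarrow> 'a"
  assumes hconj_add: "hconj (x + y) = hconj x + hconj y"
    and hconj_mult: "hconj (x * y) = hconj y * hconj x"
    and hconj_plus_self: "x + hconj x = (2 * inner x 1) *\<^sub>R 1"
    and mult_hconj: "x * hconj x = (norm x)\<^sup>2 *\<^sub>R 1"

instantiation real :: conj_div_algebra
begin

definition "hconj x = x" for x :: real

instance
  by standard (simp_all add: hconj_real_def power2_eq_square)

end

instantiation complex :: conj_div_algebra
begin

definition "hconj z = cnj z" for z :: complex

instance
  by standard (simp_all add: hconj_complex_def complex_eq_iff complex_mult_cnj cmod_power2)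

end

instantiation quat :: conj_div_algebra
begin

definition "hconj x = Quat (qre x) (- qi x) (- qj x) (- qk x)" for x :: quat

instance
proof
  fix x y :: quat
  show "hconj (x + y) = hconj x + hconj y" "hconj (x * y) = hconj y * hconj x"
    "x + hconj x = (2 * inner x 1) *\<^sub>R 1"
    by (simp_all add: hconj_quat_def quat_eq_iff inner_quat_def)
  have "x * hconj x = inner x x *\<^sub>R 1"
    by (simp add: hconj_quat_def quat_eq_iff inner_quat_def)
  then show "x * hconj x = (norm x)\<^sup>2 *\<^sub>R 1"
    by (simp add: dot_square_norm)
qed

end

definition repart :: "'a::conj_div_algebra \<Rightarrow> real" where
  "repart x = inner x 1"

lemma repart_simps:
  "repart (x::real) = x" "repart (z::complex) = Re z" "repart (q::quat) = qre q"
  by (simp_all add: repart_def inner_quat_def)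


section \<open>Hermitian matrices\<close>

definition ctranspose :: "'a::conj_div_algebra^'n^'m \<Rightarrow> 'a^'m^'n" where
  "ctranspose A = (\<chi> i j. hconj (A $ j $ i))"

definition posdef_hermitian :: "('a::conj_div_algebra^'m^'m) set" where
  "posdef_hermitian = {A. A = ctranspose A \<and>
     (\<forall>x. x \<noteq> 0 \<longrightarrow> (\<exists>r>0. (\<Sum>i\<in>UNIV. hconj (x $ i) * (A *v x) $ i) = of_real r))}"

text \<open>All eigenvalues of a Hermitian matrix are real. Real numbers are central, so over the
  quaternions left and right eigenvalues need not be distinguished here. An eigenspace is a right
  vector space over \<open>'a\<close>; its dimension over \<open>'a\<close>, which is the multiplicity of the eigenvalue,
  is its real dimension divided by \<open>DIM('a)\<close>.\<close>

definition eigenspace :: "'a::conj_div_algebra^'m^'m \<Rightarrow> real \<Rightarrow> ('a^'m) set" where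
  "eigenspace A l = {x. A *v x = l *\<^sub>R x}"

definition hdet :: "'a::conj_div_algebra^'m^'m \<Rightarrow> real" where
  "hdet A = (\<Prod>l\<in>{l. eigenspace A l \<noteq> {0}}. l ^ (dim (eigenspace A l) div DIM('a)))"

text \<open>The Hermitian matrix with diagonal \<open>d\<close> and with entries \<open>u\<close> above the diagonal, and the
  image of Lebesgue measure in these coordinates, as a measure on the space of all matrices
  (concentrated on the Hermitian ones).\<close>

definition hermitian_of ::
    "('m \<Rightarrow> real) \<times> ('m \<times> 'm \<Rightarrow> 'a) \<Rightarrow>
        'a::conj_div_algebra^('m::{finite,linorder})^('m::{finite,linorder})" where
  "hermitian_of = (\<lambda>(d, u). \<chi> i j. if i = j then of_real (d i)
     else if i < j then u (i, j) else hconj (u (j, i)))"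

definition hermitian_lborel :: "('a::conj_div_algebra^('m::{finite,linorder})^('m::{finite,linorder})) measure" where
  "hermitian_lborel = distr
     ((\<Pi>\<^sub>M i\<in>UNIV. lborel) \<Otimes>\<^sub>M (\<Pi>\<^sub>M p\<in>{(i, j). i < j}. lborel)) borel hermitian_of"

lemma continuous_on_hconj: "continuous_on S (hconj :: 'a::conj_div_algebra \<Rightarrow> 'a)"
proof -
  have *: "hconj = (\<lambda>x::'a. (2 * inner x 1) *\<^sub>R 1 - x)"
    using hconj_plus_self by (auto simp: fun_eq_iff algebra_simps)
  show ?thesis by (subst *) (intro continuous_intros)
qed

lemma borel_measurable_hconj [measurable]:
  "(hconj :: 'a::conj_div_algebra \<Rightarrow> 'a) \<in> borel_measurable borel"
  by (intro borel_measurable_continuous_onI continuous_on_hconj)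

lemma hermitian_of_nth:
  "hermitian_of p $ i $ j = (if i = j then of_real (fst p i)
     else if i < j then snd p (i, j) else hconj (snd p (j, i)))"
  by (simp add: hermitian_of_def split: prod.split)

lemma borel_measurable_hermitian_of [measurable]:
  "(hermitian_of :: _ \<Rightarrow> 'a::conj_div_algebra^('m::{finite,linorder})^('m::{finite,linorder})) \<in> borel_measurable
     ((\<Pi>\<^sub>M i\<in>UNIV. lborel) \<Otimes>\<^sub>M (\<Pi>\<^sub>M p\<in>{(i, j). i < j}. lborel))"
  (is "_ \<in> borel_measurable ?M")
proof (rule borel_measurable_euclidean_space[THEN iffD2], rule ballI)
  fix b :: "(('a, 'm) vec, 'm) vec" assume "b \<in> Basis"
  let ?h = "hermitian_of :: _ \<Rightarrow> (('a, 'm) vec, 'm) vec"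
  from \<open>b \<in> Basis\<close> obtain i j c where b: "b = axis i (axis j c)"
    by (auto simp: Basis_vec_def)
  have "(\<lambda>p. ?h p $ i $ j) \<in> borel_measurable ?M"
  proof (cases i j rule: linorder_cases)
    case less
    then have [measurable]: "(i, j) \<in> {(i, j). i < j}" by simp
    from less have "(\<lambda>p. ?h p $ i $ j) = (\<lambda>p. snd p (i, j))"
      by (auto simp: hermitian_of_nth fun_eq_iff)
    then show ?thesis by simp
  next
    case equal
    then have "(\<lambda>p. ?h p $ i $ j) = (\<lambda>p. of_real (fst p i))"
      by (auto simp: hermitian_of_nth fun_eq_iff)
    then show ?thesis by simp
  next
    case greater
    then have [measurable]: "(j, i) \<in> {(i, j). i < j}" by simp
    from greater have "(\<lambda>p. ?h p $ i $ j) = (\<lambda>p. hconj (snd p (j, i)))"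
      by (auto simp: hermitian_of_nth fun_eq_iff)
    then show ?thesis by simp
  qed
  then show "(\<lambda>p. hermitian_of p \<bullet> b) \<in> borel_measurable ?M"
    by (simp add: b inner_axis)
qed


section \<open>Densities\<close>

definition mgamma :: "real \<Rightarrow> nat \<Rightarrow> real \<Rightarrow> real" where
  "mgamma \<beta> m a = pi powr (real m * (real m - 1) * \<beta> / 4) *
     (\<Prod>i=1..m. Gamma (a - (real i - 1) * \<beta> / 2))"

definition matrix_T_density :: "real \<Rightarrow> real \<Rightarrow> 'a::conj_div_algebra^'n^'m \<Rightarrow> real" where
  "matrix_T_density \<beta> \<nu> X =
     mgamma \<beta> 1 (\<beta> * (\<nu> + real (CARD('m) * CARD('n))) / 2) /
       (pi powr (\<beta> * real (CARD('m) * CARD('n)) / 2) * mgamma \<beta> 1 (\<beta> * \<nu> / 2)) *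
     (1 + repart (trace (X ** ctranspose X))) powr
       (- \<beta> * (\<nu> + real (CARD('m) * CARD('n))) / 2)"

definition matrix_T ::
    "'w measure \<Rightarrow> real \<Rightarrow> real \<Rightarrow> ('w \<Rightarrow> 'a::conj_div_algebra^'n^'m) \<Rightarrow> bool" where
  "matrix_T M \<beta> \<nu> T \<longleftrightarrow>
     prob_space M \<and> distributed M lborel T (\<lambda>X. ennreal (matrix_T_density \<beta> \<nu> X))"

text \<open>The density on the positive definite cone, extended by 0.\<close>

definition matrix_betaII_density ::
    "real \<Rightarrow> real \<Rightarrow> nat \<Rightarrow> 'a::conj_div_algebra^'m^'m \<Rightarrow> real" where
  "matrix_betaII_density \<beta> \<nu> n F = (if F \<in> posdef_hermitian then
     mgamma \<beta> 1 (\<beta> * (\<nu> + real (CARD('m) * n)) / 2) /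
       (mgamma \<beta> 1 (\<beta> * \<nu> / 2) * mgamma \<beta> CARD('m) (\<beta> * real n / 2)) *
     hdet F powr (\<beta> * (real n - real CARD('m) + 1) / 2 - 1) *
     (1 + repart (trace F)) powr (- \<beta> * (\<nu> + real (CARD('m) * n)) / 2)
   else 0)"

end

theory Submission
  imports Defs
begin

text \<open>The density of \<open>T\<close> depends on \<open>T\<close> only through \<open>F = T T\<^sup>*\<close>. It is therefore enough to know the
  image of Lebesgue measure on the \<open>m \<times> n\<close> matrices under \<open>X \<mapsto> X X\<^sup>*\<close>: by \<open>gram_matrix_law\<close> it has the
  density \<open>\<pi>\<close> to the power \<open>\<beta>mn/2\<close>, divided by the multivariate gamma function at \<open>\<beta>n/2\<close>, times
  \<open>|F|\<close> to the power \<open>\<beta>(n-m+1)/2-1\<close>, on the positive definite cone. All of this is uniform in the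
  division algebra, with \<open>\<beta> = DIM('a)\<close>.

  The image measure is found by splitting off one row at a time. Let \<open>x\<close> be the first row, let
  \<open>s = |x|\<^sup>2\<close>, and split every other row into a multiple of \<open>x/|x|\<close> and a part orthogonal to \<open>x\<close>. Then
  \<open>s\<close> is the first pivot of \<open>F\<close>, the rest of the first row of \<open>F\<close> consists of the conjugated coefficients
  times \<open>|x|\<close>, and the Gram matrix of the orthogonal parts is the Schur complement of \<open>s\<close> in \<open>F\<close>. The pivot
  contributes a power of \<open>s\<close>, from the law of \<open>|x|\<^sup>2\<close> and from the scaling by \<open>|x|\<close>. Conversely,
  \<open>F\<close> is rebuilt from \<open>s\<close>, its first row and the Schur complement by a translation of the remaining
  entries, which preserves Lebesgue measure. In the induction both \<open>m\<close> and \<open>n\<close> drop by one, so that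
  all pivots carry the same exponent.

  The orthogonal parts live in a space of smaller dimension that depends on \<open>x\<close>. To avoid choosing
  isometries, all rows stay in the full space; the directions that have been used up are kept as an
  orthonormal set \<open>es\<close>, and the components of the rows along them are integrated against the weight
  \<open>exp (- energy es y)\<close>. Passing to one more direction then only needs translation invariance and
  Fubini's theorem (\<open>fibre_average\<close>), and all constants come from Gaussian integrals. The two halves
  of the step are \<open>gram_peel\<close> for the rows and \<open>hermitian_integral_insert\<close> for Hermitian matrices, the
  law of a pivot is \<open>residual_norm_law\<close>, and \<open>gram_law\<close> is the induction.

  It remains to see that the product of the pivots is \<open>|F|\<close>, which is defined by eigenvalues
  (\<open>pivot_prod_eq_hdet\<close>). The usual determinant, which would mediate between the two, does not exist
  over the quaternions. Instead the Gaussian integral of \<open>exp (- x\<^sup>* F x)\<close> is computed twice. Completing squares gives the power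
  \<open>-\<beta>/2\<close> of the product of the pivots; diagonalising \<open>F\<close> as a real symmetric operator gives the
  power \<open>-1/2\<close> of the product of its real eigenvalues, where each eigenvalue is counted \<open>\<beta>\<close> times
  as often as over the division algebra.\<close>

section \<open>Conjugation and the Hermitian form on row vectors\<close>

lemma hconj_eq: "hconj x = (2 * inner x 1) *\<^sub>R 1 - (x::'a::conj_div_algebra)"
  using hconj_plus_self[of x] by (simp add: algebra_simps)

lemma inner_one_one [simp]: "inner (1::'a::conj_div_algebra) 1 = 1"
  by (simp add: dot_square_norm)

lemma hconj_simps [simp]:
  fixes x y :: "'a::conj_div_algebra"
  shows "hconj (hconj x) = x" "hconj (0::'a) = 0" "hconj (1::'a) = 1"
    "hconj (- x) = - hconj x" "hconj (x - y) = hconj x - hconj y"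
    "hconj (r *\<^sub>R x) = r *\<^sub>R hconj x" "hconj (of_real r :: 'a) = of_real r"
    "inner (hconj x) 1 = inner x 1" "norm (hconj x) = norm x"
proof -
  show "inner (hconj x) 1 = inner x 1" by (simp add: hconj_eq inner_diff_left)
  show "hconj (hconj x) = x"
    by (simp add: hconj_eq inner_diff_left)
  show "hconj (0::'a) = 0" "hconj (1::'a) = 1" "hconj (- x) = - hconj x"
    "hconj (x - y) = hconj x - hconj y" "hconj (r *\<^sub>R x) = r *\<^sub>R hconj x"
    by (simp_all add: hconj_eq algebra_simps inner_diff_left flip: scaleR_2)
  show "hconj (of_real r :: 'a) = of_real r" 
    by (simp add: hconj_eq of_real_def flip: scaleR_2 scaleR_left.diff)
  have "(norm (hconj x))\<^sup>2 = (norm x)\<^sup>2"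
    by (simp add: hconj_eq power2_norm_eq_inner algebra_simps inner_commute)
  then show "norm (hconj x) = norm x" by simp
qed

lemma hconj_sum: "hconj (\<Sum>i\<in>I. f i :: 'a::conj_div_algebra) = (\<Sum>i\<in>I. hconj (f i))"
  by (induction I rule: infinite_finite_induct) (auto simp: hconj_add)

lemma mult_hconj_self: "x * hconj x = of_real ((norm (x::'a::conj_div_algebra))\<^sup>2)"
  by (simp add: mult_hconj of_real_def)

lemma hconj_self_mult: "hconj x * x = of_real ((norm (x::'a::conj_div_algebra))\<^sup>2)"
  using mult_hconj_self[of "hconj x"] by simp

text \<open>Polarisation of \<open>mult_hconj\<close>. It ties the Euclidean structure to the multiplication and makes left
  and right multiplications adjoint to those by the conjugate.\<close>
lemma inner_eq_repart: "inner x y = inner (x * hconj y) (1::'a::conj_div_algebra)"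
proof -
  have "x * hconj y + y * hconj x = (2 * inner x y) *\<^sub>R 1"
    using mult_hconj[of "x + y"] mult_hconj[of x] mult_hconj[of y]
    by (simp add: hconj_add algebra_simps power2_norm_eq_inner inner_commute)
  moreover have "x * hconj y + y * hconj x = (2 * inner (x * hconj y) 1) *\<^sub>R 1"
    using hconj_plus_self[of "x * hconj y"] by (simp add: hconj_mult)
  ultimately have "(2 * inner x y) *\<^sub>R (1::'a) = (2 * inner (x * hconj y) 1) *\<^sub>R 1" by simp
  then show ?thesis by simp
qed

lemma inner_mult_right_hconj: "inner (x * q) y = inner x (y * hconj (q::'a::conj_div_algebra))"
  by (subst (1 2) inner_eq_repart) (simp add: hconj_mult mult.assoc)

lemma inner_mult_left_hconj: "inner (q * x) y = inner x (hconj q * (y::'a::conj_div_algebra))"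
proof -
  have hh: "inner (hconj a) (hconj b) = inner a b" for a b :: 'a
    by (simp add: hconj_eq inner_diff_left inner_diff_right inner_commute)
  have *: "inner (a * b) (1::'a) = inner (b * a) 1" for a b :: 'a
  proof -
    have "inner (a * b) (1::'a) = inner a (hconj b)"
      by (subst inner_eq_repart[of a]) simp
    also have "\<dots> = inner (hconj a) b"
      using hh[of a "hconj b"] by simp
    also have "\<dots> = inner b (hconj a)" by (rule inner_commute)
    also have "\<dots> = inner (b * a) 1"
      by (subst inner_eq_repart[of b]) simp
    finally show ?thesis .
  qed
  have "inner (q * x) y = inner (q * (x * hconj y)) 1"
    by (subst inner_eq_repart) (simp add: mult.assoc)
  also have "\<dots> = inner (x * hconj (hconj q * y)) 1"
    by (subst *) (simp add: hconj_mult mult.assoc)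
  also have "\<dots> = inner x (hconj q * y)"
    by (rule inner_eq_repart[symmetric])
  finally show ?thesis .
qed

lemma of_real_repart:
  assumes "hconj x = x"
  shows "of_real (repart x) = (x::'a::conj_div_algebra)"
proof -
  have "2 *\<^sub>R x = 2 *\<^sub>R (of_real (repart x) :: 'a)"
    using hconj_plus_self[of x] assms by (simp add: repart_def of_real_def scaleR_2)
  then show ?thesis by (metis scaleR_cancel_left zero_neq_numeral)
qed

lemma repart_of_real [simp]: "repart (of_real r :: 'a::conj_div_algebra) = r"
  by (simp add: repart_def of_real_def)

lemma repart_add: "repart (x + y) = repart x + repart (y::'a::conj_div_algebra)"
  by (simp add: repart_def inner_add_left)

text \<open>The form is linear on the left: scalars act on rows from the left, as rows of \<open>X\<close> are combined in
  \<open>A X\<close>, and \<open>X X\<^sup>*\<close> is the matrix of the values of this form on the rows of \<open>X\<close>.\<close>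
definition hform :: "'a::conj_div_algebra^'n \<Rightarrow> 'a^'n \<Rightarrow> 'a" where
  "hform x y = (\<Sum>k\<in>UNIV. x $ k * hconj (y $ k))"

lemma hform_add_left: "hform (x + y) z = hform x z + hform y z"
  by (simp add: hform_def algebra_simps sum.distrib)

lemma hform_diff_left: "hform (x - y) z = hform x z - hform y z"
  by (simp add: hform_def algebra_simps sum_subtractf)

lemma hform_smult_left: "hform (c *s x) z = c * hform x z"
  by (simp add: hform_def sum_distrib_left mult.assoc)

lemma hform_zero_left [simp]: "hform 0 z = 0"
  by (simp add: hform_def)

lemma hform_sum_left: "hform (\<Sum>i\<in>I. f i) z = (\<Sum>i\<in>I. hform (f i) z)"
  by (induction I rule: infinite_finite_induct) (auto simp: hform_add_left)

lemma hconj_hform: "hconj (hform x y) = hform y x"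
  by (simp add: hform_def hconj_sum hconj_mult)

lemma hform_add_right: "hform z (x + y) = hform z x + hform z y"
  by (metis hconj_add hconj_hform hform_add_left)

lemma hform_diff_right: "hform z (x - y) = hform z x - hform z y"
  by (metis hconj_simps(5) hconj_hform hform_diff_left)

lemma hform_smult_right: "hform z (c *s x) = hform z x * hconj c"
  by (metis hconj_mult hconj_hform hform_smult_left)

lemma hform_sum_right: "hform z (\<Sum>i\<in>I. f i) = (\<Sum>i\<in>I. hform z (f i))"
  by (induction I rule: infinite_finite_induct)
     (auto simp: hform_add_right simp flip: hconj_hform[of 0])

lemma hform_self: "hform x x = of_real ((norm x)\<^sup>2)"
  by (simp add: hform_def mult_hconj_self norm_vec_def L2_set_def sum_nonneg)

definition orthonormal :: "('a::conj_div_algebra^'n) set \<Rightarrow> bool" where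
  "orthonormal es \<longleftrightarrow> finite es \<and> (\<forall>e\<in>es. \<forall>f\<in>es. hform e f = (if e = f then 1 else 0))"

definition proj :: "('a::conj_div_algebra^'n) set \<Rightarrow> 'a^'n \<Rightarrow> 'a^'n" where
  "proj es x = x - (\<Sum>e\<in>es. hform x e *s e)"

text \<open>The form of the components orthogonal to \<open>es\<close>. The Gram matrix of the rows for this form is the
  Schur complement that is left after the directions \<open>es\<close> have been eliminated.\<close>
definition residual :: "('a::conj_div_algebra^'n) set \<Rightarrow> 'a^'n \<Rightarrow> 'a^'n \<Rightarrow> 'a" where
  "residual es x y = hform x y - (\<Sum>e\<in>es. hform x e * hform e y)"

definition energy :: "('a::conj_div_algebra^'n) set \<Rightarrow> 'a^'n \<Rightarrow> real" where
  "energy es x = (\<Sum>e\<in>es. (norm (hform x e))\<^sup>2)"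

lemma hform_proj_left: "hform (proj es x) y = residual es x y"
  by (simp add: proj_def residual_def hform_diff_left hform_sum_left hform_smult_left)

lemma hform_proj_right: "hform x (proj es y) = residual es x y"
  by (simp add: proj_def residual_def hform_diff_right hform_sum_right hform_smult_right hconj_hform)

lemma residual_member:
  assumes "orthonormal es" "e \<in> es"
  shows "residual es x e = 0"
proof -
  have "(\<Sum>f\<in>es. hform x f * hform f e) = (\<Sum>f\<in>es. if f = e then hform x e else 0)"
    using assms by (intro sum.cong) (auto simp: orthonormal_def)
  then show ?thesis using assms by (simp add: residual_def orthonormal_def)
qed

lemma hconj_residual: "hconj (residual es x y) = residual es y x"
  by (simp add: residual_def hconj_sum hconj_mult hconj_hform)

lemma residual_proj:
  assumes "orthonormal es"
  shows "residual es (proj es x) y = residual es x y"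
proof -
  have "hform (proj es x) e = 0" if "e \<in> es" for e
    using that assms by (simp add: hform_proj_left residual_member)
  then show ?thesis by (simp add: residual_def[of es "proj es x"] hform_proj_left)
qed

lemma residual_self_energy: "residual es x x = of_real ((norm x)\<^sup>2 - energy es x)"
proof -
  have "hform x e * hform e x = of_real ((norm (hform x e))\<^sup>2)" for e
    using mult_hconj_self[of "hform x e"] by (simp add: hconj_hform)
  then show ?thesis by (simp add: residual_def hform_self energy_def)
qed

lemma energy_insert: "finite es \<Longrightarrow> e \<notin> es \<Longrightarrow> energy (insert e es) x = (norm (hform x e))\<^sup>2 + energy es x"
  by (simp add: energy_def)

lemma residual_insert:
  "finite es \<Longrightarrow> e \<notin> es \<Longrightarrow> residual (insert e es) x y = residual es x y - hform x e * hform e y"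
  by (simp add: residual_def)

lemma orthonormal_insert:
  assumes "orthonormal es" "hform e e = 1" "\<And>f. f \<in> es \<Longrightarrow> hform e f = 0"
  shows "e \<notin> es" "orthonormal (insert e es)"
proof -
  show "e \<notin> es" using assms by force
  have "hform f e = 0" if "f \<in> es" for f
    using assms(3)[OF that] hconj_hform[of e f] by simp
  with assms \<open>e \<notin> es\<close> show "orthonormal (insert e es)" by (auto simp: orthonormal_def)
qed

lemma residual_shift:
  assumes "orthonormal es" "e \<in> es"
  shows "residual es (x + c *s e) y = residual es x y" "residual es y (x + c *s e) = residual es y x"
proof -
  show *: "residual es y (x + c *s e) = residual es y x" for y
    using residual_member[OF assms, of y] hform_proj_left[of es y, symmetric]
    by (simp add: hform_add_right hform_smult_right)
  show "residual es (x + c *s e) y = residual es x y"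
    by (metis * hconj_residual)
qed

lemma continuous_on_hform [continuous_intros]:
  "continuous_on S f \<Longrightarrow> continuous_on S g \<Longrightarrow> continuous_on S (\<lambda>x. hform (f x) (g x))"
  unfolding hform_def
  by (intro continuous_intros continuous_on_compose2[OF continuous_on_hconj[of UNIV]]) auto

lemma hform_measurable [measurable]:
  "f \<in> borel_measurable M \<Longrightarrow> g \<in> borel_measurable M \<Longrightarrow> (\<lambda>x. hform (f x) (g x)) \<in> borel_measurable M"
  by (rule borel_measurable_continuous_Pair) (auto intro!: continuous_intros)

lemma residual_measurable [measurable]:
  assumes [measurable]: "f \<in> borel_measurable M" "g \<in> borel_measurable M"
  shows "(\<lambda>x. residual es (f x) (g x)) \<in> borel_measurable M"
  unfolding residual_def by measurable

lemma energy_measurable [measurable]: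
  assumes [measurable]: "f \<in> borel_measurable M"
  shows "(\<lambda>x. energy es (f x)) \<in> borel_measurable M"
  unfolding energy_def by measurable

lemma repart_measurable [measurable]: "(repart::'a::conj_div_algebra \<Rightarrow> real) \<in> borel_measurable borel"
  unfolding repart_def by measurable

lemma smult_measurable [measurable]:
  assumes [measurable]: "f \<in> borel_measurable M"
  shows "(\<lambda>x. f x *s (v::'a::conj_div_algebra^'n)) \<in> borel_measurable M"
proof -
  have "continuous_on UNIV (\<lambda>c. c *s v)"
    unfolding vector_scalar_mult_def by (intro continuous_intros continuous_on_vec_lambda)
  from measurable_compose[OF assms borel_measurable_continuous_onI[OF this]] show ?thesis .
qed


section \<open>Translations, Gaussian integrals and averaging along fibres\<close>

lemma nn_integral_lborel_shift:
  assumes [measurable]: "f \<in> borel_measurable borel"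
  shows "(\<integral>\<^sup>+x. f (t + x) \<partial>lborel) = (\<integral>\<^sup>+(x::'b::euclidean_space). f x \<partial>lborel)"
proof -
  have "(\<integral>\<^sup>+x. f x \<partial>lborel) = (\<integral>\<^sup>+x. f x \<partial>distr lborel borel ((+) t))"
    by (simp add: lborel_distr_plus)
  also have "\<dots> = (\<integral>\<^sup>+x. f (t + x) \<partial>lborel)"
    by (rule nn_integral_distr) simp_all
  finally show ?thesis by simp
qed

lemma nn_integral_lborel_affine:
  fixes f :: "'b::euclidean_space \<Rightarrow> ennreal"
  assumes [measurable]: "f \<in> borel_measurable borel" and c: "c \<noteq> 0"
  shows "(\<integral>\<^sup>+x. f x \<partial>lborel) = ennreal (\<bar>c\<bar> ^ DIM('b)) * (\<integral>\<^sup>+x. f (t + c *\<^sub>R x) \<partial>lborel)"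
  by (subst lborel_affine[OF c, of t])
     (simp add: nn_integral_density nn_integral_distr nn_integral_cmult)

interpretation lborel_prod: product_sigma_finite "\<lambda>_. lborel"
  by standard

lemma nn_integral_PiM_affine:
  fixes f :: "('i \<Rightarrow> 'b::euclidean_space) \<Rightarrow> ennreal"
  assumes "finite K" "f \<in> borel_measurable (Pi\<^sub>M K (\<lambda>_. lborel))" "c \<noteq> 0"
  shows "(\<integral>\<^sup>+x. f x \<partial>(Pi\<^sub>M K (\<lambda>_. lborel))) = ennreal (\<bar>c\<bar> ^ (DIM('b) * card K)) *
     (\<integral>\<^sup>+x. f (\<lambda>k\<in>K. t k + c *\<^sub>R x k) \<partial>(Pi\<^sub>M K (\<lambda>_. lborel)))"
  using assms(1,2)
proof (induction K arbitrary: f)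
  case empty
  have "(\<lambda>k\<in>{}. t k + c *\<^sub>R x k) = (\<lambda>_. undefined)" for x by auto
  then show ?case by (simp add: PiM_empty nn_integral_count_space_finite)
next
  case (insert i K f)
  note [measurable] = insert.prems
  let ?P = "Pi\<^sub>M K (\<lambda>_. lborel :: 'b measure)"
  have upd: "(\<lambda>(x, y). x(i := y)) \<in> ?P \<Otimes>\<^sub>M borel \<rightarrow>\<^sub>M Pi\<^sub>M (insert i K) (\<lambda>_. lborel)"
    using measurable_add_dim[of i K "\<lambda>_. lborel :: 'b measure"]
    by (simp cong: measurable_cong_sets)
  have [measurable]: "(\<lambda>(x, y). f (x(i := y))) \<in> borel_measurable (?P \<Otimes>\<^sub>M borel)"
    using measurable_compose[OF upd insert.prems] by (simp add: case_prod_beta')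
  have [measurable]: "(\<lambda>x. f ((\<lambda>k\<in>insert i K. t k + c *\<^sub>R x k))) \<in> borel_measurable (Pi\<^sub>M (insert i K) (\<lambda>_. lborel))"
    by measurable
  have "(\<integral>\<^sup>+x. f x \<partial>(Pi\<^sub>M (insert i K) (\<lambda>_. lborel))) = (\<integral>\<^sup>+ y. (\<integral>\<^sup>+ x. f (x(i := y)) \<partial>?P) \<partial>lborel)"
    by (rule lborel_prod.product_nn_integral_insert_rev) (use insert in auto)
  also have "\<dots> = ennreal (\<bar>c\<bar> ^ DIM('b)) * (\<integral>\<^sup>+ y. (\<integral>\<^sup>+ x. f (x(i := t i + c *\<^sub>R y)) \<partial>?P) \<partial>lborel)"
  proof (rule nn_integral_lborel_affine)
    interpret sigma_finite_measure ?P by (rule lborel_prod.sigma_finite) fact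
    show "(\<lambda>y. \<integral>\<^sup>+ x. f (x(i := y)) \<partial>?P) \<in> borel_measurable borel" by measurable
  qed fact
  also have "\<dots> = ennreal (\<bar>c\<bar> ^ DIM('b)) * (\<integral>\<^sup>+ y. (ennreal (\<bar>c\<bar> ^ (DIM('b) * card K)) *
      (\<integral>\<^sup>+ x. f ((\<lambda>k\<in>K. t k + c *\<^sub>R x k)(i := t i + c *\<^sub>R y)) \<partial>?P)) \<partial>lborel)"
    by (intro arg_cong2[where f="(*)"] nn_integral_cong insert.IH refl) measurable
  also have "\<dots> = ennreal (\<bar>c\<bar> ^ (DIM('b) * card (insert i K))) * (\<integral>\<^sup>+ y. 
      (\<integral>\<^sup>+ x. f ((\<lambda>k\<in>K. t k + c *\<^sub>R x k)(i := t i + c *\<^sub>R y)) \<partial>?P) \<partial>lborel)"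
  proof -
    interpret sigma_finite_measure ?P by (rule lborel_prod.sigma_finite) fact
    have 1: "(\<lambda>(y, x). ((\<lambda>k\<in>K. t k + c *\<^sub>R x k), t i + c *\<^sub>R y)) \<in> borel \<Otimes>\<^sub>M ?P \<rightarrow>\<^sub>M ?P \<Otimes>\<^sub>M borel"
      by measurable
    have [measurable]: "(\<lambda>(y, x). f ((\<lambda>k\<in>K. t k + c *\<^sub>R x k)(i := t i + c *\<^sub>R y)))
        \<in> borel_measurable (borel \<Otimes>\<^sub>M ?P)"
      using measurable_compose[OF measurable_compose[OF 1 upd] insert.prems] by (simp add: case_prod_beta')
    have "ennreal (\<bar>c\<bar> ^ (DIM('b) * card (insert i K))) = ennreal (\<bar>c\<bar> ^ DIM('b)) * ennreal (\<bar>c\<bar> ^ (DIM('b) * card K))"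
      using insert(1,2) by (simp add: power_add ennreal_mult)
    moreover have "(\<lambda>y. \<integral>\<^sup>+ x. f ((\<lambda>k\<in>K. t k + c *\<^sub>R x k)(i := t i + c *\<^sub>R y)) \<partial>?P) \<in> borel_measurable lborel"
      by measurable
    ultimately show ?thesis 
      by (simp only: nn_integral_cmult mult.assoc)
  qed
  also have "(\<integral>\<^sup>+ y. (\<integral>\<^sup>+ x. f ((\<lambda>k\<in>K. t k + c *\<^sub>R x k)(i := t i + c *\<^sub>R y)) \<partial>?P) \<partial>lborel) = 
     (\<integral>\<^sup>+ y. (\<integral>\<^sup>+ x. f (\<lambda>k\<in>insert i K. t k + c *\<^sub>R (x(i := y)) k) \<partial>?P) \<partial>lborel)"
    using insert(2) by (intro nn_integral_cong arg_cong[where f=f]) (auto simp: restrict_def)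
  also have "\<dots> = (\<integral>\<^sup>+x. f (\<lambda>k\<in>insert i K. t k + c *\<^sub>R x k) \<partial>(Pi\<^sub>M (insert i K) (\<lambda>_. lborel)))"
    by (rule lborel_prod.product_nn_integral_insert_rev[symmetric]) (use insert in auto)
  finally show ?case .
qed

lemma nn_integral_gaussian:
  "(\<integral>\<^sup>+(x::'b::euclidean_space). ennreal (exp (- (norm x)\<^sup>2)) \<partial>lborel) = ennreal (pi powr (DIM('b) / 2))"
proof -
  have 1: "(\<integral>\<^sup>+(x::real). ennreal (exp (- x\<^sup>2)) \<partial>lborel) = ennreal (sqrt pi)"
  proof -
    have "has_bochner_integral lborel (\<lambda>x::real. exp (- x\<^sup>2)) (2 *\<^sub>R (sqrt pi / 2))"
      by (rule has_bochner_integral_even_function[OF gaussian_moment_0]) simp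
    then show ?thesis
      by (intro nn_integral_eq_integral[THEN trans])
         (auto simp: has_bochner_integral_iff)
  qed
  have "exp (- (norm x)\<^sup>2) = (\<Prod>b\<in>Basis. exp (- (x \<bullet> b)\<^sup>2))" for x :: 'b
  proof -
    have "(norm x)\<^sup>2 = (\<Sum>b\<in>Basis. (x \<bullet> b)\<^sup>2)"
      by (simp only: power2_norm_eq_inner) (subst euclidean_inner, simp add: power2_eq_square)
    then show ?thesis by (simp add: exp_sum flip: sum_negf)
  qed
  then have "(\<integral>\<^sup>+(x::'b). ennreal (exp (- (norm x)\<^sup>2)) \<partial>lborel)
     = (\<integral>\<^sup>+(x::'b). (\<Prod>b\<in>Basis. ennreal (exp (- (x \<bullet> b)\<^sup>2))) \<partial>lborel)"
    by (simp add: prod_ennreal)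
  also have "\<dots> = (\<Prod>b\<in>(Basis::'b set). (\<integral>\<^sup>+x. ennreal (exp (- x\<^sup>2)) \<partial>lborel))"
    by (rule nn_integral_lborel_prod) auto
  also have "\<dots> = ennreal (sqrt pi ^ DIM('b))"
    by (simp add: 1 ennreal_power)
  also have "sqrt pi ^ DIM('b) = pi powr (DIM('b) / 2)"
    by (simp add: powr_half_sqrt[symmetric] powr_powr flip: powr_realpow)
  finally show ?thesis .
qed

lemma nn_integral_gaussian_scaled:
  assumes "t > 0"
  shows "(\<integral>\<^sup>+(x::'b::euclidean_space). ennreal (exp (- t * (norm (x - x0))\<^sup>2)) \<partial>lborel) =
    ennreal ((pi / t) powr (DIM('b) / 2))"
proof -
  let ?c = "1 / sqrt t"
  have "(\<integral>\<^sup>+(x::'b). ennreal (exp (- t * (norm (x - x0))\<^sup>2)) \<partial>lborel)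
    = ennreal (\<bar>?c\<bar> ^ DIM('b)) * (\<integral>\<^sup>+(x::'b). ennreal (exp (- t * (norm ((x0 + ?c *\<^sub>R x) - x0))\<^sup>2)) \<partial>lborel)"
    using assms by (intro nn_integral_lborel_affine) auto
  also have "(\<lambda>x::'b. exp (- t * (norm ((x0 + ?c *\<^sub>R x) - x0))\<^sup>2)) = (\<lambda>x. exp (- (norm x)\<^sup>2))"
    using assms by (simp add: power_mult_distrib power_divide)
  also have "ennreal (\<bar>?c\<bar> ^ DIM('b)) * (\<integral>\<^sup>+(x::'b). ennreal (exp (- (norm x)\<^sup>2)) \<partial>lborel)
     = ennreal (?c ^ DIM('b) * pi powr (DIM('b) / 2))"
    using assms by (simp add: nn_integral_gaussian ennreal_mult)
  also have "?c ^ DIM('b) * pi powr (DIM('b) / 2) = (pi / t) powr (DIM('b) / 2)"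
    using assms
    by (simp add: powr_divide powr_half_sqrt[symmetric] powr_powr power_one_over flip: powr_realpow)
  finally show ?thesis .
qed

text \<open>The splitting of rows into components rests on this lemma. The elements of \<open>L\<close> act on \<open>M\<close> by measure preserving maps, and the coordinate \<open>c\<close> moves along with the action while \<open>k\<close> does
  not see it. Then the coordinate may be replaced by a variable \<open>a\<close> that is integrated independently
  against the invariant measure \<open>L\<close>, provided that the fibres are weighted by a profile \<open>\<phi>\<close> of total
  mass \<open>\<kappa>\<close>. The proof substitutes \<open>a = c y + b\<close>, exchanges the integrals, and moves the translation
  by \<open>b\<close> from \<open>k\<close> into the profile.\<close>
lemma fibre_average:
  fixes \<phi> :: "'c \<Rightarrow> ennreal" and k :: "'c \<Rightarrow> 'y \<Rightarrow> ennreal"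
  assumes sf: "sigma_finite_measure M" "sigma_finite_measure L"
    and c [measurable]: "c \<in> M \<rightarrow>\<^sub>M L"
    and T [measurable]: "(\<lambda>(b, y). T b y) \<in> L \<Otimes>\<^sub>M M \<rightarrow>\<^sub>M M"
    and add [measurable]: "(\<lambda>(a, b). add a b) \<in> L \<Otimes>\<^sub>M L \<rightarrow>\<^sub>M L"
    and sub [measurable]: "(\<lambda>(a, b). sub a b) \<in> L \<Otimes>\<^sub>M L \<rightarrow>\<^sub>M L"
    and \<phi> [measurable]: "\<phi> \<in> borel_measurable L"
    and k [measurable]: "(\<lambda>(a, y). k a y) \<in> borel_measurable (L \<Otimes>\<^sub>M M)"
    and T_inv: "\<And>b f. b \<in> space L \<Longrightarrow> f \<in> borel_measurable M \<Longrightarrow>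
        (\<integral>\<^sup>+y. f (T b y) \<partial>M) = (\<integral>\<^sup>+y. f y \<partial>M)"
    and add_inv: "\<And>a f. a \<in> space L \<Longrightarrow> f \<in> borel_measurable L \<Longrightarrow>
        (\<integral>\<^sup>+b. f (add a b) \<partial>L) = (\<integral>\<^sup>+b. f b \<partial>L)"
    and k_inv: "\<And>a b y. a \<in> space L \<Longrightarrow> b \<in> space L \<Longrightarrow> y \<in> space M \<Longrightarrow> k a (T b y) = k a y"
    and c_T: "\<And>b y. b \<in> space L \<Longrightarrow> y \<in> space M \<Longrightarrow> c (T b y) = sub (c y) b"
    and add_sub: "\<And>a b. a \<in> space L \<Longrightarrow> b \<in> space L \<Longrightarrow> add (sub a b) b = a"
    and total: "\<And>a. a \<in> space L \<Longrightarrow> (\<integral>\<^sup>+b. \<phi> (sub a b) \<partial>L) = \<kappa>"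
  shows "(\<integral>\<^sup>+y. (\<integral>\<^sup>+a. \<phi> (c y) * k a y \<partial>L) \<partial>M) = \<kappa> * (\<integral>\<^sup>+y. k (c y) y \<partial>M)"
proof -
  interpret M: sigma_finite_measure M by fact
  interpret L: sigma_finite_measure L by fact
  interpret P: pair_sigma_finite L M ..
  have cs: "c y \<in> space L" if "y \<in> space M" for y
    using that by (rule measurable_space[OF c])
  have Ts: "T b y \<in> space M" if "b \<in> space L" "y \<in> space M" for b y
    using that measurable_space[OF T, of "(b, y)"] by (auto simp: space_pair_measure)
  have [measurable]: "(\<lambda>(b, y). k (add (c y) b) y) \<in> borel_measurable (L \<Otimes>\<^sub>M M)"
  proof -
    have "(\<lambda>p. (add (c (snd p)) (fst p), snd p)) \<in> L \<Otimes>\<^sub>M M \<rightarrow>\<^sub>M L \<Otimes>\<^sub>M M"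
      using measurable_compose[OF _ add, of "\<lambda>p. (c (snd p), fst p)" "L \<Otimes>\<^sub>M M"] by simp
    from measurable_compose[OF this k] show ?thesis by (simp add: case_prod_beta')
  qed
  have [measurable]: "(\<lambda>y. k (c y) y) \<in> borel_measurable M"
    using measurable_compose[OF _ k, of "\<lambda>y. (c y, y)" M] by simp
  have [measurable]: "(\<lambda>(b, y). \<phi> (sub (c y) b)) \<in> borel_measurable (L \<Otimes>\<^sub>M M)"
  proof -
    have "(\<lambda>p. sub (c (snd p)) (fst p)) \<in> L \<Otimes>\<^sub>M M \<rightarrow>\<^sub>M L"
      using measurable_compose[OF _ sub, of "\<lambda>p. (c (snd p), fst p)" "L \<Otimes>\<^sub>M M"] by simp
    from measurable_compose[OF this \<phi>] show ?thesis by (simp add: case_prod_beta')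
  qed
  have "(\<integral>\<^sup>+y. (\<integral>\<^sup>+a. \<phi> (c y) * k a y \<partial>L) \<partial>M) = (\<integral>\<^sup>+y. (\<integral>\<^sup>+b. \<phi> (c y) * k (add (c y) b) y \<partial>L) \<partial>M)"
  proof (rule nn_integral_cong)
    fix y assume y: "y \<in> space M"
    have "(\<lambda>a. k a y) \<in> borel_measurable L"
      using measurable_compose[OF _ k, of "\<lambda>a. (a, y)" L] y by simp
    then show "(\<integral>\<^sup>+a. \<phi> (c y) * k a y \<partial>L) = (\<integral>\<^sup>+b. \<phi> (c y) * k (add (c y) b) y \<partial>L)"
      using cs[OF y] by (subst add_inv[of "c y" "\<lambda>a. \<phi> (c y) * k a y"]) auto
  qed
  also have "\<dots> = (\<integral>\<^sup>+b. (\<integral>\<^sup>+y. \<phi> (c y) * k (add (c y) b) y \<partial>M) \<partial>L)"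
    by (rule P.Fubini') measurable
  also have "\<dots> = (\<integral>\<^sup>+b. (\<integral>\<^sup>+y. \<phi> (sub (c y) b) * k (c y) y \<partial>M) \<partial>L)"
  proof (rule nn_integral_cong)
    fix b assume b: "b \<in> space L"
    have 1: "(\<lambda>y. k (add (c y) b) y) \<in> borel_measurable M"
      using measurable_compose[OF measurable_Pair1'[OF b] \<open>(\<lambda>(b, y). k (add (c y) b) y) \<in> borel_measurable (L \<Otimes>\<^sub>M M)\<close>]
      by simp
    have "(\<integral>\<^sup>+y. \<phi> (c y) * k (add (c y) b) y \<partial>M)
      = (\<integral>\<^sup>+y. \<phi> (c (T b y)) * k (add (c (T b y)) b) (T b y) \<partial>M)"
      using 1 measurable_compose[OF c \<phi>] by (intro T_inv[OF b, symmetric]) (rule borel_measurable_times_ennreal)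
    also have "\<dots> = (\<integral>\<^sup>+y. \<phi> (sub (c y) b) * k (c y) y \<partial>M)"
      by (intro nn_integral_cong) (simp add: b c_T add_sub cs k_inv)
    finally show "(\<integral>\<^sup>+y. \<phi> (c y) * k (add (c y) b) y \<partial>M) = (\<integral>\<^sup>+y. \<phi> (sub (c y) b) * k (c y) y \<partial>M)" .
  qed
  also have "\<dots> = (\<integral>\<^sup>+y. (\<integral>\<^sup>+b. \<phi> (sub (c y) b) * k (c y) y \<partial>L) \<partial>M)"
    by (rule P.Fubini'[symmetric]) measurable
  also have "\<dots> = (\<integral>\<^sup>+y. \<kappa> * k (c y) y \<partial>M)"
  proof (rule nn_integral_cong)
    fix y assume y: "y \<in> space M"
    have "(\<lambda>b. \<phi> (sub (c y) b)) \<in> borel_measurable L"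
      using measurable_compose[OF measurable_Pair2'[OF y] \<open>(\<lambda>(b, y). \<phi> (sub (c y) b)) \<in> borel_measurable (L \<Otimes>\<^sub>M M)\<close>]
      by simp
    then show "(\<integral>\<^sup>+b. \<phi> (sub (c y) b) * k (c y) y \<partial>L) = \<kappa> * k (c y) y"
      by (simp add: nn_integral_multc total cs y)
  qed
  also have "\<dots> = \<kappa> * (\<integral>\<^sup>+y. k (c y) y \<partial>M)"
    by (rule nn_integral_cmult) measurable
  finally show ?thesis .
qed

text \<open>If the rest of the integrand is invariant along a direction, then the integral depends on the profile
  along this direction only through its total mass. This replaces a choice of orthonormal coordinates.\<close>
lemma profile_exchange:
  fixes \<phi>1 \<phi>2 :: "'b::euclidean_space \<Rightarrow> ennreal" and h :: "'e::euclidean_space \<Rightarrow> ennreal"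
  assumes [measurable]: "\<phi>1 \<in> borel_measurable borel" "\<phi>2 \<in> borel_measurable borel"
    "h \<in> borel_measurable borel" "c \<in> borel_measurable borel" "\<tau> \<in> borel_measurable borel"
    and c: "\<And>b y. c (y + \<tau> b) = c y - b" and h: "\<And>b y. h (y + \<tau> b) = h y"
    and total: "\<And>a. (\<integral>\<^sup>+b. \<phi>2 (a - b) \<partial>lborel) = \<kappa>"
  shows "(\<integral>\<^sup>+a. \<phi>1 a \<partial>lborel) * (\<integral>\<^sup>+y. \<phi>2 (c y) * h y \<partial>lborel) = \<kappa> * (\<integral>\<^sup>+y. \<phi>1 (c y) * h y \<partial>lborel)"
proof -
  have "(\<integral>\<^sup>+y. (\<integral>\<^sup>+a. \<phi>2 (c y) * (\<phi>1 a * h y) \<partial>lborel) \<partial>lborel) = \<kappa> * (\<integral>\<^sup>+y. \<phi>1 (c y) * h y \<partial>lborel)"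
  proof (rule fibre_average[where T="\<lambda>b y. y + \<tau> b" and add="(+)" and sub="(-)"])
    show "(\<integral>\<^sup>+y. f (y + \<tau> b) \<partial>lborel) = (\<integral>\<^sup>+y. f y \<partial>lborel)"
      if "f \<in> borel_measurable lborel" for b and f :: "'e \<Rightarrow> ennreal"
      using nn_integral_lborel_shift[of f "\<tau> b"] that by (simp add: add.commute)
    show "(\<integral>\<^sup>+b. f (a + b) \<partial>lborel) = (\<integral>\<^sup>+b. f b \<partial>lborel)"
      if "f \<in> borel_measurable lborel" for a and f :: "'b \<Rightarrow> ennreal"
      using nn_integral_lborel_shift[of f a] that by simp
  qed (auto intro: lborel.sigma_finite_measure_axioms simp: c h total)
  moreover have "(\<integral>\<^sup>+y. (\<integral>\<^sup>+a. \<phi>2 (c y) * (\<phi>1 a * h y) \<partial>lborel) \<partial>lborel) =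
    (\<integral>\<^sup>+y. (\<integral>\<^sup>+a. \<phi>1 a \<partial>lborel) * (\<phi>2 (c y) * h y) \<partial>lborel)"
    by (intro nn_integral_cong) (simp add: nn_integral_cmult nn_integral_multc mult_ac)
  moreover have "\<dots> = (\<integral>\<^sup>+a. \<phi>1 a \<partial>lborel) * (\<integral>\<^sup>+y. \<phi>2 (c y) * h y \<partial>lborel)"
    by (rule nn_integral_cmult) measurable
  ultimately show ?thesis by simp
qed


section \<open>The law of the squared length of a residual\<close>

lemma repart_residual: "repart (residual es x x) = (norm x)\<^sup>2 - energy es x"
  by (subst residual_self_energy) (rule repart_of_real)

lemma energy_shift:
  assumes "\<And>f. f \<in> es \<Longrightarrow> hform e f = 0"
  shows "energy es (x + c *s e) = energy es x"
  unfolding energy_def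
  by (intro sum.cong refl) (simp add: hform_add_left hform_smult_left assms)

lemma energy_scale:
  fixes es :: "('a::conj_div_algebra^'n) set"
  shows "energy es (c *\<^sub>R x) = c\<^sup>2 * energy es x"
proof -
  have "hform (c *\<^sub>R x) e = c *\<^sub>R hform x e" for e :: "'a^'n"
    by (simp add: hform_def scaleR_sum_right)
  then show ?thesis by (simp add: energy_def power_mult_distrib sum_distrib_left)
qed

text \<open>Each of the directions in \<open>es\<close> contributes the quotient of the Gaussian integrals with parameters \<open>t\<close>
  and \<open>1\<close>, by an exchange of profiles.\<close>
lemma energy_profile_scaling:
  fixes es :: "('a::conj_div_algebra^'n) set" and h :: "'a^'n \<Rightarrow> ennreal"
  assumes "orthonormal es" and [measurable]: "h \<in> borel_measurable borel"
    and "\<And>e y c. e \<in> es \<Longrightarrow> h (y + c *s e) = h y" and "t > 0"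
  shows "(\<integral>\<^sup>+y. ennreal (exp (- t * energy es y)) * h y \<partial>lborel) =
    ennreal (t powr - (DIM('a) * card es / 2)) * (\<integral>\<^sup>+y. ennreal (exp (- energy es y)) * h y \<partial>lborel)"
proof -
  have "finite es" using assms(1) by (simp add: orthonormal_def)
  then show ?thesis using assms(1-3)
  proof (induction es arbitrary: h)
    case empty
    then show ?case using \<open>t > 0\<close> by (simp add: energy_def)
  next
    case (insert e es h)
    note [measurable] = insert.prems(2)
    have on: "orthonormal es" using insert.prems(1) by (auto simp: orthonormal_def)
    have he: "hform e e = 1" "\<And>f. f \<in> es \<Longrightarrow> hform e f = 0" "\<And>f. f \<in> es \<Longrightarrow> hform f e = 0"
      using insert.prems(1) insert.hyps(2) by (auto simp: orthonormal_def)
    have split: "ennreal (exp (- (r * (a + b)))) = ennreal (exp (- (r * a))) * ennreal (exp (- (r * b)))" for r a b :: real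
      by (simp add: mult_exp_exp distrib_left flip: ennreal_mult)
    let ?p = "real DIM('a) / 2" and ?g = "\<lambda>y. ennreal (exp (- t * energy es y)) * h y"
    let ?A = "\<integral>\<^sup>+y. ennreal (exp (- (norm (hform y e))\<^sup>2)) * ?g y \<partial>lborel"
    let ?B = "\<integral>\<^sup>+y. ennreal (exp (- t * (norm (hform y e))\<^sup>2)) * ?g y \<partial>lborel"
    have "(\<integral>\<^sup>+(a::'a). ennreal (exp (- t * (norm a)\<^sup>2)) \<partial>lborel) * ?A = ennreal (pi powr ?p) * ?B"
    proof (rule profile_exchange[where \<tau>="\<lambda>b. (- b) *s e"])
      show "hform (y + (- b) *s e) e = hform y e - b" for b y
        by (simp add: hform_add_left hform_smult_left he)
      show "?g (y + (- b) *s e) = ?g y" for b y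
        by (simp add: energy_shift he(2) insert.prems(3))
      show "(\<integral>\<^sup>+(b::'a). ennreal (exp (- (norm (a - b))\<^sup>2)) \<partial>lborel) = ennreal (pi powr ?p)" for a
        using nn_integral_gaussian_scaled[of 1 a] by (simp add: norm_minus_commute)
    qed measurable
    moreover have "(\<integral>\<^sup>+(a::'a). ennreal (exp (- t * (norm a)\<^sup>2)) \<partial>lborel) = ennreal (pi powr ?p) * ennreal (t powr - ?p)"
      using nn_integral_gaussian_scaled[of t "0::'a"] \<open>t > 0\<close>
      by (simp add: powr_divide powr_minus_divide flip: ennreal_mult)
    ultimately have "ennreal (pi powr ?p) * ?B = ennreal (pi powr ?p) * (ennreal (t powr - ?p) * ?A)"
      by (simp add: mult.assoc)
    then have B: "?B = ennreal (t powr - ?p) * ?A"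
      by (subst (asm) ennreal_mult_cancel_left) auto
    have "(\<integral>\<^sup>+y. ennreal (exp (- t * energy (insert e es) y)) * h y \<partial>lborel) = ?B"
      by (intro nn_integral_cong) (simp add: energy_insert insert.hyps split mult.assoc)
    also note B
    also have "?A = (\<integral>\<^sup>+y. ennreal (exp (- t * energy es y)) * (ennreal (exp (- (norm (hform y e))\<^sup>2)) * h y) \<partial>lborel)"
      by (simp add: mult_ac)
    also have "\<dots> = ennreal (t powr - (DIM('a) * card es / 2)) *
       (\<integral>\<^sup>+y. ennreal (exp (- energy es y)) * (ennreal (exp (- (norm (hform y e))\<^sup>2)) * h y) \<partial>lborel)"
      by (rule insert.IH[OF on]) (auto simp: hform_add_left hform_smult_left he(3) insert.prems(3))
    also have "(\<integral>\<^sup>+y. ennreal (exp (- energy es y)) * (ennreal (exp (- (norm (hform y e))\<^sup>2)) * h y) \<partial>lborel)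
       = (\<integral>\<^sup>+y. ennreal (exp (- energy (insert e es) y)) * h y \<partial>lborel)"
      using split[of 1] by (intro nn_integral_cong) (simp add: energy_insert insert.hyps mult_ac)
    also have "ennreal (t powr - ?p) * (ennreal (t powr - (DIM('a) * card es / 2)) * (\<integral>\<^sup>+y. ennreal (exp (- energy (insert e es) y)) * h y \<partial>lborel))
       = ennreal (t powr - (DIM('a) * card (insert e es) / 2)) * (\<integral>\<^sup>+y. ennreal (exp (- energy (insert e es) y)) * h y \<partial>lborel)"
      using insert.hyps
      by (simp add: add_divide_distrib distrib_left powr_add[symmetric] flip: mult.assoc ennreal_mult)
    finally show ?case .
  qed
qed

lemma power_law_density:
  fixes R :: "real measure"
  assumes sets [measurable_cong]: "sets R = sets borel" and p: "p > 0" and a: "\<alpha> \<ge> 0"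
    and pos: "\<And>s. s > 0 \<Longrightarrow> emeasure R {..s} = ennreal (\<alpha> * s powr p)"
    and zero: "emeasure R {..0} = 0"
  shows "R = density lborel (\<lambda>s. ennreal (\<alpha> * p * (indicator {0<..} s * s powr (p - 1))))"
proof (rule measure_eqI_generator_eq[where E="range atMost" and \<Omega>=UNIV and A="\<lambda>i. {..real i}"])
  have eq: "(sets borel :: real set set) = sigma_sets UNIV (range atMost)"
    unfolding borel_eq_atMost by (rule sets_measure_of) simp
  then show "sets R = sigma_sets UNIV (range atMost)"
    "sets (density lborel (\<lambda>s. ennreal (\<alpha> * p * (indicator {0<..} s * s powr (p - 1))))) = sigma_sets UNIV (range atMost)"
    by (simp_all add: sets)
  show "Int_stable (range (atMost :: real \<Rightarrow> _))"
    by (auto simp: Int_stable_def Int_atMost)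
  show "(\<Union>i. {..real i}) = UNIV"
    by (auto intro: real_arch_simple)
  show "emeasure R {..real i} \<noteq> \<infinity>" for i
    using pos[of "real i"] zero by (cases "i = 0") auto
  fix X assume "X \<in> range (atMost :: real \<Rightarrow> _)"
  then obtain s where X: "X = {..s}" by auto
  have "emeasure (density lborel (\<lambda>s. ennreal (\<alpha> * p * (indicator {0<..} s * s powr (p - 1))))) {..s}
     = ennreal (\<alpha> * p) * (\<integral>\<^sup>+x. indicator {0..s} x * x powr (p - 1) \<partial>lborel)"
    using a p
    by (subst emeasure_density, simp, simp, subst nn_integral_cmult[symmetric], simp)
       (auto simp: indicator_def ennreal_mult intro!: nn_integral_cong)
  also have "\<dots> = emeasure R {..s}"
  proof (cases "s > 0")
    case True
    have "(\<integral>\<^sup>+x. indicator {0..s} x * x powr (p - 1) \<partial>lborel) = ennreal (s powr (p - 1 + 1) / (p - 1 + 1))"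
      by (rule nn_integral_has_integral_lebesgue) (use True p has_integral_powr_from_0[of "p - 1" s] in auto)
    then show ?thesis using True p a pos[of s] by (simp flip: ennreal_mult)
  next
    case False
    have "emeasure R {..s} \<le> emeasure R {..0}" using False by (intro emeasure_mono) auto
    moreover have "(\<lambda>x. ennreal (indicator {0..s} x * x powr (p - 1))) = (\<lambda>x. 0)"
      using False by (auto simp: indicator_def fun_eq_iff)
    ultimately show ?thesis using zero by simp
  qed
  finally show "emeasure R X = emeasure (density lborel (\<lambda>s. ennreal (\<alpha> * p * (indicator {0<..} s * s powr (p - 1))))) X"
    by (simp add: X)
qed auto

text \<open>The squared length of the component orthogonal to \<open>es\<close> follows a power law, because its law is
  homogeneous: dilating the whole space by \<open>sqrt t\<close> and undoing the effect on the weight along \<open>es\<close> by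
  \<open>energy_profile_scaling\<close> leaves the power of \<open>t\<close> that belongs to the orthogonal complement. Together
  the squared length and the energy give \<open>(norm x)\<^sup>2\<close>, so that a Gaussian integral over the whole space
  determines the constant.\<close>
theorem residual_norm_law:
  fixes es :: "('a::conj_div_algebra^'n) set" and g :: "real \<Rightarrow> ennreal"
  assumes on: "orthonormal es" and less: "card es < CARD('n)"
    and [measurable]: "g \<in> borel_measurable borel"
  defines "p \<equiv> real DIM('a) * (real CARD('n) - real (card es)) / 2"
  shows "(\<integral>\<^sup>+x. ennreal (exp (- energy es x)) * g (repart (residual es x x)) \<partial>lborel) =
    ennreal (pi powr (real DIM('a) * real CARD('n) / 2) / Gamma p) *
    (\<integral>\<^sup>+s. ennreal (indicator {0<..} s * s powr (p - 1)) * g s \<partial>lborel)"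
proof -
  define q where "q x = repart (residual es x x)" for x
  have q [measurable]: "q \<in> borel_measurable borel" unfolding q_def by measurable
  have q_eq: "q x = (norm x)\<^sup>2 - energy es x" for x by (simp add: q_def repart_residual)
  have q_scale: "q (c *\<^sub>R x) = c\<^sup>2 * q x" for c x by (simp add: q_eq energy_scale power_mult_distrib algebra_simps)
  have q_shift: "q (y + c *s e) = q y" if "e \<in> es" for e y c
    using residual_shift[OF on that] by (simp add: q_def)
  have p: "p > 0" using less by (simp add: p_def)
  define V where "V = density (lborel :: ('a^'n) measure) (\<lambda>x. ennreal (exp (- energy es x)))"
  define R where "R = distr V borel q"
  have sets_R [measurable_cong]: "sets R = sets borel" by (simp add: R_def)
  have R: "(\<integral>\<^sup>+s. h s \<partial>R) = (\<integral>\<^sup>+x. ennreal (exp (- energy es x)) * h (q x) \<partial>lborel)"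
    if [measurable]: "h \<in> borel_measurable borel" for h
    by (simp add: R_def V_def nn_integral_distr nn_integral_density)
  have homog: "(\<integral>\<^sup>+s. h s \<partial>R) = ennreal (t powr p) * (\<integral>\<^sup>+s. h (t * s) \<partial>R)"
    if [measurable]: "h \<in> borel_measurable borel" and t: "t > 0" for h t
  proof -
    let ?k = "real DIM('a) * card es / 2" and ?n = "real DIM('a) * CARD('n) / 2"
    have "(\<integral>\<^sup>+s. h s \<partial>R) = (\<integral>\<^sup>+x. ennreal (exp (- energy es x)) * h (q x) \<partial>lborel)"
      by (rule R) measurable
    also have "\<dots> = ennreal (\<bar>sqrt t\<bar> ^ DIM('a^'n)) *
        (\<integral>\<^sup>+x. ennreal (exp (- energy es (0 + sqrt t *\<^sub>R x))) * h (q (0 + sqrt t *\<^sub>R x)) \<partial>lborel)"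
      using t by (intro nn_integral_lborel_affine) auto
    also have "\<bar>sqrt t\<bar> ^ DIM('a^'n) = t powr ?n"
      using t by (simp add: powr_half_sqrt[symmetric] powr_powr mult.commute flip: powr_realpow)
    also have "(\<integral>\<^sup>+x. ennreal (exp (- energy es (0 + sqrt t *\<^sub>R x))) * h (q (0 + sqrt t *\<^sub>R x)) \<partial>lborel)
       = (\<integral>\<^sup>+x. ennreal (exp (- t * energy es x)) * h (t * q x) \<partial>lborel)"
      using t by (simp add: energy_scale q_scale)
    also have "\<dots> = ennreal (t powr - ?k) * (\<integral>\<^sup>+x. ennreal (exp (- energy es x)) * h (t * q x) \<partial>lborel)"
      using energy_profile_scaling[OF on _ _ t, of "\<lambda>x. h (t * q x)"] by (simp add: q_shift)
    also have "(\<integral>\<^sup>+x. ennreal (exp (- energy es x)) * h (t * q x) \<partial>lborel) = (\<integral>\<^sup>+s. h (t * s) \<partial>R)"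
      by (rule R[symmetric]) measurable
    also have "ennreal (t powr ?n) * (ennreal (t powr - ?k) * (\<integral>\<^sup>+s. h (t * s) \<partial>R)) =
       ennreal (t powr p) * (\<integral>\<^sup>+s. h (t * s) \<partial>R)"
      by (simp add: p_def powr_add[symmetric] right_diff_distrib diff_divide_distrib flip: mult.assoc ennreal_mult)
    finally show ?thesis .
  qed
  have gauss: "(\<integral>\<^sup>+s. ennreal (exp (- s)) \<partial>R) = ennreal (pi powr (real DIM('a) * real CARD('n) / 2))"
  proof -
    have "(\<integral>\<^sup>+s. ennreal (exp (- s)) \<partial>R) = (\<integral>\<^sup>+(x::'a^'n). ennreal (exp (- (norm x)\<^sup>2)) \<partial>lborel)"
      by (subst R) (auto intro!: nn_integral_cong simp: q_eq simp flip: ennreal_mult exp_add)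
    then show ?thesis by (simp add: nn_integral_gaussian mult.commute)
  qed
  have fin: "emeasure R {..1} < \<infinity>"
  proof -
    have "emeasure R {..1} = (\<integral>\<^sup>+s. indicator {..1} s \<partial>R)"
      by simp
    also have "\<dots> \<le> (\<integral>\<^sup>+s. ennreal (exp 1) * ennreal (exp (- s)) \<partial>R)"
      by (intro nn_integral_mono) (auto simp: indicator_def simp flip: ennreal_mult exp_add)
    also have "\<dots> = ennreal (exp 1) * ennreal (pi powr (real DIM('a) * real CARD('n) / 2))"
      by (subst nn_integral_cmult) (auto simp: gauss)
    finally show ?thesis by (rule order.strict_trans1) (simp flip: ennreal_mult)
  qed
  define \<alpha> where "\<alpha> = measure R {..1}"
  have \<alpha>: "emeasure R {..1} = ennreal \<alpha>" "\<alpha> \<ge> 0"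
    using fin by (auto simp: \<alpha>_def emeasure_eq_ennreal_measure)
  have cdf: "emeasure R {..s} = ennreal (\<alpha> * s powr p)" if "s > 0" for s
  proof -
    have "emeasure R {..s} = (\<integral>\<^sup>+x. indicator {..s} x \<partial>R)" by simp
    also have "\<dots> = ennreal (s powr p) * (\<integral>\<^sup>+x. indicator {..s} (s * x) \<partial>R)"
      using that by (intro homog) auto
    also have "(\<lambda>x. indicator {..s} (s * x) :: ennreal) = indicator {..1}"
      using that by (auto simp: indicator_def fun_eq_iff)
    finally show ?thesis by (simp add: \<alpha> mult.commute flip: ennreal_mult)
  qed
  \<comment> \<open>the mass of the half-line is finite, and homogeneity multiplies it by \<open>2 powr p\<close>\<close>
  have zero: "emeasure R {..0} = 0"
  proof -
    have "emeasure R {..0} = (\<integral>\<^sup>+x. indicator {..0} x \<partial>R)" by simp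
    also have "\<dots> = ennreal (2 powr p) * (\<integral>\<^sup>+x. indicator {..0} (2 * x) \<partial>R)"
      by (intro homog) auto
    also have "(\<lambda>x. indicator {..0} (2 * x :: real) :: ennreal) = indicator {..0}"
      by (auto simp: indicator_def fun_eq_iff)
    finally have eq: "emeasure R {..0} = ennreal (2 powr p) * emeasure R {..0}" by simp
    have "emeasure R {..0} \<le> emeasure R {..1}" by (intro emeasure_mono) auto
    then obtain c where c: "emeasure R {..0} = ennreal c" "c \<ge> 0"
      using fin by (metis ennreal_cases le_less_trans less_irrefl infinity_ennreal_def)
    then have "c = 2 powr p * c" using eq by (simp flip: ennreal_mult)
    then have "c = 0" using p by (simp add: powr_eq_one_iff_gen)
    then show ?thesis using c by simp
  qed
  have dens: "R = density lborel (\<lambda>s. ennreal (\<alpha> * p * (indicator {0<..} s * s powr (p - 1))))"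
    using sets_R p \<alpha>(2) cdf zero by (rule power_law_density)
  have int: "(\<integral>\<^sup>+s. h s \<partial>R) = ennreal (\<alpha> * p) * (\<integral>\<^sup>+s. ennreal (indicator {0<..} s * s powr (p - 1)) * h s \<partial>lborel)"
    if [measurable]: "h \<in> borel_measurable borel" for h
    by (subst dens, subst nn_integral_density, simp, simp)
       (use p \<alpha>(2) in \<open>simp add: ennreal_mult mult.assoc nn_integral_cmult\<close>)
  have "ennreal (pi powr (real DIM('a) * real CARD('n) / 2)) = ennreal (\<alpha> * p) *
     (\<integral>\<^sup>+s. ennreal (indicator {0<..} s * s powr (p - 1)) * ennreal (exp (- s)) \<partial>lborel)"
    using int[of "\<lambda>s. ennreal (exp (- s))"] gauss by simp
  also have "(\<integral>\<^sup>+s. ennreal (indicator {0<..} s * s powr (p - 1)) * ennreal (exp (- s)) \<partial>lborel)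
     = (\<integral>\<^sup>+s. ennreal (indicator {0..} s * s powr (p - 1) / exp s) \<partial>lborel)"
    by (intro nn_integral_cong) (auto simp: indicator_def exp_minus field_simps simp flip: ennreal_mult)
  also have "\<dots> = ennreal (Gamma p)" using Gamma_conv_nn_integral_real[OF p] by simp
  finally have "pi powr (real DIM('a) * real CARD('n) / 2) = \<alpha> * p * Gamma p"
    using p \<alpha>(2) by (simp flip: ennreal_mult)
  then have const: "\<alpha> * p = pi powr (real DIM('a) * real CARD('n) / 2) / Gamma p"
    using Gamma_real_pos[OF p] by (simp add: field_simps)
  show ?thesis using R[of g] int[of g] by (simp add: const q_def)
qed


section \<open>Integration over Hermitian matrices by Schur complements\<close>

lemma borel_measurable_vecI:
  fixes f :: "'w \<Rightarrow> 'b::euclidean_space^'k"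
  assumes "\<And>i. (\<lambda>x. f x $ i) \<in> borel_measurable M"
  shows "f \<in> borel_measurable M"
proof (rule borel_measurable_euclidean_space[THEN iffD2], rule ballI)
  fix b :: "'b^'k" assume "b \<in> Basis"
  then obtain i c where b: "b = axis i c" by (auto simp: Basis_vec_def)
  have "(\<lambda>x. f x $ i \<bullet> c) \<in> borel_measurable M" using assms by measurable
  then show "(\<lambda>x. f x \<bullet> b) \<in> borel_measurable M" by (simp add: b inner_axis)
qed

lemma borel_measurable_vec_nth [measurable]:
  fixes f :: "'w \<Rightarrow> 'b::euclidean_space^'k"
  assumes [measurable]: "f \<in> borel_measurable M"
  shows "(\<lambda>x. f x $ i) \<in> borel_measurable M"
  by (rule measurable_compose[OF assms borel_measurable_continuous_onI])
     (intro continuous_intros)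

definition pairs_above :: "'m::linorder set \<Rightarrow> ('m \<times> 'm) set" where
  "pairs_above I = {(i, j). i \<in> I \<and> j \<in> I \<and> i < j}"

text \<open>The induction runs over the index set, so matrices indexed by a subset \<open>I\<close> are embedded into the full
  matrix type by zeros.\<close>
definition hermitian_on ::
    "('m::{finite,linorder}) set \<Rightarrow> ('m \<Rightarrow> real) \<Rightarrow> ('m \<times> 'm \<Rightarrow> 'a) \<Rightarrow> 'a::conj_div_algebra^('m::{finite,linorder})^('m::{finite,linorder})" where
  "hermitian_on I d u = (\<chi> i j. if i \<in> I \<and> j \<in> I then hermitian_of (d, u) $ i $ j else 0)"

text \<open>For the full index set this is the integral with respect to \<open>hermitian_lborel\<close>. As an iterated
  integral it avoids any question of sigma-finiteness of image measures.\<close>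
definition hermitian_integral ::
    "('m::{finite,linorder}) set \<Rightarrow> ('a::conj_div_algebra^('m::{finite,linorder})^('m::{finite,linorder}) \<Rightarrow> ennreal) \<Rightarrow> ennreal" where
  "hermitian_integral I g = (\<integral>\<^sup>+d. (\<integral>\<^sup>+u. g (hermitian_on I d u)
     \<partial>(\<Pi>\<^sub>M p\<in>pairs_above I. lborel)) \<partial>(\<Pi>\<^sub>M i\<in>I. lborel))"

lemma hermitian_on_nth:
  "hermitian_on I d u $ i $ j = (if i \<in> I \<and> j \<in> I then
     if i = j then of_real (d i) else if i < j then u (i, j) else hconj (u (j, i)) else 0)"
  by (simp add: hermitian_on_def hermitian_of_nth)

lemma hermitian_on_measurable:
  assumes d [measurable]: "d \<in> N \<rightarrow>\<^sub>M (\<Pi>\<^sub>M i\<in>I. lborel)"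
    and u [measurable]: "u \<in> N \<rightarrow>\<^sub>M (\<Pi>\<^sub>M p\<in>pairs_above I. lborel)"
  shows "(\<lambda>x. hermitian_on I (d x) (u x)) \<in> borel_measurable N"
proof (intro borel_measurable_vecI)
  fix i j
  have D: "(\<lambda>x. d x i) \<in> borel_measurable N" if "i \<in> I" for i
    using measurable_compose[OF d measurable_component_singleton[OF that]] by simp
  have U: "(\<lambda>x. u x p) \<in> borel_measurable N" if "p \<in> pairs_above I" for p
    using measurable_compose[OF u measurable_component_singleton[OF that]] by simp
  show "(\<lambda>x. hermitian_on I (d x) (u x) $ i $ j) \<in> borel_measurable N"
  proof (cases "i \<in> I \<and> j \<in> I")
    case True
    then show ?thesis
      using D[of i] U[of "(i, j)"] U[of "(j, i)"]
      by (cases "i = j"; cases "i < j") (simp_all add: hermitian_on_nth pairs_above_def)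
  next
    case False
    then have "(\<lambda>x. hermitian_on I (d x) (u x) $ i $ j) = (\<lambda>_. 0)"
      by (auto simp: fun_eq_iff hermitian_on_nth)
    then show ?thesis by simp
  qed
qed

lemma hermitian_integral_measurable:
  fixes f :: "'w \<Rightarrow> 'a::conj_div_algebra^('m::{finite,linorder})^('m::{finite,linorder}) \<Rightarrow> ennreal"
  assumes f: "(\<lambda>(x, F). f x F) \<in> borel_measurable (N \<Otimes>\<^sub>M borel)"
  shows "(\<lambda>x. hermitian_integral I (f x)) \<in> borel_measurable N"
proof -
  let ?D = "\<Pi>\<^sub>M i\<in>I. lborel :: real measure" and ?U = "\<Pi>\<^sub>M p\<in>pairs_above I. lborel :: 'a measure"
  have "(\<lambda>p. (fst (fst p), hermitian_on I (snd (fst p)) (snd p))) \<in> (N \<Otimes>\<^sub>M ?D) \<Otimes>\<^sub>M ?U \<rightarrow>\<^sub>M N \<Otimes>\<^sub>M borel"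
    by (intro measurable_Pair hermitian_on_measurable) measurable
  from measurable_compose[OF this f]
  have 1: "(\<lambda>(z, u). f (fst z) (hermitian_on I (snd z) u)) \<in> borel_measurable ((N \<Otimes>\<^sub>M ?D) \<Otimes>\<^sub>M ?U)"
    by (simp add: case_prod_beta')
  have 2: "(\<lambda>z. \<integral>\<^sup>+u. f (fst z) (hermitian_on I (snd z) u) \<partial>?U) \<in> borel_measurable (N \<Otimes>\<^sub>M ?D)"
    by (rule sigma_finite_measure.borel_measurable_nn_integral[OF lborel_prod.sigma_finite 1]) simp
  have "(\<lambda>(x, d). \<integral>\<^sup>+u. f x (hermitian_on I d u) \<partial>?U) \<in> borel_measurable (N \<Otimes>\<^sub>M ?D)"
    using 2 by (simp add: case_prod_beta')
  then show ?thesis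
    unfolding hermitian_integral_def
    by (rule sigma_finite_measure.borel_measurable_nn_integral[OF lborel_prod.sigma_finite, rotated]) simp
qed

lemma hermitian_integral_cong:
  assumes "\<And>d u. f (hermitian_on I d u) = g (hermitian_on I d u)"
  shows "hermitian_integral I f = hermitian_integral I g"
  by (simp add: hermitian_integral_def assms)

lemma hermitian_integral_cmult:
  assumes [measurable]: "g \<in> borel_measurable borel"
  shows "hermitian_integral I (\<lambda>F. c * g F) = c * hermitian_integral I g"
proof -
  have 1: "(\<lambda>(d, u). g (hermitian_on I d u))
    \<in> borel_measurable ((\<Pi>\<^sub>M i\<in>I. lborel) \<Otimes>\<^sub>M (\<Pi>\<^sub>M p\<in>pairs_above I. lborel))"
    using measurable_compose[OF hermitian_on_measurable assms, of fst _ _ snd]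
    by (simp add: case_prod_beta')
  have [measurable]: "(\<lambda>u. g (hermitian_on I d u)) \<in> borel_measurable (\<Pi>\<^sub>M p\<in>pairs_above I. lborel)"
    if "d \<in> space (\<Pi>\<^sub>M i\<in>I. lborel)" for d
    by (rule measurable_compose[OF hermitian_on_measurable assms]) (use that in auto)
  have "hermitian_integral I (\<lambda>F. c * g F) = (\<integral>\<^sup>+d. c * (\<integral>\<^sup>+u. g (hermitian_on I d u)
     \<partial>(\<Pi>\<^sub>M p\<in>pairs_above I. lborel)) \<partial>(\<Pi>\<^sub>M i\<in>I. lborel))"
    unfolding hermitian_integral_def by (intro nn_integral_cong nn_integral_cmult) simp
  also have "\<dots> = c * hermitian_integral I g"
    unfolding hermitian_integral_def
    by (intro nn_integral_cmult sigma_finite_measure.borel_measurable_nn_integral[OF lborel_prod.sigma_finite] 1) simp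
  finally show ?thesis .
qed

lemma hermitian_integral_translate:
  fixes T :: "'a::conj_div_algebra^('m::{finite,linorder})^('m::{finite,linorder})"
  assumes [measurable]: "g \<in> borel_measurable borel"
    and herm: "\<And>i j. T $ j $ i = hconj (T $ i $ j)"
    and zero: "\<And>i j. i \<notin> I \<or> j \<notin> I \<Longrightarrow> T $ i $ j = 0"
  shows "hermitian_integral I (\<lambda>F. g (F + T)) = hermitian_integral I g"
proof -
  let ?D = "\<Pi>\<^sub>M i\<in>I. lborel :: real measure" and ?U = "\<Pi>\<^sub>M p\<in>pairs_above I. lborel :: 'a measure"
  let ?d = "\<lambda>d. \<lambda>i\<in>I. repart (T $ i $ i) + 1 *\<^sub>R d i"
  let ?u = "\<lambda>u. \<lambda>p\<in>pairs_above I. T $ fst p $ snd p + 1 *\<^sub>R u p"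
  have eq: "hermitian_on I d u + T = hermitian_on I (?d d) (?u u)" for d u
  proof -
    have "of_real (repart (T $ i $ i)) = T $ i $ i" for i
      by (rule of_real_repart) (simp flip: herm)
    then show ?thesis
      using zero by (auto simp: vec_eq_iff hermitian_on_nth pairs_above_def hconj_add not_less herm[symmetric])
  qed
  have 1: "(\<lambda>(d, u). g (hermitian_on I d u)) \<in> borel_measurable (?D \<Otimes>\<^sub>M ?U)"
    using measurable_compose[OF hermitian_on_measurable assms(1), of fst _ _ snd]
    by (simp add: case_prod_beta')
  have 2: "(\<lambda>u. g (hermitian_on I d u)) \<in> borel_measurable ?U" if "d \<in> space ?D" for d
    by (rule measurable_compose[OF hermitian_on_measurable assms(1)]) (use that in auto)
  have "hermitian_integral I (\<lambda>F. g (F + T)) =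
     (\<integral>\<^sup>+d. (\<integral>\<^sup>+u. g (hermitian_on I (?d d) (?u u)) \<partial>?U) \<partial>?D)"
    unfolding hermitian_integral_def eq ..
  also have "\<dots> = (\<integral>\<^sup>+d. (\<integral>\<^sup>+u. g (hermitian_on I (?d d) u) \<partial>?U) \<partial>?D)"
  proof (rule nn_integral_cong)
    fix d assume "d \<in> space ?D"
    have "?d d \<in> space ?D" by (simp add: space_PiM)
    from 2[OF this] show "(\<integral>\<^sup>+u. g (hermitian_on I (?d d) (?u u)) \<partial>?U) = (\<integral>\<^sup>+u. g (hermitian_on I (?d d) u) \<partial>?U)"
      by (subst (2) nn_integral_PiM_affine[where c=1 and t="\<lambda>p. T $ fst p $ snd p"]) simp_all
  qed
  also have "\<dots> = (\<integral>\<^sup>+d. (\<integral>\<^sup>+u. g (hermitian_on I d u) \<partial>?U) \<partial>?D)"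
    using sigma_finite_measure.borel_measurable_nn_integral[OF lborel_prod.sigma_finite 1]
    by (subst (2) nn_integral_PiM_affine[where c=1 and t="\<lambda>i. repart (T $ i $ i)"]) simp_all
  finally show ?thesis by (simp add: hermitian_integral_def)
qed

text \<open>The matrix with first pivot \<open>s\<close>, first row \<open>u\<close> and Schur complement \<open>S\<close>. The row is indexed by pairs
  in order to match the coordinates above the diagonal.\<close>
definition bordered ::
    "('m::{finite,linorder}) \<Rightarrow> 'm set \<Rightarrow> real \<Rightarrow> ('m \<times> 'm \<Rightarrow> 'a) \<Rightarrow> 'a^('m::{finite,linorder})^('m::{finite,linorder}) \<Rightarrow> 'a::conj_div_algebra^('m::{finite,linorder})^('m::{finite,linorder})" where
  "bordered i0 I s u S = (\<chi> i j.
     if i = i0 \<and> j = i0 then of_real s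
     else if i = i0 \<and> j \<in> I then u (i0, j)
     else if i \<in> I \<and> j = i0 then hconj (u (i0, i))
     else if i \<in> I \<and> j \<in> I then S $ i $ j + (1 / s) *\<^sub>R (hconj (u (i0, i)) * u (i0, j))
     else 0)"

definition schur :: "('m::finite) \<Rightarrow> 'a^'m^'m \<Rightarrow> 'a::conj_div_algebra^('m::finite)^('m::finite)" where
  "schur i0 F = (\<chi> i j. F $ i $ j - (1 / repart (F $ i0 $ i0)) *\<^sub>R (F $ i $ i0 * F $ i0 $ j))"

text \<open>The power \<open>a\<close> of the product of the pivots that are met when the indices are eliminated in the given
  order; as a density it has to vanish off the cone, that is, as soon as a pivot fails to be positive.\<close>
fun pivot_weight :: "real \<Rightarrow> ('m::finite) list \<Rightarrow> 'a::conj_div_algebra^('m::finite)^('m::finite) \<Rightarrow> real" where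
  "pivot_weight a [] F = 1"
| "pivot_weight a (i # is) F = (if repart (F $ i $ i) > 0
     then repart (F $ i $ i) powr a * pivot_weight a is (schur i F) else 0)"

lemma pivot_weight_nonneg: "pivot_weight a is F \<ge> 0"
  by (induction "is" arbitrary: F) auto

lemma schur_measurable [measurable]: "schur i0 \<in> borel_measurable borel"
  unfolding schur_def by (intro borel_measurable_vecI) (simp, measurable)

lemma pivot_weight_measurable [measurable]:
  "(pivot_weight a is :: 'a::conj_div_algebra^'m^'m \<Rightarrow> real) \<in> borel_measurable borel"
proof (induction "is")
  case (Cons i "is")
  have "(\<lambda>F :: 'a^'m^'m. pivot_weight a is (schur i F)) \<in> borel_measurable borel"
    by (rule measurable_compose[OF schur_measurable Cons.IH])
  then show ?case by simp
qed simp

lemma bordered_measurable: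
  assumes [measurable]: "s \<in> borel_measurable N"
    and u: "u \<in> N \<rightarrow>\<^sub>M (\<Pi>\<^sub>M p\<in>{i0} \<times> I. lborel)"
    and [measurable]: "S \<in> borel_measurable N"
  shows "(\<lambda>x. bordered i0 I (s x) (u x) (S x)) \<in> borel_measurable N"
proof (intro borel_measurable_vecI)
  fix i j
  have U [measurable]: "(\<lambda>x. u x (i0, j)) \<in> borel_measurable N" if "j \<in> I" for j
    using measurable_compose[OF u measurable_component_singleton[of "(i0, j)"]] that by simp
  consider "i = i0" "j = i0" | "i = i0" "j \<noteq> i0" "j \<in> I" | "i \<noteq> i0" "i \<in> I" "j = i0"
    | "i \<noteq> i0" "j \<noteq> i0" "i \<in> I" "j \<in> I" | "i \<notin> insert i0 I \<or> j \<notin> insert i0 I"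
    by blast
  then show "(\<lambda>x. bordered i0 I (s x) (u x) (S x) $ i $ j) \<in> borel_measurable N"
  proof cases
    case 5
    then have "(\<lambda>x. bordered i0 I (s x) (u x) (S x) $ i $ j) = (\<lambda>_. 0)"
      by (auto simp: fun_eq_iff bordered_def)
    then show ?thesis by simp
  qed (simp_all add: bordered_def)
qed

lemma schur_bordered:
  fixes S :: "'a::conj_div_algebra^('m::{finite,linorder})^('m::{finite,linorder})"
  assumes "s > 0" "i0 \<notin> I" and zero: "\<And>i j. i \<notin> I \<or> j \<notin> I \<Longrightarrow> S $ i $ j = 0"
  shows "schur i0 (bordered i0 I s u S) = S"
proof -
  have [simp]: "of_real s * x = s *\<^sub>R x" "x * of_real s = s *\<^sub>R x" for x :: 'a
    by (simp_all add: of_real_def)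
  show ?thesis
    using assms(1,2) zero by (auto simp: vec_eq_iff schur_def bordered_def)
qed

text \<open>Since \<open>i0\<close> precedes \<open>I\<close>, the new coordinates above the diagonal are exactly the row \<open>i0\<close>. For a
  fixed first row the entries over \<open>I\<close> differ from the Schur complement by a fixed Hermitian matrix,
  hence by a translation.\<close>
lemma hermitian_integral_insert:
  fixes g :: "'a::conj_div_algebra^('m::{finite,linorder})^('m::{finite,linorder}) \<Rightarrow> ennreal"
  assumes less: "\<And>j. j \<in> I \<Longrightarrow> i0 < j" and g [measurable]: "g \<in> borel_measurable borel"
  shows "hermitian_integral (insert i0 I) (\<lambda>F. ennreal (pivot_weight a (i0 # is) F) * g F) =
    (\<integral>\<^sup>+s. ennreal (indicator {0<..} s * s powr a) *
      (\<integral>\<^sup>+u. hermitian_integral I (\<lambda>S. ennreal (pivot_weight a is S) * g (bordered i0 I s u S))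
        \<partial>(\<Pi>\<^sub>M p\<in>{i0} \<times> I. lborel)) \<partial>lborel)"
proof -
  let ?D = "\<lambda>I. \<Pi>\<^sub>M i\<in>I. lborel :: real measure" and ?U = "\<lambda>P. \<Pi>\<^sub>M p\<in>P. lborel :: 'a measure"
  let ?h = "\<lambda>F. ennreal (pivot_weight a (i0 # is) F) * g F"
  let ?I = "insert i0 I"
  have i0: "i0 \<notin> I" using less by blast
  have h: "?h \<in> borel_measurable borel" by measurable
  have pairs: "pairs_above ?I = ({i0} \<times> I) \<union> pairs_above I" and disj: "({i0} \<times> I) \<inter> pairs_above I = {}"
    using less i0 by (auto simp: pairs_above_def) force+
  let ?T = "\<lambda>s u. (\<chi> i j. if i \<in> I \<and> j \<in> I then (1 / s) *\<^sub>R (hconj (u (i0, i)) * u (i0, j)) else 0) :: 'a^('m::{finite,linorder})^('m::{finite,linorder})"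
  have split: "hermitian_on ?I (d(i0 := s)) (merge ({i0} \<times> I) (pairs_above I) (u, v)) =
     bordered i0 I s u (hermitian_on I d v - ?T s u)" for d s u v
    using less i0
    by (auto simp: vec_eq_iff hermitian_on_nth bordered_def merge_def pairs_above_def not_less
        dest: order.asym)
  have meas1: "(\<lambda>(d, u). ?h (hermitian_on ?I d u)) \<in> borel_measurable (?D ?I \<Otimes>\<^sub>M ?U (pairs_above ?I))"
    using measurable_compose[OF hermitian_on_measurable h, of fst _ _ snd]
    by (simp add: case_prod_beta')
  have meas2: "(\<lambda>u. ?h (hermitian_on ?I d u)) \<in> borel_measurable (?U (pairs_above ?I))"
    if "d \<in> space (?D ?I)" for d
    by (rule measurable_compose[OF hermitian_on_measurable h]) (use that in auto)
  have "hermitian_integral ?I ?h = (\<integral>\<^sup>+s. (\<integral>\<^sup>+d. (\<integral>\<^sup>+u. ?h (hermitian_on ?I (d(i0 := s)) u)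
      \<partial>?U (pairs_above ?I)) \<partial>?D I) \<partial>lborel)"
    unfolding hermitian_integral_def
    by (rule lborel_prod.product_nn_integral_insert_rev)
       (use i0 sigma_finite_measure.borel_measurable_nn_integral[OF lborel_prod.sigma_finite meas1] in auto)
  also have "\<dots> = (\<integral>\<^sup>+s. (\<integral>\<^sup>+d. (\<integral>\<^sup>+u. (\<integral>\<^sup>+v. ?h (bordered i0 I s u (hermitian_on I d v - ?T s u))
      \<partial>?U (pairs_above I)) \<partial>?U ({i0} \<times> I)) \<partial>?D I) \<partial>lborel)"
  proof (intro nn_integral_cong)
    fix s d assume "d \<in> space (?D I)"
    then have "d(i0 := s) \<in> space (?D ?I)" by (auto simp: space_PiM PiE_def extensional_def)
    from meas2[OF this]
    show "(\<integral>\<^sup>+u. ?h (hermitian_on ?I (d(i0 := s)) u) \<partial>?U (pairs_above ?I)) =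
      (\<integral>\<^sup>+u. (\<integral>\<^sup>+v. ?h (bordered i0 I s u (hermitian_on I d v - ?T s u))
      \<partial>?U (pairs_above I)) \<partial>?U ({i0} \<times> I))"
      unfolding pairs split[symmetric]
      by (intro lborel_prod.product_nn_integral_fold disj) auto
  qed
  also have "\<dots> = (\<integral>\<^sup>+s. (\<integral>\<^sup>+u. hermitian_integral I (\<lambda>S. ?h (bordered i0 I s u (S - ?T s u))) \<partial>?U ({i0} \<times> I)) \<partial>lborel)"
    unfolding hermitian_integral_def
  proof (intro nn_integral_cong pair_sigma_finite.Fubini')
    show "pair_sigma_finite (?U ({i0} \<times> I)) (?D I)"
      by (intro pair_sigma_finite.intro lborel_prod.sigma_finite) auto
    fix s :: real
    have T: "(\<lambda>p. ?T s (fst (fst p))) \<in> borel_measurable ((?U ({i0} \<times> I) \<Otimes>\<^sub>M ?D I) \<Otimes>\<^sub>M ?U (pairs_above I))"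
    proof (intro borel_measurable_vecI)
      fix i j
      show "(\<lambda>p. ?T s (fst (fst p)) $ i $ j) \<in> borel_measurable ((?U ({i0} \<times> I) \<Otimes>\<^sub>M ?D I) \<Otimes>\<^sub>M ?U (pairs_above I))"
        by (cases "i \<in> I \<and> j \<in> I") auto
    qed
    have "(\<lambda>p. bordered i0 I s (fst (fst p)) (hermitian_on I (snd (fst p)) (snd p) - ?T s (fst (fst p))))
       \<in> borel_measurable ((?U ({i0} \<times> I) \<Otimes>\<^sub>M ?D I) \<Otimes>\<^sub>M ?U (pairs_above I))"
      by (intro bordered_measurable borel_measurable_diff hermitian_on_measurable T) measurable
    from measurable_compose[OF this h]
    have "(\<lambda>(z, v). case z of (u, d) \<Rightarrow> ?h (bordered i0 I s u (hermitian_on I d v - ?T s u)))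
      \<in> borel_measurable ((?U ({i0} \<times> I) \<Otimes>\<^sub>M ?D I) \<Otimes>\<^sub>M ?U (pairs_above I))"
      by (simp add: case_prod_beta')
    from sigma_finite_measure.borel_measurable_nn_integral[OF lborel_prod.sigma_finite, OF _ this]
    show "(\<lambda>(u, d). \<integral>\<^sup>+v. ?h (bordered i0 I s u (hermitian_on I d v - ?T s u)) \<partial>?U (pairs_above I))
      \<in> borel_measurable (?U ({i0} \<times> I) \<Otimes>\<^sub>M ?D I)"
      by (simp add: case_prod_beta')
  qed
  also have "\<dots> = (\<integral>\<^sup>+s. (\<integral>\<^sup>+u. hermitian_integral I (\<lambda>S. ?h (bordered i0 I s u S)) \<partial>?U ({i0} \<times> I)) \<partial>lborel)"
  proof (intro nn_integral_cong)
    fix s :: real and u assume u: "u \<in> space (?U ({i0} \<times> I))"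
    have "bordered i0 I s u \<in> borel_measurable borel"
      using bordered_measurable[of "\<lambda>_. s" borel "\<lambda>_. u" i0 I "\<lambda>S. S"] u by simp
    from measurable_compose[OF this h]
    have "hermitian_integral I (\<lambda>S. ?h (bordered i0 I s u (S + (- ?T s u)))) = hermitian_integral I (\<lambda>S. ?h (bordered i0 I s u S))"
      by (intro hermitian_integral_translate) (auto simp: hconj_mult)
    then show "hermitian_integral I (\<lambda>S. ?h (bordered i0 I s u (S - ?T s u))) = hermitian_integral I (\<lambda>S. ?h (bordered i0 I s u S))"
      by simp
  qed
  also have "\<dots> = (\<integral>\<^sup>+s. ennreal (indicator {0<..} s * s powr a) *
      (\<integral>\<^sup>+u. hermitian_integral I (\<lambda>S. ennreal (pivot_weight a is S) * g (bordered i0 I s u S))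
        \<partial>?U ({i0} \<times> I)) \<partial>lborel)"
  proof (rule nn_integral_cong)
    fix s :: real
    show "(\<integral>\<^sup>+u. hermitian_integral I (\<lambda>S. ?h (bordered i0 I s u S)) \<partial>?U ({i0} \<times> I)) =
      ennreal (indicator {0<..} s * s powr a) *
      (\<integral>\<^sup>+u. hermitian_integral I (\<lambda>S. ennreal (pivot_weight a is S) * g (bordered i0 I s u S))
        \<partial>?U ({i0} \<times> I))"
    proof (cases "s > 0")
      case False
      have "bordered i0 I s u S $ i0 $ i0 = of_real s" for u and S :: "'a^('m::{finite,linorder})^('m::{finite,linorder})"
        by (simp add: bordered_def)
      then show ?thesis using False by (simp add: hermitian_integral_def)
    next
      case True
      let ?f = "\<lambda>u S. ennreal (pivot_weight a is S) * g (bordered i0 I s u S)"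
      have b: "(\<lambda>p. bordered i0 I s (fst p) (snd p)) \<in> borel_measurable (?U ({i0} \<times> I) \<Otimes>\<^sub>M borel)"
        by (intro bordered_measurable) measurable
      have [measurable]: "(\<lambda>p. g (bordered i0 I s (fst p) (snd p))) \<in> borel_measurable (?U ({i0} \<times> I) \<Otimes>\<^sub>M borel)"
        by (rule measurable_compose[OF b g])
      have f: "(\<lambda>(u, S). ?f u S) \<in> borel_measurable (?U ({i0} \<times> I) \<Otimes>\<^sub>M borel)"
        unfolding case_prod_beta' by measurable
      have "hermitian_integral I (\<lambda>S. ?h (bordered i0 I s u S)) =
        ennreal (s powr a) * hermitian_integral I (?f u)"
        if u: "u \<in> space (?U ({i0} \<times> I))" for u
      proof -
        have "bordered i0 I s u \<in> borel_measurable borel"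
          using bordered_measurable[of "\<lambda>_. s" borel "\<lambda>_. u" i0 I "\<lambda>S. S"] u by simp
        from measurable_compose[OF this g] have [measurable]: "?f u \<in> borel_measurable borel" by measurable
        have "hermitian_integral I (\<lambda>S. ?h (bordered i0 I s u S)) = 
          hermitian_integral I (\<lambda>S. ennreal (s powr a) * ?f u S)"
        proof (rule hermitian_integral_cong)
          fix d v
          have "schur i0 (bordered i0 I s u (hermitian_on I d v)) = hermitian_on I d v"
            by (rule schur_bordered[OF True i0]) (auto simp: hermitian_on_nth)
          moreover have "bordered i0 I s u (hermitian_on I d v) $ i0 $ i0 = of_real s"
            by (simp add: bordered_def)
          ultimately show "?h (bordered i0 I s u (hermitian_on I d v)) = ennreal (s powr a) * ?f u (hermitian_on I d v)"
            using True by (simp add: ennreal_mult pivot_weight_nonneg mult.assoc)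
        qed
        also have "\<dots> = ennreal (s powr a) * hermitian_integral I (?f u)"
          by (rule hermitian_integral_cmult) measurable
        finally show ?thesis .
      qed
      then have "(\<integral>\<^sup>+u. hermitian_integral I (\<lambda>S. ?h (bordered i0 I s u S)) \<partial>?U ({i0} \<times> I)) =
        (\<integral>\<^sup>+u. ennreal (s powr a) * hermitian_integral I (?f u) \<partial>?U ({i0} \<times> I))"
        by (rule nn_integral_cong)
      also have "\<dots> = ennreal (s powr a) * (\<integral>\<^sup>+u. hermitian_integral I (?f u) \<partial>?U ({i0} \<times> I))"
        by (intro nn_integral_cmult hermitian_integral_measurable f)
      finally show ?thesis using True by simp
    qed
  qed
  finally show ?thesis .
qed


section \<open>The Gram matrix of random rows\<close>

definition gram :: "('a::conj_div_algebra^'n) set \<Rightarrow> 'm set \<Rightarrow> ('m \<Rightarrow> 'a^'n) \<Rightarrow> 'a^('m::finite)^('m::finite)" where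
  "gram es I y = (\<chi> i j. if i \<in> I \<and> j \<in> I then residual es (y i) (y j) else 0)"

lemma gram_measurable:
  assumes y: "y \<in> N \<rightarrow>\<^sub>M (\<Pi>\<^sub>M i\<in>I. lborel)"
  shows "(\<lambda>x. gram es I (y x)) \<in> borel_measurable N"
proof (intro borel_measurable_vecI)
  fix i j
  have [measurable]: "(\<lambda>x. y x i) \<in> borel_measurable N" if "i \<in> I" for i
    using measurable_compose[OF y measurable_component_singleton[OF that]] by simp
  show "(\<lambda>x. gram es I (y x) $ i $ j) \<in> borel_measurable N"
    by (cases "i \<in> I \<and> j \<in> I") (auto simp: gram_def)
qed

lemma measurable_restrict_lborel:
  assumes "\<And>i. i \<in> I \<Longrightarrow> (\<lambda>x. f x i) \<in> borel_measurable N"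
  shows "(\<lambda>x. \<lambda>i\<in>I. f x i) \<in> N \<rightarrow>\<^sub>M (\<Pi>\<^sub>M i\<in>I. lborel)"
  using assms by (intro measurable_restrict) simp

lemma nn_integral_gaussian_PiM:
  fixes a :: "'i \<Rightarrow> 'b::euclidean_space"
  assumes "finite K"
  shows "(\<integral>\<^sup>+b. (\<Prod>p\<in>K. ennreal (exp (- (norm (a p - b p))\<^sup>2))) \<partial>(\<Pi>\<^sub>M p\<in>K. lborel)) =
    ennreal (pi powr (real DIM('b) * card K / 2))"
proof -
  have 1: "(\<integral>\<^sup>+(b::'b). ennreal (exp (- (norm (c - b))\<^sup>2)) \<partial>lborel) = ennreal (pi powr (DIM('b) / 2))" for c
    using nn_integral_gaussian_scaled[of 1 c] by (simp add: norm_minus_commute)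
  have "(\<integral>\<^sup>+b. (\<Prod>p\<in>K. ennreal (exp (- (norm (a p - b p))\<^sup>2))) \<partial>(\<Pi>\<^sub>M p\<in>K. lborel))
    = (\<Prod>p\<in>K. (\<integral>\<^sup>+(b::'b). ennreal (exp (- (norm (a p - b))\<^sup>2)) \<partial>lborel))"
    by (rule lborel_prod.product_nn_integral_prod[OF assms]) measurable
  also have "\<dots> = (\<Prod>p\<in>K. ennreal (pi powr (DIM('b) / 2)))"
    by (simp add: 1)
  also have "\<dots> = ennreal (pi powr (real DIM('b) * card K / 2))"
    by (simp add: ennreal_power powr_powr flip: powr_realpow)
  finally show ?thesis .
qed

text \<open>The remaining rows are freed from their components along \<open>e\<close>, the normalised residual of \<open>x\<close>. Those
  components become independent variables by \<open>fibre_average\<close>, with the Gaussian as profile, which is what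
  turns the weight for \<open>es\<close> into the weight for \<open>insert e es\<close>. Rescaling them by \<open>sqrt s\<close> gives the first
  row of the Gram matrix. The result depends on \<open>x\<close> only through \<open>s\<close>.\<close>
lemma gram_peel:
  fixes x :: "'a::conj_div_algebra^'n" and g :: "'a^('m::{finite,linorder})^('m::{finite,linorder}) \<Rightarrow> ennreal"
  assumes on: "orthonormal es" and i0: "i0 \<notin> I" and g: "g \<in> borel_measurable borel"
  defines "s \<equiv> repart (residual es x x)"
  assumes s: "s > 0"
  defines "e \<equiv> of_real (1 / sqrt s) *s proj es x"
  defines "r \<equiv> real DIM('a) * real (card I) / 2"
  shows "orthonormal (insert e es)" "e \<notin> es"
    "(\<integral>\<^sup>+y. (\<Prod>i\<in>I. ennreal (exp (- energy es (y i)))) * g (gram es (insert i0 I) (y(i0 := x)))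
        \<partial>(\<Pi>\<^sub>M i\<in>I. lborel)) =
      ennreal (pi powr - r * s powr - r) *
      (\<integral>\<^sup>+u. (\<integral>\<^sup>+y. (\<Prod>i\<in>I. ennreal (exp (- energy (insert e es) (y i)))) *
         g (bordered i0 I s u (gram (insert e es) I y)) \<partial>(\<Pi>\<^sub>M i\<in>I. lborel))
        \<partial>(\<Pi>\<^sub>M p\<in>{i0} \<times> I. lborel))"
proof -
  let ?es = "insert e es" and ?K = "{i0} \<times> I"
  let ?Y = "\<Pi>\<^sub>M i\<in>I. lborel :: ('a^'n) measure" and ?U = "\<Pi>\<^sub>M p\<in>{i0} \<times> I. lborel :: 'a measure"
  have sx: "residual es x x = of_real s"
    unfolding s_def by (rule of_real_repart[symmetric]) (simp add: hconj_residual)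
  have sq: "sqrt s * sqrt s = s" "sqrt s \<noteq> 0" using s by auto
  define q where "q = 1 / sqrt s"
  have q: "sqrt s * q = 1" "q * sqrt s = 1" using sq by (simp_all add: q_def)
  have e_eq: "e = of_real q *s proj es x" by (simp only: e_def q_def)
  have e_left: "sqrt s *\<^sub>R hform e y = residual es x y" for y
    by (simp add: e_eq hform_smult_left hform_proj_left scaleR_conv_of_real q flip: mult.assoc of_real_mult)
  have ee: "hform e e = 1"
  proof -
    have "residual es x (proj es x) = of_real s"
      using sx by (metis hconj_residual residual_proj[OF on])
    then have "hform e e = of_real q * (of_real s * of_real q)"
      by (simp add: e_eq hform_smult_left hform_smult_right hform_proj_left residual_proj[OF on] mult.assoc)
    also have "\<dots> = of_real (q * (s * q))" by simp
    also have "q * (s * q) = 1" using sq by (simp add: q_def field_simps)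
    finally show ?thesis by simp
  qed
  have ef: "hform e f = 0" if "f \<in> es" for f
    using e_left[of f] residual_member[OF on that, of x] sq by simp
  show on': "orthonormal ?es" and e: "e \<notin> es"
    using orthonormal_insert[OF on ee ef] by auto
  have fin: "finite es" using on by (simp add: orthonormal_def)
  \<comment> \<open>The coordinate is \<open>hform e y\<close> rather than \<open>hform y e\<close>, as it enters the row and not the column of the
    Gram matrix; so the rows have to be moved by the conjugate of \<open>b\<close>. The factors 1 in \<open>T\<close> and
    \<open>add\<close> exhibit them as affine maps in the sense of \<open>nn_integral_PiM_affine\<close>.\<close>
  define c where "c = (\<lambda>y::'m \<Rightarrow> 'a^'n. \<lambda>p\<in>?K. hform e (y (snd p)))"
  define T where "T = (\<lambda>(b::'m \<times> 'm \<Rightarrow> 'a) y. \<lambda>i\<in>I. (- hconj (b (i0, i))) *s e + 1 *\<^sub>R y i)"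
  define add where "add = (\<lambda>(a::'m \<times> 'm \<Rightarrow> 'a) b. \<lambda>p\<in>?K. a p + 1 *\<^sub>R b p)"
  define sub where "sub = (\<lambda>(a::'m \<times> 'm \<Rightarrow> 'a) b. \<lambda>p\<in>?K. a p - b p)"
  define \<phi> where "\<phi> = (\<lambda>a::'m \<times> 'm \<Rightarrow> 'a. \<Prod>p\<in>?K. ennreal (exp (- (norm (a p))\<^sup>2)))"
  define G where "G = (\<lambda>u y. g (bordered i0 I s u (gram ?es I y)))"
  define k where "k = (\<lambda>a y. (\<Prod>i\<in>I. ennreal (exp (- energy es (y i)))) * G (\<lambda>p\<in>?K. 0 + sqrt s *\<^sub>R a p) y)"
  have comp [measurable]: "(\<lambda>x. f x i) \<in> borel_measurable N"
    if "i \<in> J" "f \<in> N \<rightarrow>\<^sub>M (\<Pi>\<^sub>M i\<in>J. lborel)" for i J N and f :: "'z \<Rightarrow> 'i \<Rightarrow> 'b::euclidean_space"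
    using measurable_compose[OF that(2) measurable_component_singleton[OF that(1)]] by simp
  have G_meas: "(\<lambda>z. G (u z) (y z)) \<in> borel_measurable N"
    if "u \<in> N \<rightarrow>\<^sub>M ?U" "y \<in> N \<rightarrow>\<^sub>M ?Y" for u y and N :: "'z measure"
    unfolding G_def
    by (rule measurable_compose[OF _ g]) (intro bordered_measurable gram_measurable that, simp)
  have Gs_meas: "(\<lambda>z. G (\<lambda>p\<in>?K. 0 + sqrt s *\<^sub>R u z p) (y z)) \<in> borel_measurable N"
    if "u \<in> N \<rightarrow>\<^sub>M ?U" "y \<in> N \<rightarrow>\<^sub>M ?Y" for u y and N :: "'z measure"
    using comp[OF _ that(1)] by (intro G_meas that measurable_restrict_lborel) simp
  have energy_meas: "(\<lambda>z. (\<Prod>i\<in>I. ennreal (exp (- energy es' (y z i))))) \<in> borel_measurable N"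
    if "y \<in> N \<rightarrow>\<^sub>M ?Y" for y es' and N :: "'z measure"
    using comp[OF _ that] by measurable
  have shift: "residual ?es (v + q *s e) w = residual ?es v w" "residual ?es w (v + q *s e) = residual ?es w v" for q v w
    using residual_shift[OF on', of e] by auto
  have key: "(\<integral>\<^sup>+y. (\<integral>\<^sup>+a. \<phi> (c y) * k a y \<partial>?U) \<partial>?Y) = ennreal (pi powr r) * (\<integral>\<^sup>+y. k (c y) y \<partial>?Y)"
  proof (rule fibre_average[where T=T and add=add and sub=sub])
    show "sigma_finite_measure ?Y" "sigma_finite_measure ?U"
      by (intro lborel_prod.sigma_finite; simp)+
    show "c \<in> ?Y \<rightarrow>\<^sub>M ?U"
      unfolding c_def using comp[OF _ measurable_ident_sets[OF refl], of _ I]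
      by (intro measurable_restrict_lborel hform_measurable) auto
    show "(\<lambda>(b, y). T b y) \<in> ?U \<Otimes>\<^sub>M ?Y \<rightarrow>\<^sub>M ?Y"
      unfolding T_def case_prod_beta'
      using comp[of _ ?K "fst"] comp[of _ I "snd"]
      by (intro measurable_restrict_lborel borel_measurable_add smult_measurable borel_measurable_uminus
        measurable_compose[OF _ borel_measurable_hconj] borel_measurable_scaleR) auto
    show "(\<lambda>(a, b). add a b) \<in> ?U \<Otimes>\<^sub>M ?U \<rightarrow>\<^sub>M ?U" "(\<lambda>(a, b). sub a b) \<in> ?U \<Otimes>\<^sub>M ?U \<rightarrow>\<^sub>M ?U"
      unfolding add_def sub_def case_prod_beta'
      using comp[of _ ?K "fst"] comp[of _ ?K "snd"]
      by (intro measurable_restrict_lborel borel_measurable_add borel_measurable_diff borel_measurable_scaleR; auto)+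
    show "\<phi> \<in> borel_measurable ?U"
      unfolding \<phi>_def by measurable
    show "(\<lambda>(a, y). k a y) \<in> borel_measurable (?U \<Otimes>\<^sub>M ?Y)"
      unfolding k_def case_prod_beta'
      by (intro borel_measurable_times_ennreal energy_meas Gs_meas) auto
    show "(\<integral>\<^sup>+y. f (T b y) \<partial>?Y) = (\<integral>\<^sup>+y. f y \<partial>?Y)"
      if "f \<in> borel_measurable ?Y" for f b
      unfolding T_def
      using nn_integral_PiM_affine[OF _ that, of 1 "\<lambda>i. (- hconj (b (i0, i))) *s e"] by simp
    show "(\<integral>\<^sup>+b. f (add a b) \<partial>?U) = (\<integral>\<^sup>+b. f b \<partial>?U)"
      if "f \<in> borel_measurable ?U" for f a
      unfolding add_def using nn_integral_PiM_affine[OF _ that, of 1 a] by simp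
    show "k a (T b y) = k a y" for a b y
    proof -
      have Tb: "T b y i = y i + (- hconj (b (i0, i))) *s e" if "i \<in> I" for i
        using that by (simp add: T_def)
      have "gram ?es I (T b y) = gram ?es I y"
        by (auto simp: gram_def vec_eq_iff Tb shift)
      moreover have "energy es (T b y i) = energy es (y i)" if "i \<in> I" for i
        by (simp add: Tb that energy_shift ef)
      ultimately show ?thesis by (simp add: k_def G_def)
    qed
    show "c (T b y) = sub (c y) b" for b y
      by (auto simp: c_def T_def sub_def fun_eq_iff hform_add_right hform_smult_right ee)
    show "add (sub a b) b = a" if "a \<in> space ?U" for a b
      using that by (auto simp: add_def sub_def fun_eq_iff space_PiM PiE_def extensional_def restrict_def)
    show "(\<integral>\<^sup>+b. \<phi> (sub a b) \<partial>?U) = ennreal (pi powr r)" for a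
      using nn_integral_gaussian_PiM[of ?K a]
      by (simp add: \<phi>_def sub_def r_def cong: prod.cong)
  qed
  have left: "k (c y) y = (\<Prod>i\<in>I. ennreal (exp (- energy es (y i)))) * g (gram es (insert i0 I) (y(i0 := x)))" for y
  proof -
    define u where "u = (\<lambda>p\<in>?K. 0 + sqrt s *\<^sub>R c y p)"
    have u: "u (i0, j) = residual es x (y j)" if "j \<in> I" for j
      using that by (simp add: u_def c_def e_left)
    have prod_eq: "(1 / s) *\<^sub>R (residual es (y i) x * residual es x (y j)) = hform (y i) e * hform e (y j)" for i j
    proof -
      have "hconj (residual es x (y i)) * residual es x (y j) = s *\<^sub>R (hform (y i) e * hform e (y j))"
        using sq(1) by (simp add: hconj_hform flip: e_left)
      then show ?thesis using s by (simp add: hconj_residual)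
    qed
    have "bordered i0 I s u (gram ?es I y) = gram es (insert i0 I) (y(i0 := x))"
      using i0
      by (auto simp: vec_eq_iff bordered_def gram_def u sx hconj_residual residual_insert fin e prod_eq)
    then show ?thesis by (simp add: k_def G_def u_def)
  qed
  have right: "\<phi> (c y) * k a y = (\<Prod>i\<in>I. ennreal (exp (- energy ?es (y i)))) * G (\<lambda>p\<in>?K. 0 + sqrt s *\<^sub>R a p) y" for a y
  proof -
    have "\<phi> (c y) = (\<Prod>i\<in>I. ennreal (exp (- (norm (hform (y i) e))\<^sup>2)))"
    proof -
      have "norm (hform e v) = norm (hform v e)" for v
        using hconj_simps(9)[of "hform v e"] by (simp add: hconj_hform)
      then have "\<phi> (c y) = (\<Prod>p\<in>?K. ennreal (exp (- (norm (hform (y (snd p)) e))\<^sup>2)))"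
        by (simp add: \<phi>_def c_def cong: prod.cong)
      also have "?K = Pair i0 ` I" by auto
      also have "(\<Prod>p\<in>Pair i0 ` I. ennreal (exp (- (norm (hform (y (snd p)) e))\<^sup>2))) = (\<Prod>i\<in>I. ennreal (exp (- (norm (hform (y i) e))\<^sup>2)))"
        by (subst prod.reindex) (auto simp: inj_on_def)
      finally show ?thesis .
    qed
    then have "\<phi> (c y) * (\<Prod>i\<in>I. ennreal (exp (- energy es (y i)))) = (\<Prod>i\<in>I. ennreal (exp (- energy ?es (y i))))"
      by (simp add: energy_insert fin e mult_exp_exp flip: prod.distrib ennreal_mult)
    then show ?thesis by (simp add: k_def flip: mult.assoc)
  qed
  let ?H = "\<lambda>u y. (\<Prod>i\<in>I. ennreal (exp (- energy ?es (y i)))) * G u y"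
  have H1: "(\<lambda>(a, y). ?H (\<lambda>p\<in>?K. 0 + sqrt s *\<^sub>R a p) y) \<in> borel_measurable (?U \<Otimes>\<^sub>M ?Y)"
    unfolding case_prod_beta' by (intro borel_measurable_times_ennreal energy_meas Gs_meas) auto
  have H2: "(\<lambda>(u, y). ?H u y) \<in> borel_measurable (?U \<Otimes>\<^sub>M ?Y)"
    unfolding case_prod_beta' by (intro borel_measurable_times_ennreal energy_meas G_meas) auto
  have sf: "sigma_finite_measure ?Y" "sigma_finite_measure ?U"
    by (intro lborel_prod.sigma_finite; simp)+
  have "(\<integral>\<^sup>+y. (\<integral>\<^sup>+a. \<phi> (c y) * k a y \<partial>?U) \<partial>?Y) = (\<integral>\<^sup>+a. (\<integral>\<^sup>+y. ?H (\<lambda>p\<in>?K. 0 + sqrt s *\<^sub>R a p) y \<partial>?Y) \<partial>?U)"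
    unfolding right by (rule pair_sigma_finite.Fubini'[OF pair_sigma_finite.intro[OF sf(2,1)] H1])
  moreover have "(\<integral>\<^sup>+u. (\<integral>\<^sup>+y. ?H u y \<partial>?Y) \<partial>?U) = ennreal (s powr r) * \<dots>"
  proof -
    have "(\<integral>\<^sup>+u. (\<integral>\<^sup>+y. ?H u y \<partial>?Y) \<partial>?U) = ennreal (\<bar>sqrt s\<bar> ^ (DIM('a) * card ?K)) *
        (\<integral>\<^sup>+a. (\<integral>\<^sup>+y. ?H (\<lambda>p\<in>?K. 0 + sqrt s *\<^sub>R a p) y \<partial>?Y) \<partial>?U)"
      by (rule nn_integral_PiM_affine[OF _ _ sq(2)])
         (use sigma_finite_measure.borel_measurable_nn_integral[OF sf(1) H2] in simp_all)
    also have "\<bar>sqrt s\<bar> ^ (DIM('a) * card ?K) = s powr r"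
      using s by (simp add: r_def card_cartesian_product powr_half_sqrt[symmetric] powr_powr flip: powr_realpow)
    finally show ?thesis .
  qed
  ultimately have "(\<integral>\<^sup>+u. (\<integral>\<^sup>+y. ?H u y \<partial>?Y) \<partial>?U) = ennreal (s powr r) * (ennreal (pi powr r) * (\<integral>\<^sup>+y. k (c y) y \<partial>?Y))"
    using key by simp
  then have "ennreal (pi powr - r * s powr - r) * (\<integral>\<^sup>+u. (\<integral>\<^sup>+y. ?H u y \<partial>?Y) \<partial>?U) = (\<integral>\<^sup>+y. k (c y) y \<partial>?Y)"
    using s by (simp add: powr_minus field_simps flip: ennreal_mult mult.assoc)
  then show "(\<integral>\<^sup>+y. (\<Prod>i\<in>I. ennreal (exp (- energy es (y i)))) * g (gram es (insert i0 I) (y(i0 := x))) \<partial>?Y) =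
      ennreal (pi powr - r * s powr - r) *
      (\<integral>\<^sup>+u. (\<integral>\<^sup>+y. (\<Prod>i\<in>I. ennreal (exp (- energy ?es (y i)))) *
         g (bordered i0 I s u (gram ?es I y)) \<partial>?Y) \<partial>?U)"
    by (simp add: left G_def)
qed


lemma mgamma_Suc:
  "mgamma \<beta> (Suc m) a = pi powr (real m * \<beta> / 2) * Gamma a * mgamma \<beta> m (a - \<beta> / 2)"
proof -
  have "(\<Prod>i=1..Suc m. Gamma (a - (real i - 1) * \<beta> / 2)) = Gamma a * (\<Prod>i=Suc 1..Suc m. Gamma (a - (real i - 1) * \<beta> / 2))"
    by (subst prod.atLeast_Suc_atMost) auto
  also have "(\<Prod>i=Suc 1..Suc m. Gamma (a - (real i - 1) * \<beta> / 2)) = (\<Prod>i=1..m. Gamma (a - \<beta> / 2 - (real i - 1) * \<beta> / 2))"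
    by (subst prod.shift_bounds_cl_Suc_ivl) (simp add: field_simps)
  finally show ?thesis
    by (simp add: mgamma_def powr_add[symmetric] field_simps)
qed

lemma mgamma_0 [simp]: "mgamma \<beta> 0 a = 1"
  by (simp add: mgamma_def)

lemma mgamma_pos:
  assumes "\<beta> > 0" "a > (real m - 1) * \<beta> / 2"
  shows "mgamma \<beta> m a > 0"
  unfolding mgamma_def
proof (intro mult_pos_pos prod_pos ballI Gamma_real_pos)
  fix i assume "i \<in> {1..m}"
  then have "(real i - 1) * \<beta> / 2 \<le> (real m - 1) * \<beta> / 2"
    using assms(1) by (intro divide_right_mono mult_right_mono) auto
  then show "a - (real i - 1) * \<beta> / 2 > 0" using assms(2) by simp
qed simp

text \<open>Induction on the number of rows, with \<open>es\<close> arbitrary. The exponent of the pivots is the same for the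
  remaining rows and one more direction. The exponent of \<open>s\<close> arises as \<open>p - 1\<close> from
  \<open>residual_norm_law\<close>, less \<open>r\<close> from the scaling in \<open>gram_peel\<close>; the constants obey the recursion
  \<open>mgamma_Suc\<close>.\<close>
theorem gram_law:
  fixes es :: "('a::conj_div_algebra^'n) set" and "is" :: "'m::{finite,linorder} list"
    and g :: "'a^('m::{finite,linorder})^('m::{finite,linorder}) \<Rightarrow> ennreal"
  assumes "sorted_wrt (<) is" "orthonormal es" "card es + length is \<le> CARD('n)"
    and "g \<in> borel_measurable borel"
  defines "\<beta> \<equiv> real DIM('a)"
  shows "(\<integral>\<^sup>+y. (\<Prod>i\<in>set is. ennreal (exp (- energy es (y i)))) * g (gram es (set is) y)
      \<partial>(\<Pi>\<^sub>M i\<in>set is. lborel)) =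
    ennreal (pi powr (\<beta> * real (CARD('n) * length is) / 2) /
      mgamma \<beta> (length is) (\<beta> * (real CARD('n) - real (card es)) / 2)) *
    hermitian_integral (set is) (\<lambda>F.
      ennreal (pivot_weight (\<beta> * (real CARD('n) - real (card es) - real (length is) + 1) / 2 - 1) is F) * g F)"
  using assms(1-4)
proof (induction "is" arbitrary: es g)
  case Nil
  have "gram es {} y = 0" for y :: "'m \<Rightarrow> 'a^'n" by (simp add: gram_def vec_eq_iff)
  moreover have "hermitian_on {} d u = (0 :: 'a^('m::{finite,linorder})^('m::{finite,linorder}))" for d u by (simp add: hermitian_on_nth vec_eq_iff)
  moreover have "pairs_above ({} :: 'm set) = {}" by (simp add: pairs_above_def)
  ultimately show ?case
    by (simp add: hermitian_integral_def PiM_empty nn_integral_count_space_finite)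
next
  case (Cons i0 "is" es g)
  note g [measurable] = Cons.prems(4)
  let ?I = "set is"
  let ?Y = "\<Pi>\<^sub>M i\<in>?I. lborel :: ('a^'n) measure" and ?U = "\<Pi>\<^sub>M p\<in>{i0} \<times> ?I. lborel :: 'a measure"
  have less: "i0 < j" if "j \<in> ?I" for j using Cons.prems(1) that by auto
  then have i0: "i0 \<notin> ?I" by blast
  have "distinct is" using Cons.prems(1) by (simp add: strict_sorted_iff)
  then have card_I: "card ?I = length is" by (rule distinct_card)
  have on: "orthonormal es" and fin: "finite es"
    using Cons.prems(2) by (auto simp: orthonormal_def)
  define n k m where "n = real CARD('n)" and "k = real (card es)" and "m = real (length is)"
  have bound: "k + m + 1 \<le> n" using Cons.prems(3) by (simp add: n_def k_def m_def)
  have \<beta>: "\<beta> > 0" by (simp add: \<beta>_def)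
  define p where "p = \<beta> * (n - k) / 2"
  define r where "r = \<beta> * m / 2"
  define a where "a = \<beta> * (n - k - m) / 2 - 1"
  define C where "C = pi powr (\<beta> * (n * m) / 2) / mgamma \<beta> (length is) (p - \<beta> / 2)"
  have "\<beta> * (k + m + 1) \<le> \<beta> * n" using bound \<beta> by simp
  then have C: "C \<ge> 0" unfolding C_def
    using \<beta> by (intro divide_nonneg_nonneg less_imp_le[OF mgamma_pos]) (auto simp: p_def m_def field_simps)
  have p: "p > 0" using bound \<beta> by (simp add: p_def m_def)
  define q where "q x = repart (residual es x x)" for x
  define H where "H s = (\<integral>\<^sup>+u. hermitian_integral ?I (\<lambda>S. ennreal (pivot_weight a is S) * g (bordered i0 ?I s u S)) \<partial>?U)" for s
  have H [measurable]: "H \<in> borel_measurable borel"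
  proof -
    have b: "(\<lambda>z. bordered i0 ?I (fst (fst z)) (snd (fst z)) (snd z)) \<in> borel_measurable ((borel \<Otimes>\<^sub>M ?U) \<Otimes>\<^sub>M borel)"
      by (intro bordered_measurable) measurable
    have [measurable]: "(\<lambda>z. g (bordered i0 ?I (fst (fst z)) (snd (fst z)) (snd z))) \<in> borel_measurable ((borel \<Otimes>\<^sub>M ?U) \<Otimes>\<^sub>M borel)"
      by (rule measurable_compose[OF b g])
    have "(\<lambda>(z, S). ennreal (pivot_weight a is S) * g (bordered i0 ?I (fst z) (snd z) S)) \<in> borel_measurable ((borel \<Otimes>\<^sub>M ?U) \<Otimes>\<^sub>M borel)"
      unfolding case_prod_beta' by measurable
    from hermitian_integral_measurable[OF this]
    have "(\<lambda>(s, u). hermitian_integral ?I (\<lambda>S. ennreal (pivot_weight a is S) * g (bordered i0 ?I s u S))) \<in> borel_measurable (borel \<Otimes>\<^sub>M ?U)"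
      by (simp add: case_prod_beta')
    then show ?thesis
      unfolding H_def
      by (rule sigma_finite_measure.borel_measurable_nn_integral[OF lborel_prod.sigma_finite, rotated]) simp
  qed
  have inner: "(\<integral>\<^sup>+y. (\<Prod>i\<in>?I. ennreal (exp (- energy es (y i)))) * g (gram es (insert i0 ?I) (y(i0 := x))) \<partial>?Y)
      = ennreal (pi powr - r * C) * (ennreal (q x powr - r) * H (q x))" if q: "q x > 0" for x
  proof -
    let ?e = "of_real (1 / sqrt (q x)) *s proj es x"
    let ?es = "insert ?e es"
    note peel = gram_peel[OF on i0 g, of x, folded q_def, OF q]
    have card_es: "real (card ?es) = k + 1" using peel(2) fin by (simp add: k_def)
    have IH: "(\<integral>\<^sup>+y. (\<Prod>i\<in>?I. ennreal (exp (- energy ?es (y i)))) * g (bordered i0 ?I (q x) u (gram ?es ?I y)) \<partial>?Y)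
       = ennreal C * hermitian_integral ?I (\<lambda>S. ennreal (pivot_weight a is S) * g (bordered i0 ?I (q x) u S))"
      if u: "u \<in> space ?U" for u
    proof -
      have "bordered i0 ?I (q x) u \<in> borel_measurable borel"
        using bordered_measurable[of "\<lambda>_. q x" borel "\<lambda>_. u" i0 ?I "\<lambda>S. S"] u by simp
      from measurable_compose[OF this g]
      have g': "(\<lambda>S. g (bordered i0 ?I (q x) u S)) \<in> borel_measurable borel" .
      have "card ?es + length is \<le> CARD('n)" "sorted_wrt (<) is"
        using Cons.prems(1,3) peel(2) fin by auto
      from Cons.IH[OF this(2) peel(1) this(1) g', unfolded card_es]
      show ?thesis
        by (simp add: C_def a_def p_def n_def k_def m_def algebra_simps diff_divide_distrib add_divide_distrib)
    qed
    have "(\<integral>\<^sup>+y. (\<Prod>i\<in>?I. ennreal (exp (- energy es (y i)))) * g (gram es (insert i0 ?I) (y(i0 := x))) \<partial>?Y)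
      = ennreal (pi powr - r * q x powr - r) * (\<integral>\<^sup>+u. ennreal C * hermitian_integral ?I (\<lambda>S. ennreal (pivot_weight a is S) * g (bordered i0 ?I (q x) u S)) \<partial>?U)"
      unfolding peel(3) using IH
      by (simp add: card_I r_def \<beta>_def m_def cong: nn_integral_cong)
    also have "(\<integral>\<^sup>+u. ennreal C * hermitian_integral ?I (\<lambda>S. ennreal (pivot_weight a is S) * g (bordered i0 ?I (q x) u S)) \<partial>?U) = ennreal C * H (q x)"
      unfolding H_def
    proof (intro nn_integral_cmult hermitian_integral_measurable)
      have b: "(\<lambda>z. bordered i0 ?I (q x) (fst z) (snd z)) \<in> borel_measurable (?U \<Otimes>\<^sub>M borel)"
        by (intro bordered_measurable) measurable
      have [measurable]: "(\<lambda>z. g (bordered i0 ?I (q x) (fst z) (snd z))) \<in> borel_measurable (?U \<Otimes>\<^sub>M borel)"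
        by (rule measurable_compose[OF b g])
      show "(\<lambda>(u, S). ennreal (pivot_weight a is S) * g (bordered i0 ?I (q x) u S)) \<in> borel_measurable (?U \<Otimes>\<^sub>M borel)"
        unfolding case_prod_beta' by measurable
    qed
    also have "ennreal (pi powr - r * q x powr - r) * (ennreal C * H (q x)) = ennreal (pi powr - r * C) * (ennreal (q x powr - r) * H (q x))"
      using C by (simp add: ennreal_mult mult_ac)
    finally show ?thesis .
  qed
  have law: "(\<integral>\<^sup>+x. ennreal (exp (- energy es x)) * h (q x) \<partial>lborel) =
    ennreal (pi powr (\<beta> * n / 2) / Gamma p) * (\<integral>\<^sup>+s. ennreal (indicator {0<..} s * s powr (p - 1)) * h s \<partial>lborel)"
    if "h \<in> borel_measurable borel" for h
    unfolding q_def using residual_norm_law[OF on _ that] Cons.prems(3)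
    by (simp add: p_def n_def k_def \<beta>_def)
  have q_meas [measurable]: "q \<in> borel_measurable borel" unfolding q_def by measurable
  \<comment> \<open>the law of \<open>q\<close> gives no mass to rows that are dependent on \<open>es\<close>\<close>
  have pos: "AE x in lborel. q x > 0"
  proof -
    have "(\<integral>\<^sup>+x. ennreal (exp (- energy es x)) * indicator {..0} (q x) \<partial>lborel) =
      ennreal (pi powr (\<beta> * n / 2) / Gamma p) * (\<integral>\<^sup>+s. ennreal (indicator {0<..} s * s powr (p - 1)) * indicator {..0} s \<partial>lborel)"
      by (rule law) measurable
    also have "(\<lambda>s. ennreal (indicator {0<..} s * s powr (p - 1)) * indicator {..0} s) = (\<lambda>_. 0)"
      by (auto simp: indicator_def)
    finally have "(\<integral>\<^sup>+x. ennreal (exp (- energy es x)) * indicator {..0} (q x) \<partial>lborel) = 0" by simp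
    then have "AE x in lborel. ennreal (exp (- energy es x)) * indicator {..0} (q x) = 0"
      by (subst (asm) nn_integral_0_iff_AE) auto
    then show ?thesis
      by eventually_elim (auto simp: indicator_def split: if_splits)
  qed
  have upd: "(\<lambda>y. (\<Prod>i\<in>insert i0 ?I. ennreal (exp (- energy es (y i)))) * g (gram es (insert i0 ?I) y))
      \<in> borel_measurable (\<Pi>\<^sub>M i\<in>insert i0 ?I. lborel)"
  proof -
    have [measurable]: "(\<lambda>y. y i) \<in> borel_measurable (\<Pi>\<^sub>M i\<in>insert i0 ?I. lborel :: ('a^'n) measure)" if "i \<in> insert i0 ?I" for i
      using measurable_component_singleton[OF that, of "\<lambda>_. lborel"] by simp
    have [measurable]: "(\<lambda>y. g (gram es (insert i0 ?I) y)) \<in> borel_measurable (\<Pi>\<^sub>M i\<in>insert i0 ?I. lborel)"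
      by (rule measurable_compose[OF gram_measurable g]) simp
    show ?thesis by measurable
  qed
  have "(\<integral>\<^sup>+y. (\<Prod>i\<in>insert i0 ?I. ennreal (exp (- energy es (y i)))) * g (gram es (insert i0 ?I) y)
      \<partial>(\<Pi>\<^sub>M i\<in>insert i0 ?I. lborel)) =
    (\<integral>\<^sup>+x. (\<integral>\<^sup>+y. (\<Prod>i\<in>insert i0 ?I. ennreal (exp (- energy es ((y(i0 := x)) i)))) * g (gram es (insert i0 ?I) (y(i0 := x))) \<partial>?Y) \<partial>lborel)"
    by (rule lborel_prod.product_nn_integral_insert_rev[OF _ i0 upd]) simp
  also have "\<dots> = (\<integral>\<^sup>+x. ennreal (exp (- energy es x)) *
      (\<integral>\<^sup>+y. (\<Prod>i\<in>?I. ennreal (exp (- energy es (y i)))) * g (gram es (insert i0 ?I) (y(i0 := x))) \<partial>?Y) \<partial>lborel)"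
  proof (rule nn_integral_cong)
    fix x :: "'a^'n"
    have eq: "(\<Prod>i\<in>insert i0 ?I. ennreal (exp (- energy es ((y(i0 := x)) i)))) =
      ennreal (exp (- energy es x)) * (\<Prod>i\<in>?I. ennreal (exp (- energy es (y i))))" for y
    proof -
      have "(\<Prod>i\<in>?I. ennreal (exp (- energy es ((y(i0 := x)) i)))) = (\<Prod>i\<in>?I. ennreal (exp (- energy es (y i))))"
        using i0 by (intro prod.cong) auto
      then show ?thesis using i0 by (simp add: prod.insert)
    qed
    have "(\<lambda>y. y(i0 := x)) \<in> ?Y \<rightarrow>\<^sub>M (\<Pi>\<^sub>M i\<in>insert i0 ?I. lborel)"
      by (rule measurable_fun_upd[where J="?I"]) auto
    from measurable_compose[OF gram_measurable[OF this] g]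
    have [measurable]: "(\<lambda>y. g (gram es (insert i0 ?I) (y(i0 := x)))) \<in> borel_measurable ?Y" .
    have [measurable]: "(\<lambda>y. y i) \<in> borel_measurable ?Y" if "i \<in> ?I" for i
      using measurable_component_singleton[OF that, of "\<lambda>_. lborel"] by simp
    show "(\<integral>\<^sup>+y. (\<Prod>i\<in>insert i0 ?I. ennreal (exp (- energy es ((y(i0 := x)) i)))) * g (gram es (insert i0 ?I) (y(i0 := x))) \<partial>?Y)
      = ennreal (exp (- energy es x)) *
      (\<integral>\<^sup>+y. (\<Prod>i\<in>?I. ennreal (exp (- energy es (y i)))) * g (gram es (insert i0 ?I) (y(i0 := x))) \<partial>?Y)"
      unfolding eq mult.assoc by (rule nn_integral_cmult) measurable
  qed
  also have "\<dots> = (\<integral>\<^sup>+x. ennreal (pi powr - r * C) * (ennreal (exp (- energy es x)) * (ennreal (q x powr - r) * H (q x))) \<partial>lborel)"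
    using pos by (intro nn_integral_cong_AE) (auto simp: inner mult_ac)
  also have "\<dots> = ennreal (pi powr - r * C) * (\<integral>\<^sup>+x. ennreal (exp (- energy es x)) * (ennreal (q x powr - r) * H (q x)) \<partial>lborel)"
    by (rule nn_integral_cmult) measurable
  also have "(\<integral>\<^sup>+x. ennreal (exp (- energy es x)) * (ennreal (q x powr - r) * H (q x)) \<partial>lborel) =
    ennreal (pi powr (\<beta> * n / 2) / Gamma p) * (\<integral>\<^sup>+s. ennreal (indicator {0<..} s * s powr (p - 1)) * (ennreal (s powr - r) * H s) \<partial>lborel)"
    by (rule law) measurable
  also have "(\<integral>\<^sup>+s. ennreal (indicator {0<..} s * s powr (p - 1)) * (ennreal (s powr - r) * H s) \<partial>lborel) =
     (\<integral>\<^sup>+s. ennreal (indicator {0<..} s * s powr a) * H s \<partial>lborel)"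
  proof (intro nn_integral_cong)
    fix s :: real
    have "p - 1 - r = a" by (simp add: p_def r_def a_def field_simps)
    then have "s powr (p - 1) * s powr - r = s powr a"
      by (simp flip: powr_add)
    then show "ennreal (indicator {0<..} s * s powr (p - 1)) * (ennreal (s powr - r) * H s) = ennreal (indicator {0<..} s * s powr a) * H s"
      by (auto simp: indicator_def simp flip: mult.assoc ennreal_mult)
  qed
  also have "\<dots> = hermitian_integral (insert i0 ?I) (\<lambda>F. ennreal (pivot_weight a (i0 # is) F) * g F)"
    unfolding H_def by (rule hermitian_integral_insert[symmetric]) (use less g in auto)
  also have "ennreal (pi powr - r * C) * (ennreal (pi powr (\<beta> * n / 2) / Gamma p) * hermitian_integral (insert i0 ?I) (\<lambda>F. ennreal (pivot_weight a (i0 # is) F) * g F)) =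
    ennreal (pi powr - r * C * (pi powr (\<beta> * n / 2) / Gamma p)) * hermitian_integral (insert i0 ?I) (\<lambda>F. ennreal (pivot_weight a (i0 # is) F) * g F)"
    using C Gamma_real_pos[OF p] by (subst ennreal_mult) (auto simp: mult.assoc)
  also have "pi powr - r * C * (pi powr (\<beta> * n / 2) / Gamma p) =
    pi powr (\<beta> * real (CARD('n) * length (i0 # is)) / 2) / mgamma \<beta> (length (i0 # is)) (\<beta> * (real CARD('n) - real (card es)) / 2)"
  proof -
    have "mgamma \<beta> (length (i0 # is)) (\<beta> * (real CARD('n) - real (card es)) / 2) = pi powr r * Gamma p * mgamma \<beta> (length is) (p - \<beta> / 2)"
      by (simp add: mgamma_Suc p_def n_def k_def r_def m_def mult.commute)
    moreover have "pi powr (\<beta> * real (CARD('n) * length (i0 # is)) / 2) = pi powr (\<beta> * (n * m) / 2) * pi powr (\<beta> * n / 2)"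
    proof -
      have "\<beta> * real (CARD('n) * length (i0 # is)) / 2 = \<beta> * (n * m) / 2 + \<beta> * n / 2"
        by (simp add: n_def m_def field_simps)
      then show ?thesis by (simp only: powr_add)
    qed
    ultimately show ?thesis by (simp add: C_def powr_minus field_simps)
  qed
  also have "a = \<beta> * (real CARD('n) - real (card es) - real (length (i0 # is)) + 1) / 2 - 1"
    by (simp add: a_def n_def k_def m_def)
  finally show ?case by simp
qed


section \<open>Real symmetric operators and their eigenspaces\<close>

text \<open>A maximiser of the quadratic form on the unit sphere of \<open>V\<close> is an eigenvector, and its orthogonal
  complement in \<open>V\<close> is again invariant.\<close>
lemma spectral_invariant_subspace:
  fixes A :: "'e::euclidean_space \<Rightarrow> 'e"
  assumes lin: "linear A" and sym: "\<And>x y. x \<bullet> A y = A x \<bullet> y"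
    and V: "subspace V" "\<And>v. v \<in> V \<Longrightarrow> A v \<in> V"
  shows "\<exists>B \<subseteq> V. finite B \<and> pairwise orthogonal B \<and> (\<forall>b\<in>B. norm b = 1) \<and> span B = V \<and>
    (\<forall>b\<in>B. \<exists>l. A b = l *\<^sub>R b)"
  using V
proof (induction "dim V" arbitrary: V rule: less_induct)
  case less
  note V = less.prems
  interpret linear A by fact
  show ?case
  proof (cases "V = {0}")
    case True
    then show ?thesis by (intro exI[of _ "{}"]) auto
  next
    case False
    let ?K = "{x \<in> V. norm x = 1}"
    obtain x0 where x0: "x0 \<in> V" "x0 \<noteq> 0" using False V(1) subspace_0 by blast
    then have "(1 / norm x0) *\<^sub>R x0 \<in> ?K" using V(1) by (simp add: subspace_scale)
    then have "?K \<noteq> {}" by blast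
    moreover have "compact ?K"
    proof -
      have "?K = V \<inter> sphere 0 1" by auto
      then show ?thesis using closed_subspace[OF V(1)] by (simp add: closed_Int_compact)
    qed
    moreover have "continuous_on ?K (\<lambda>x. x \<bullet> A x)"
      using lin by (intro continuous_intros linear_continuous_on) (simp add: linear_conv_bounded_linear)
    ultimately obtain v where v: "v \<in> V" "norm v = 1" and max: "\<And>y. y \<in> V \<Longrightarrow> norm y = 1 \<Longrightarrow> y \<bullet> A y \<le> v \<bullet> A v"
      using continuous_attains_sup[of ?K "\<lambda>x. x \<bullet> A x"] by blast
    define l where "l = v \<bullet> A v"
    have le: "y \<bullet> A y \<le> l * (y \<bullet> y)" if y: "y \<in> V" for y
    proof (cases "y = 0")
      case False
      have "((1 / norm y) *\<^sub>R y) \<bullet> A ((1 / norm y) *\<^sub>R y) \<le> l"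
        unfolding l_def using False y V(1) by (intro max) (auto simp: subspace_scale)
      then have "(y \<bullet> A y) / (norm y)\<^sup>2 \<le> l"
        by (simp add: scale power2_eq_square)
      then show ?thesis using False
        by (simp add: divide_le_eq dot_square_norm)
    qed simp
    have perp: "w \<bullet> A v = 0" if w: "w \<in> V" "w \<bullet> v = 0" for w
    proof -
      define K where "K = \<bar>l * (w \<bullet> w) - w \<bullet> A w\<bar> + 1"
      define c where "c = w \<bullet> A v"
      have K: "K > 0" by (simp add: K_def)
      have vv: "v \<bullet> v = 1" using v by (simp add: dot_square_norm)
      have ineq: "2 * t * c \<le> t\<^sup>2 * K" for t
      proof -
        have "v + t *\<^sub>R w \<in> V" using v w V(1) by (simp add: subspace_add subspace_scale)
        from le[OF this] have "2 * t * c \<le> t\<^sup>2 * (l * (w \<bullet> w) - w \<bullet> A w)"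
          using sym[of v w] w(2) vv
          by (simp add: add scale inner_add_left inner_add_right c_def l_def[symmetric] power2_eq_square
            inner_commute[of v w] inner_commute[of "A v" w] algebra_simps)
        also have "\<dots> \<le> t\<^sup>2 * K" by (intro mult_left_mono) (auto simp: K_def)
        finally show ?thesis .
      qed
      \<comment> \<open>a nonzero linear term would beat the quadratic one for small \<open>t\<close>; \<open>c / K\<close> is small enough\<close>
      have "2 * (c / K) * c \<le> (c / K)\<^sup>2 * K" by (rule ineq)
      then have "2 * c\<^sup>2 / K \<le> c\<^sup>2 / K" using K by (simp add: power2_eq_square)
      then have "c\<^sup>2 \<le> 0" using K by (simp add: divide_le_cancel)
      then show ?thesis by (simp add: c_def)
    qed
    have eig: "A v = l *\<^sub>R v"
    proof -
      define u where "u = A v - l *\<^sub>R v"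
      have "u \<in> V" unfolding u_def using v V by (simp add: subspace_diff subspace_scale)
      moreover have uv: "u \<bullet> v = 0"
        using v by (simp add: u_def inner_diff_left l_def dot_square_norm inner_commute[of "A v" v])
      ultimately have "u \<bullet> A v = 0" by (rule perp)
      then have "u \<bullet> u = 0" using uv by (subst (2) u_def) (simp add: inner_diff_right)
      then show ?thesis by (simp add: u_def)
    qed
    let ?W = "{y \<in> V. v \<bullet> y = 0}"
    have W: "subspace ?W"
      using V(1) by (auto simp: subspace_def inner_add_right)
    have "v \<notin> ?W" using v by (simp add: dot_square_norm)
    then have psub: "?W \<subset> V" using v(1) by blast
    have spans: "span ?W = ?W" "span V = V" using W V(1) by (simp_all only: span_eq_iff)
    have "dim ?W < dim V" by (rule dim_psubset) (simp only: spans psub)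
    moreover have "A w \<in> ?W" if "w \<in> ?W" for w
      using that V(2) eig by (simp add: sym)
    ultimately have "\<exists>B \<subseteq> ?W. finite B \<and> pairwise orthogonal B \<and> (\<forall>b\<in>B. norm b = 1) \<and> span B = ?W \<and>
        (\<forall>b\<in>B. \<exists>l. A b = l *\<^sub>R b)"
      by (intro less.hyps W)
    then obtain B where B: "B \<subseteq> ?W" "finite B" "pairwise orthogonal B" "\<And>b. b \<in> B \<Longrightarrow> norm b = 1"
      "span B = ?W" "\<And>b. b \<in> B \<Longrightarrow> \<exists>l. A b = l *\<^sub>R b"
      by (elim exE conjE) blast
    have "span (insert v B) = V"
    proof
      show "span (insert v B) \<subseteq> V"
        using B(1) v V(1) by (intro span_minimal) auto
      show "V \<subseteq> span (insert v B)"
      proof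
        fix y assume y: "y \<in> V"
        have "y - (v \<bullet> y) *\<^sub>R v \<in> ?W"
          using y v V(1) by (simp add: subspace_diff subspace_scale inner_diff_right dot_square_norm)
        then have "y - (v \<bullet> y) *\<^sub>R v \<in> span B" using B(5) by simp
        then show "y \<in> span (insert v B)" by (auto simp: span_insert)
      qed
    qed
    moreover have "pairwise orthogonal (insert v B)"
      using B(1,3) by (auto simp: pairwise_insert orthogonal_def inner_commute)
    ultimately show ?thesis
      using B v eig by (intro exI[of _ "insert v B"]) auto
  qed
qed

text \<open>The analogue of \<open>energy_profile_scaling\<close> for real directions, with a parameter for each of them.\<close>
lemma gaussian_profile_scaling:
  fixes B :: "'e::euclidean_space set" and \<mu> :: "'e \<Rightarrow> real" and h :: "'e \<Rightarrow> ennreal"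
  assumes "finite B" "pairwise orthogonal B" "\<And>b. b \<in> B \<Longrightarrow> norm b = 1" "\<And>b. b \<in> B \<Longrightarrow> \<mu> b > 0"
    "h \<in> borel_measurable borel" "\<And>b y c. b \<in> B \<Longrightarrow> h (y + c *\<^sub>R b) = h y"
  shows "(\<integral>\<^sup>+y. ennreal (exp (- (\<Sum>b\<in>B. \<mu> b * (y \<bullet> b)\<^sup>2))) * h y \<partial>lborel) =
    ennreal ((\<Prod>b\<in>B. \<mu> b) powr - (1 / 2)) * (\<integral>\<^sup>+y. ennreal (exp (- (\<Sum>b\<in>B. (y \<bullet> b)\<^sup>2))) * h y \<partial>lborel)"
  using assms
proof (induction B arbitrary: h)
  case empty
  then show ?case by simp
next
  case (insert e B h)
  note [measurable] = insert.prems(4)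
  have split: "ennreal (exp (- (a + b))) = ennreal (exp (- a)) * ennreal (exp (- b))" for a b :: real
    by (simp add: mult_exp_exp flip: ennreal_mult)
  have orth: "b \<bullet> e = 0" "e \<bullet> b = 0" if "b \<in> B" for b
    using insert.prems(1) insert.hyps(2) that by (auto simp: pairwise_insert orthogonal_def)
  have ee: "e \<bullet> e = 1" using insert.prems(2) by (simp add: dot_square_norm)
  have pos: "\<mu> e > 0" "(\<Prod>b\<in>B. \<mu> b) > 0" using insert.prems(3) by (auto intro: prod_pos)
  let ?g = "\<lambda>y. ennreal (exp (- (\<Sum>b\<in>B. \<mu> b * (y \<bullet> b)\<^sup>2))) * h y"
  let ?A = "\<integral>\<^sup>+y. ennreal (exp (- (y \<bullet> e)\<^sup>2)) * ?g y \<partial>lborel"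
  let ?B = "\<integral>\<^sup>+y. ennreal (exp (- (\<mu> e * (y \<bullet> e)\<^sup>2))) * ?g y \<partial>lborel"
  have "(\<integral>\<^sup>+(a::real). ennreal (exp (- (\<mu> e * a\<^sup>2))) \<partial>lborel) * ?A = ennreal (pi powr (1/2)) * ?B"
  proof (rule profile_exchange[where \<tau>="\<lambda>b. (- b) *\<^sub>R e"])
    show "(y + (- b) *\<^sub>R e) \<bullet> e = y \<bullet> e - b" for b y by (simp add: inner_diff_left ee)
    have "(\<Sum>b\<in>B. \<mu> b * ((y + (- c) *\<^sub>R e) \<bullet> b)\<^sup>2) = (\<Sum>b\<in>B. \<mu> b * (y \<bullet> b)\<^sup>2)" for y c
      by (intro sum.cong) (auto simp: inner_diff_left orth)
    then show "?g (y + (- b) *\<^sub>R e) = ?g y" for b y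
      using insert.prems(5)[of e y "- b"] by simp
    show "(\<integral>\<^sup>+(b::real). ennreal (exp (- (a - b)\<^sup>2)) \<partial>lborel) = ennreal (pi powr (1/2))" for a
      using nn_integral_gaussian_scaled[of 1 a] by (simp add: power2_commute)
  qed measurable
  moreover have "(\<integral>\<^sup>+(a::real). ennreal (exp (- (\<mu> e * a\<^sup>2))) \<partial>lborel) = ennreal (pi powr (1/2)) * ennreal (\<mu> e powr - (1/2))"
    using nn_integral_gaussian_scaled[of "\<mu> e" "0::real"] pos
    by (simp add: powr_divide powr_minus_divide flip: ennreal_mult)
  ultimately have "ennreal (pi powr (1/2)) * ?B = ennreal (pi powr (1/2)) * (ennreal (\<mu> e powr - (1/2)) * ?A)"
    by (simp add: mult.assoc)
  then have B: "?B = ennreal (\<mu> e powr - (1/2)) * ?A"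
    by (subst (asm) ennreal_mult_cancel_left) auto
  have "(\<integral>\<^sup>+y. ennreal (exp (- (\<Sum>b\<in>insert e B. \<mu> b * (y \<bullet> b)\<^sup>2))) * h y \<partial>lborel) = ?B"
    by (intro nn_integral_cong) (simp only: sum.insert[OF insert.hyps] split mult.assoc)
  also note B
  also have "?A = (\<integral>\<^sup>+y. ennreal (exp (- (\<Sum>b\<in>B. \<mu> b * (y \<bullet> b)\<^sup>2))) * (ennreal (exp (- (y \<bullet> e)\<^sup>2)) * h y) \<partial>lborel)"
    by (simp add: mult_ac)
  also have "\<dots> = ennreal ((\<Prod>b\<in>B. \<mu> b) powr - (1/2)) *
     (\<integral>\<^sup>+y. ennreal (exp (- (\<Sum>b\<in>B. (y \<bullet> b)\<^sup>2))) * (ennreal (exp (- (y \<bullet> e)\<^sup>2)) * h y) \<partial>lborel)"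
    by (rule insert.IH) (use insert.prems in \<open>auto simp: pairwise_insert inner_add_left orth\<close>)
  also have "(\<integral>\<^sup>+y. ennreal (exp (- (\<Sum>b\<in>B. (y \<bullet> b)\<^sup>2))) * (ennreal (exp (- (y \<bullet> e)\<^sup>2)) * h y) \<partial>lborel)
     = (\<integral>\<^sup>+y. ennreal (exp (- (\<Sum>b\<in>insert e B. (y \<bullet> b)\<^sup>2))) * h y \<partial>lborel)"
    by (intro nn_integral_cong) (simp only: sum.insert[OF insert.hyps] split mult_ac)
  also have "ennreal (\<mu> e powr - (1/2)) * (ennreal ((\<Prod>b\<in>B. \<mu> b) powr - (1/2)) * (\<integral>\<^sup>+y. ennreal (exp (- (\<Sum>b\<in>insert e B. (y \<bullet> b)\<^sup>2))) * h y \<partial>lborel))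
     = ennreal ((\<Prod>b\<in>insert e B. \<mu> b) powr - (1/2)) * (\<integral>\<^sup>+y. ennreal (exp (- (\<Sum>b\<in>insert e B. (y \<bullet> b)\<^sup>2))) * h y \<partial>lborel)"
    using pos by (simp only: prod.insert[OF insert.hyps] powr_mult) (simp add: ennreal_mult mult.assoc)
  finally show ?case .
qed

lemma orthonormal_basis_expansion:
  fixes B :: "'e::euclidean_space set"
  assumes "finite B" "pairwise orthogonal B" "\<And>b. b \<in> B \<Longrightarrow> norm b = 1" "span B = UNIV"
  shows "x = (\<Sum>b\<in>B. (x \<bullet> b) *\<^sub>R b)"
proof -
  define y where "y = x - (\<Sum>b\<in>B. (x \<bullet> b) *\<^sub>R b)"
  have yb: "y \<bullet> c = 0" if c: "c \<in> B" for c
  proof -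
    have "(\<Sum>b\<in>B. (x \<bullet> b) * (b \<bullet> c)) = (\<Sum>b\<in>B. if b = c then x \<bullet> c else 0)"
      using assms(2,3) c by (intro sum.cong) (auto simp: pairwise_def orthogonal_def dot_square_norm)
    then show ?thesis using assms(1) c by (simp add: y_def inner_diff_left inner_sum_left)
  qed
  have "orthogonal y y"
    by (rule orthogonal_to_span[of _ B]) (auto simp: assms(4) orthogonal_def yb)
  then show ?thesis by (simp add: orthogonal_def y_def)
qed

lemma nn_integral_exp_symmetric_form:
  fixes A :: "'e::euclidean_space \<Rightarrow> 'e"
  assumes B: "finite B" "pairwise orthogonal B" "\<And>b. b \<in> B \<Longrightarrow> norm b = 1" "span B = UNIV"
    and lin: "linear A" and eig: "\<And>b. b \<in> B \<Longrightarrow> A b = \<mu> b *\<^sub>R b" and pos: "\<And>b. b \<in> B \<Longrightarrow> \<mu> b > 0"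
  shows "(\<integral>\<^sup>+x. ennreal (exp (- (x \<bullet> A x))) \<partial>lborel) = ennreal (pi powr (DIM('e) / 2) * (\<Prod>b\<in>B. \<mu> b) powr - (1 / 2))"
proof -
  interpret linear A by fact
  note exp = orthonormal_basis_expansion[OF B]
  have Ax: "A x = (\<Sum>b\<in>B. (\<mu> b * (x \<bullet> b)) *\<^sub>R b)" for x
    by (subst exp[of x]) (auto simp: linear_sum[OF lin] linear_scale[OF lin] eig mult.commute intro!: sum.cong)
  have "x \<bullet> A x = (\<Sum>b\<in>B. \<mu> b * (x \<bullet> b)\<^sup>2)" for x
    by (subst Ax) (simp add: inner_sum_right power2_eq_square mult.assoc)
  then have "(\<integral>\<^sup>+x. ennreal (exp (- (x \<bullet> A x))) \<partial>lborel) = (\<integral>\<^sup>+x. ennreal (exp (- (\<Sum>b\<in>B. \<mu> b * (x \<bullet> b)\<^sup>2))) * 1 \<partial>lborel)"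
    by simp
  also have "\<dots> = ennreal ((\<Prod>b\<in>B. \<mu> b) powr - (1 / 2)) * (\<integral>\<^sup>+x. ennreal (exp (- (\<Sum>b\<in>B. (x \<bullet> b)\<^sup>2))) * 1 \<partial>lborel)"
    by (rule gaussian_profile_scaling) (use B pos in auto)
  also have "(\<lambda>x. (\<Sum>b\<in>B. (x \<bullet> b)\<^sup>2)) = (\<lambda>x. (norm x)\<^sup>2)"
  proof
    fix x
    have "x \<bullet> x = x \<bullet> (\<Sum>b\<in>B. (x \<bullet> b) *\<^sub>R b)" by (rule arg_cong[OF exp])
    then have "x \<bullet> x = (\<Sum>b\<in>B. (x \<bullet> b)\<^sup>2)"
      by (simp add: inner_sum_right power2_eq_square)
    then show "(\<Sum>b\<in>B. (x \<bullet> b)\<^sup>2) = (norm x)\<^sup>2"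
      by (simp only: power2_norm_eq_inner)
  qed
  finally show ?thesis by (simp add: nn_integral_gaussian mult.commute flip: ennreal_mult)
qed

lemma eigenspace_of_orthonormal_eigenbasis:
  fixes A :: "'e::euclidean_space \<Rightarrow> 'e"
  assumes B: "finite B" "pairwise orthogonal B" "\<And>b. b \<in> B \<Longrightarrow> norm b = 1" "span B = UNIV"
    and lin: "linear A" and eig: "\<And>b. b \<in> B \<Longrightarrow> A b = \<mu> b *\<^sub>R b"
  shows "{x. A x = l *\<^sub>R x} = span {b \<in> B. \<mu> b = l}" "dim {x. A x = l *\<^sub>R x} = card {b \<in> B. \<mu> b = l}"
proof -
  interpret linear A by fact
  note exp = orthonormal_basis_expansion[OF B]
  have Ax: "A x \<bullet> c = \<mu> c * (x \<bullet> c)" if c: "c \<in> B" for x c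
  proof -
    have "A x = (\<Sum>b\<in>B. (\<mu> b * (x \<bullet> b)) *\<^sub>R b)"
      by (subst exp[of x]) (auto simp: linear_sum[OF lin] linear_scale[OF lin] eig mult.commute intro!: sum.cong)
    moreover have "(\<Sum>b\<in>B. \<mu> b * (x \<bullet> b) * (b \<bullet> c)) = (\<Sum>b\<in>B. if b = c then \<mu> c * (x \<bullet> c) else 0)"
      using B(2,3) c by (intro sum.cong) (auto simp: pairwise_def orthogonal_def dot_square_norm)
    ultimately show ?thesis using B(1) c by (simp add: inner_sum_left)
  qed
  show eq: "{x. A x = l *\<^sub>R x} = span {b \<in> B. \<mu> b = l}"
  proof
    show "span {b \<in> B. \<mu> b = l} \<subseteq> {x. A x = l *\<^sub>R x}"
      by (rule span_minimal) (auto simp: eig subspace_def add scale scaleR_add_right)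
    show "{x. A x = l *\<^sub>R x} \<subseteq> span {b \<in> B. \<mu> b = l}"
    proof
      fix x assume "x \<in> {x. A x = l *\<^sub>R x}"
      then have x: "A x = l *\<^sub>R x" by simp
      have "(x \<bullet> b) *\<^sub>R b \<in> span {b \<in> B. \<mu> b = l}" if b: "b \<in> B" for b
      proof (cases "\<mu> b = l")
        case True
        then show ?thesis using b by (intro span_scale span_base) simp
      next
        case False
        have "l * (x \<bullet> b) = \<mu> b * (x \<bullet> b)" using Ax[OF b, of x] x by simp
        then have "x \<bullet> b = 0" using False by simp
        then show ?thesis by (simp add: span_zero)
      qed
      then have "(\<Sum>b\<in>B. (x \<bullet> b) *\<^sub>R b) \<in> span {b \<in> B. \<mu> b = l}"
        by (rule span_sum)
      then show "x \<in> span {b \<in> B. \<mu> b = l}"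
        by (subst exp[of x])
    qed
  qed
  have "0 \<notin> B" using B(3)[of 0] by auto
  then have "independent {b \<in> B. \<mu> b = l}"
    using B(2,3) by (intro pairwise_orthogonal_independent) (auto simp: pairwise_def)
  then show "dim {x. A x = l *\<^sub>R x} = card {b \<in> B. \<mu> b = l}"
    unfolding eq dim_span by (rule dim_eq_card_independent)
qed

text \<open>Vector spaces over a division algebra are free: the line generated by a nonzero vector has real
  dimension \<open>DIM('a)\<close>, and its real orthogonal complement is again closed under scalars. Hence the
  division in the definition of \<open>hdet\<close> is exact.\<close>
lemma dim_right_module:
  fixes V :: "('a::conj_div_algebra^'m) set"
  assumes "subspace V" "\<And>v q. v \<in> V \<Longrightarrow> (\<chi> i. v $ i * q) \<in> V"
  shows "DIM('a) dvd dim V"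
  using assms
proof (induction "dim V" arbitrary: V rule: less_induct)
  case less
  show ?case
  proof (cases "V = {0}")
    case True
    then show ?thesis by simp
  next
    case False
    then obtain v where v: "v \<in> V" "v \<noteq> 0" using less.prems(1) subspace_0 by blast
    define f where "f q = (\<chi> i. v $ i * q)" for q :: 'a
    obtain k where k: "v $ k \<noteq> 0" using v(2) by (auto simp: vec_eq_iff)
    have f: "linear f" unfolding f_def by (rule linearI) (simp_all add: vec_eq_iff algebra_simps)
    have "inj f"
    proof (rule injI)
      fix p q assume "f p = f q"
      then have "f p $ k = f q $ k" by simp
      then show "p = q" using k by (simp add: f_def)
    qed
    then have dimf: "dim (range f) = DIM('a)"
      using dim_image_eq[OF f, of UNIV] by simp
    have L: "subspace (range f)" using linear_subspace_image[OF f subspace_UNIV] .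
    have LV: "range f \<subseteq> V" using less.prems(2)[OF v(1)] by (auto simp: f_def)
    let ?W = "{y \<in> V. \<forall>x\<in>range f. orthogonal x y}"
    have dims: "dim ?W + DIM('a) = dim V"
      using dim_subspace_orthogonal_to_vectors[OF L less.prems(1) LV] unfolding dimf .
    then have "dim ?W < dim V" using DIM_positive[where 'a='a] by linarith
    moreover have "subspace ?W"
      unfolding subspace_def orthogonal_def
      using subspace_0[OF less.prems(1)] subspace_add[OF less.prems(1)] subspace_scale[OF less.prems(1)]
      by (simp add: inner_add_right)
    moreover have "(\<chi> i. w $ i * q) \<in> ?W" if w: "w \<in> ?W" for w q
    proof -
      have perp: "f p \<bullet> w = 0" for p
        using w unfolding orthogonal_def by blast
      have move: "(v $ i * p) \<bullet> (w $ i * q) = (v $ i * (p * hconj q)) \<bullet> (w $ i)" for i p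
        using inner_mult_right_hconj[of "v $ i * p" "hconj q" "w $ i"]
        by (simp only: hconj_simps(1) mult.assoc)
      have "f p \<bullet> (\<chi> i. w $ i * q) = f (p * hconj q) \<bullet> w" for p
        by (simp only: inner_vec_def f_def vec_lambda_beta move)
      then have orth: "orthogonal x (\<chi> i. w $ i * q)" if "x \<in> range f" for x
        using that perp unfolding orthogonal_def by force
      have "(\<chi> i. w $ i * q) \<in> V" using w by (intro less.prems(2)) blast
      then show ?thesis by (intro CollectI conjI ballI orth)
    qed
    ultimately have "DIM('a) dvd dim ?W" by (rule less.hyps[of ?W])
    then have "DIM('a) dvd dim ?W + DIM('a)" by (rule dvd_add) (rule dvd_refl)
    then show ?thesis unfolding dims .
  qed
qed


section \<open>Pivots, positive definiteness and the determinant\<close>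

lemma prod_Basis_vec: "(\<Prod>b\<in>(Basis :: ('b::euclidean_space^'k) set). f b) = (\<Prod>i\<in>UNIV. \<Prod>b\<in>Basis. f (axis i b))"
proof -
  have "bij_betw (\<lambda>(i, b). axis i b) (UNIV \<times> Basis) (Basis :: ('b^'k) set)"
    by (auto simp: bij_betw_def inj_on_def Basis_vec_def axis_eq_axis)
  from prod.reindex_bij_betw[OF this, of f, symmetric] show ?thesis
    by (simp add: prod.cartesian_product case_prod_beta')
qed

lemma repart_zero [simp]: "repart 0 = 0"
  by (simp add: repart_def)

lemma vec_nth_vec_lambda: "vec_nth (vec_lambda x) = x"
  by (simp add: fun_eq_iff)

lemma vec_lambda_measurable:
  "(vec_lambda :: ('k::finite \<Rightarrow> 'b::euclidean_space) \<Rightarrow> 'b^'k) \<in> Pi\<^sub>M UNIV (\<lambda>_. lborel) \<rightarrow>\<^sub>M borel"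
proof (rule borel_measurable_vecI)
  fix i :: 'k
  show "(\<lambda>x. vec_lambda x $ i) \<in> borel_measurable (Pi\<^sub>M UNIV (\<lambda>_. lborel :: 'b measure))"
    using measurable_component_singleton[of i UNIV "\<lambda>_. lborel :: 'b measure"] by simp
qed

lemma lborel_vec: "(lborel :: ('b::euclidean_space^'k) measure) = distr (\<Pi>\<^sub>M i\<in>UNIV. lborel) borel vec_lambda"
proof (rule lborel_eqI)
  fix l u :: "'b^'k" assume le: "\<And>b. b \<in> Basis \<Longrightarrow> l \<bullet> b \<le> u \<bullet> b"
  have le': "l $ i \<bullet> b \<le> u $ i \<bullet> b" if "b \<in> Basis" for i b
    using le[of "axis i b"] that by (simp add: inner_axis)
  have mem: "x \<in> box l u \<longleftrightarrow> (\<forall>i. x $ i \<in> box (l $ i) (u $ i))" for x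
    by (auto simp: mem_box Basis_vec_def inner_axis)
  have "emeasure (distr (\<Pi>\<^sub>M i\<in>UNIV. lborel) borel vec_lambda) (box l u) =
    emeasure (\<Pi>\<^sub>M i\<in>(UNIV::'k set). lborel :: 'b measure) (\<Pi>\<^sub>E i\<in>UNIV. box (l $ i) (u $ i))"
    by (subst emeasure_distr[OF vec_lambda_measurable])
       (auto intro!: arg_cong[where f="emeasure _"] simp: mem space_PiM PiE_iff)
  also have "\<dots> = (\<Prod>i\<in>UNIV. emeasure lborel (box (l $ i) (u $ i)))"
    by (rule lborel_prod.emeasure_PiM) auto
  also have "\<dots> = (\<Prod>i\<in>UNIV. ennreal (\<Prod>b\<in>Basis. (u $ i - l $ i) \<bullet> b))"
    using le' by (intro prod.cong refl) (simp add: emeasure_lborel_box)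
  also have "\<dots> = ennreal (\<Prod>i\<in>UNIV. \<Prod>b\<in>Basis. (u $ i - l $ i) \<bullet> b)"
    using le' by (intro prod_ennreal prod_nonneg) (simp add: inner_diff_left)
  also have "(\<Prod>i\<in>UNIV. \<Prod>b\<in>Basis. (u $ i - l $ i) \<bullet> b) = (\<Prod>b\<in>Basis. (u - l) \<bullet> b)"
    by (simp add: prod_Basis_vec inner_axis)
  finally show "emeasure (distr (\<Pi>\<^sub>M i\<in>UNIV. lborel) borel vec_lambda) (box l u) = ennreal (\<Prod>b\<in>Basis. (u - l) \<bullet> b)" .
qed simp

lemma nn_integral_lborel_vec:
  fixes f :: "'b::euclidean_space^'k \<Rightarrow> ennreal"
  assumes "f \<in> borel_measurable borel"
  shows "(\<integral>\<^sup>+x. f x \<partial>lborel) = (\<integral>\<^sup>+x. f (vec_lambda x) \<partial>(\<Pi>\<^sub>M i\<in>UNIV. lborel))"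
  by (subst lborel_vec) (simp add: nn_integral_distr vec_lambda_measurable assms)

text \<open>Columns are a right module, so here the conjugate stands on the left, in contrast to \<open>hform\<close>.
  Functions are used as vectors in order to restrict them to index sets.\<close>
definition hquad :: "'m set \<Rightarrow> 'a::conj_div_algebra^('m::finite)^('m::finite) \<Rightarrow> ('m \<Rightarrow> 'a) \<Rightarrow> 'a" where
  "hquad I F x = (\<Sum>i\<in>I. \<Sum>j\<in>I. hconj (x i) * (F $ i $ j * x j))"

lemma ctranspose_nth: "ctranspose A $ i $ j = hconj (A $ j $ i)"
  by (simp add: ctranspose_def)

lemma hermitian_nth: "F = ctranspose F \<Longrightarrow> hconj (F $ i $ j) = F $ j $ i"
  by (metis ctranspose_nth)

lemma hermitian_diag: "F = ctranspose F \<Longrightarrow> F $ i $ i = of_real (repart (F $ i $ i))"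
  by (simp add: of_real_repart hermitian_nth)

lemma schur_hermitian:
  assumes "F = ctranspose F"
  shows "schur i0 F = ctranspose (schur i0 F)"
  by (simp add: vec_eq_iff ctranspose_nth schur_def hconj_mult hermitian_nth[OF assms])

lemma hquad_real:
  assumes "F = ctranspose F"
  shows "of_real (repart (hquad I F x)) = hquad I F x"
proof (rule of_real_repart)
  have "hconj (hquad I F x) = (\<Sum>i\<in>I. \<Sum>j\<in>I. hconj (x j) * (F $ j $ i * x i))"
    by (simp add: hquad_def hconj_sum hconj_mult hermitian_nth[OF assms] mult.assoc)
  also have "\<dots> = hquad I F x" unfolding hquad_def by (rule sum.swap)
  finally show "hconj (hquad I F x) = hquad I F x" .
qed

lemma complete_square:
  fixes F :: "'a::conj_div_algebra^('m::finite)^('m::finite)"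
  assumes herm: "F = ctranspose F" and i0: "i0 \<notin> I" and s: "repart (F $ i0 $ i0) = s" "s \<noteq> 0"
  defines "w x \<equiv> (\<Sum>j\<in>I. F $ i0 $ j * x j)"
  shows "repart (hquad (insert i0 I) F x) =
    s * (norm (x i0 + (1 / s) *\<^sub>R w x))\<^sup>2 + repart (hquad I (schur i0 F) x)"
proof -
  let ?w = "w x" and ?x = "x i0"
  have F00: "F $ i0 $ i0 = of_real s" using hermitian_diag[OF herm, of i0] s by simp
  have real_mult: "of_real s * y = s *\<^sub>R y" for y :: 'a by (simp add: of_real_def)
  have hw: "hconj ?w = (\<Sum>i\<in>I. hconj (x i) * F $ i $ i0)"
    by (simp add: w_def hconj_sum hconj_mult hermitian_nth[OF herm])
  have "hquad (insert i0 I) F x = hconj ?x * (F $ i0 $ i0 * ?x) + hconj ?x * ?w + hconj ?w * ?x + hquad I F x"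
    using i0 unfolding hquad_def hw
    by (simp add: sum.distrib sum_distrib_left sum_distrib_right mult.assoc w_def)
  moreover have "hquad I (schur i0 F) x = hquad I F x - (1 / s) *\<^sub>R (hconj ?w * ?w)"
  proof -
    have "hconj ?w * ?w = (\<Sum>i\<in>I. \<Sum>j\<in>I. hconj (x i) * (F $ i $ i0 * F $ i0 $ j * x j))"
      unfolding hw unfolding w_def by (simp add: sum_product mult.assoc)
    then show ?thesis
      by (simp add: hquad_def schur_def s left_diff_distrib right_diff_distrib sum_subtractf scaleR_sum_right)
  qed
  moreover have "of_real (s * (norm (?x + (1 / s) *\<^sub>R ?w))\<^sup>2) =
     hconj ?x * (F $ i0 $ i0 * ?x) + hconj ?x * ?w + hconj ?w * ?x + (1 / s) *\<^sub>R (hconj ?w * ?w)"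
  proof -
    have "of_real (s * (norm (?x + (1 / s) *\<^sub>R ?w))\<^sup>2) = s *\<^sub>R (hconj (?x + (1 / s) *\<^sub>R ?w) * (?x + (1 / s) *\<^sub>R ?w))"
      by (simp add: hconj_self_mult of_real_def)
    then show ?thesis
      using s(2) by (simp add: F00 real_mult hconj_add algebra_simps)
  qed
  ultimately have "hquad (insert i0 I) F x = of_real (s * (norm (?x + (1 / s) *\<^sub>R ?w))\<^sup>2) + hquad I (schur i0 F) x"
    by simp
  then show ?thesis by (simp only: repart_add repart_of_real)
qed

fun pivots_pos :: "('m::finite) list \<Rightarrow> 'a::conj_div_algebra^('m::finite)^('m::finite) \<Rightarrow> bool" where
  "pivots_pos [] F = True"
| "pivots_pos (i # is) F = (repart (F $ i $ i) > 0 \<and> pivots_pos is (schur i F))"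

fun pivot_prod :: "('m::finite) list \<Rightarrow> 'a::conj_div_algebra^('m::finite)^('m::finite) \<Rightarrow> real" where
  "pivot_prod [] F = 1"
| "pivot_prod (i # is) F = repart (F $ i $ i) * pivot_prod is (schur i F)"

lemma pivot_prod_pos: "pivots_pos is F \<Longrightarrow> pivot_prod is F > 0"
  by (induction "is" arbitrary: F) auto

lemma pivot_weight_eq: "pivot_weight a is F = (if pivots_pos is F then pivot_prod is F powr a else 0)"
proof (induction "is" arbitrary: F)
  case (Cons i "is")
  show ?case
    using pivot_prod_pos[of "is" "schur i F"] by (auto simp: Cons.IH powr_mult)
qed simp

lemma hquad_cong: "(\<And>i. i \<in> I \<Longrightarrow> x i = y i) \<Longrightarrow> hquad I F x = hquad I F y"
  by (simp add: hquad_def)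

text \<open>Completing the square splits the form into a positive multiple of a norm and the form of the Schur
  complement. For the converse, the coordinate \<open>i0\<close> is chosen such that the norm vanishes.\<close>
lemma pivots_pos_iff:
  fixes F :: "'a::conj_div_algebra^('m::finite)^('m::finite)"
  assumes "distinct is" "F = ctranspose F"
  shows "pivots_pos is F \<longleftrightarrow> (\<forall>x. (\<exists>i\<in>set is. x i \<noteq> 0) \<longrightarrow> repart (hquad (set is) F x) > 0)"
  using assms
proof (induction "is" arbitrary: F)
  case (Cons i0 "is" F)
  let ?I = "set is" and ?s = "repart (F $ i0 $ i0)"
  have i0: "i0 \<notin> ?I" and herm: "F = ctranspose F" using Cons.prems by auto
  have IH: "pivots_pos is (schur i0 F) \<longleftrightarrow> (\<forall>x. (\<exists>i\<in>?I. x i \<noteq> 0) \<longrightarrow> repart (hquad ?I (schur i0 F) x) > 0)"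
    using Cons.prems schur_hermitian[OF herm] by (intro Cons.IH) auto
  define w where "w x = (\<Sum>j\<in>?I. F $ i0 $ j * x j)" for x
  note square = complete_square[OF herm i0 refl, folded w_def]
  have w_cong: "w x = w y" if "\<And>i. i \<in> ?I \<Longrightarrow> x i = y i" for x y
    using that by (simp add: w_def)
  show ?case
  proof
    assume "pivots_pos (i0 # is) F"
    then have s: "?s > 0" and pos: "\<And>x. (\<exists>i\<in>?I. x i \<noteq> 0) \<Longrightarrow> repart (hquad ?I (schur i0 F) x) > 0"
      using IH by auto
    show "\<forall>x. (\<exists>i\<in>set (i0 # is). x i \<noteq> 0) \<longrightarrow> repart (hquad (set (i0 # is)) F x) > 0"
    proof (intro allI impI)
      fix x :: "'m \<Rightarrow> 'a" assume x: "\<exists>i\<in>set (i0 # is). x i \<noteq> 0"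
      show "repart (hquad (set (i0 # is)) F x) > 0"
      proof (cases "\<exists>i\<in>?I. x i \<noteq> 0")
        case True
        then show ?thesis using pos[of x] s square[of x] by (simp add: add_nonneg_pos)
      next
        case False
        then have "x i0 \<noteq> 0" "w x = 0" "hquad ?I (schur i0 F) x = 0"
          using x by (auto simp: w_def hquad_def)
        then show ?thesis using s square[of x] by simp
      qed
    qed
  next
    assume pos: "\<forall>x. (\<exists>i\<in>set (i0 # is). x i \<noteq> 0) \<longrightarrow> repart (hquad (set (i0 # is)) F x) > 0"
    have s: "?s > 0"
    proof -
      let ?x = "\<lambda>i. if i = i0 then 1 else 0 :: 'a"
      have row: "(\<Sum>j\<in>insert i0 ?I. hconj (?x i) * (F $ i $ j * ?x j)) = (if i = i0 then F $ i0 $ i0 else 0)" for i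
      proof (cases "i = i0")
        case True
        then have "(\<Sum>j\<in>insert i0 ?I. hconj (?x i) * (F $ i $ j * ?x j)) = (\<Sum>j\<in>insert i0 ?I. if j = i0 then F $ i0 $ i0 else 0)"
          by (intro sum.cong) auto
        then show ?thesis using True by (simp add: sum.delta)
      qed simp
      have "hquad (insert i0 ?I) F ?x = (\<Sum>i\<in>insert i0 ?I. if i = i0 then F $ i0 $ i0 else 0)"
        unfolding hquad_def row ..
      also have "\<dots> = F $ i0 $ i0" by (subst sum.delta) auto
      finally show ?thesis using pos[rule_format, of ?x] by simp
    qed
    moreover have "pivots_pos is (schur i0 F)"
      unfolding IH
    proof (intro allI impI)
      fix x :: "'m \<Rightarrow> 'a" assume x: "\<exists>i\<in>?I. x i \<noteq> 0"
      define y where "y = x(i0 := - ((1 / ?s) *\<^sub>R w x))"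
      have y: "y i = x i" if "i \<in> ?I" for i using that i0 by (auto simp: y_def)
      have "w y = w x" by (rule w_cong) (rule y)
      moreover have "y i0 = - ((1 / ?s) *\<^sub>R w x)" by (simp add: y_def)
      ultimately have "y i0 + (1 / ?s) *\<^sub>R w y = 0" by simp
      moreover have "hquad ?I (schur i0 F) y = hquad ?I (schur i0 F) x" by (rule hquad_cong) (rule y)
      moreover have "repart (hquad (insert i0 ?I) F y) > 0" using pos[rule_format, of y] x y by auto
      ultimately show "repart (hquad ?I (schur i0 F) x) > 0" using square[of y] s by simp
    qed
    ultimately show "pivots_pos (i0 # is) F" by simp
  qed
qed simp

lemma repart_hquad_measurable:
  assumes "x \<in> N \<rightarrow>\<^sub>M (\<Pi>\<^sub>M i\<in>I. lborel)"
  shows "(\<lambda>z. repart (hquad I F (x z))) \<in> borel_measurable N"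
proof -
  have [measurable]: "(\<lambda>z. x z i) \<in> borel_measurable N" if "i \<in> I" for i
    using measurable_compose[OF assms measurable_component_singleton[OF that]] by simp
  show ?thesis unfolding hquad_def by measurable
qed

text \<open>After completing the square, the integral over the coordinate \<open>i0\<close> is a Gaussian integral.\<close>
lemma nn_integral_exp_hquad:
  fixes F :: "'a::conj_div_algebra^('m::finite)^('m::finite)"
  assumes "distinct is" "F = ctranspose F" "pivots_pos is F"
  shows "(\<integral>\<^sup>+x. ennreal (exp (- repart (hquad (set is) F x))) \<partial>(\<Pi>\<^sub>M i\<in>set is. lborel)) =
    ennreal (pi powr (real DIM('a) * real (length is) / 2) * pivot_prod is F powr - (real DIM('a) / 2))"
  using assms
proof (induction "is" arbitrary: F)
  case Nil
  show ?case by (simp add: hquad_def PiM_empty nn_integral_count_space_finite)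
next
  case (Cons i0 "is" F)
  let ?I = "set is" and ?s = "repart (F $ i0 $ i0)" and ?b = "real DIM('a)"
  have i0: "i0 \<notin> ?I" and herm: "F = ctranspose F" and s: "?s > 0" using Cons.prems by auto
  define w where "w x = (\<Sum>j\<in>?I. F $ i0 $ j * x j)" for x
  note square = complete_square[OF herm i0 refl, folded w_def]
  have meas: "(\<lambda>x. ennreal (exp (- repart (hquad J G x)))) \<in> borel_measurable (\<Pi>\<^sub>M i\<in>J. lborel)" for J and G :: "'a^'m^'m"
    using repart_hquad_measurable[of "\<lambda>x. x" _ J G] by measurable
  have "(\<integral>\<^sup>+x. ennreal (exp (- repart (hquad (insert i0 ?I) F x))) \<partial>(\<Pi>\<^sub>M i\<in>insert i0 ?I. lborel)) =
    (\<integral>\<^sup>+x. (\<integral>\<^sup>+y. ennreal (exp (- repart (hquad (insert i0 ?I) F (x(i0 := y))))) \<partial>lborel) \<partial>(\<Pi>\<^sub>M i\<in>?I. lborel))"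
    by (rule lborel_prod.product_nn_integral_insert[OF _ i0 meas]) simp
  also have "\<dots> = (\<integral>\<^sup>+x. ennreal ((pi / ?s) powr (?b / 2)) * ennreal (exp (- repart (hquad ?I (schur i0 F) x))) \<partial>(\<Pi>\<^sub>M i\<in>?I. lborel))"
  proof (rule nn_integral_cong)
    fix x :: "'m \<Rightarrow> 'a"
    have eqs: "hquad ?I (schur i0 F) (x(i0 := y)) = hquad ?I (schur i0 F) x" "w (x(i0 := y)) = w x" for y
      using i0 by (auto simp: w_def intro!: hquad_cong sum.cong)
    have "ennreal (exp (- repart (hquad (insert i0 ?I) F (x(i0 := y))))) =
      ennreal (exp (- ?s * (norm (y - (- (1 / ?s) *\<^sub>R w x)))\<^sup>2)) * ennreal (exp (- repart (hquad ?I (schur i0 F) x)))" for y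
      using square[of "x(i0 := y)", unfolded eqs] s by (simp add: mult_exp_exp flip: ennreal_mult)
    then show "(\<integral>\<^sup>+y. ennreal (exp (- repart (hquad (insert i0 ?I) F (x(i0 := y))))) \<partial>lborel) =
      ennreal ((pi / ?s) powr (?b / 2)) * ennreal (exp (- repart (hquad ?I (schur i0 F) x)))"
      using s by (simp only: nn_integral_multc nn_integral_gaussian_scaled) (subst nn_integral_multc, measurable, simp only: nn_integral_gaussian_scaled)
  qed
  also have "\<dots> = ennreal ((pi / ?s) powr (?b / 2)) * (\<integral>\<^sup>+x. ennreal (exp (- repart (hquad ?I (schur i0 F) x))) \<partial>(\<Pi>\<^sub>M i\<in>?I. lborel))"
    by (rule nn_integral_cmult[OF meas])
  also have "(\<integral>\<^sup>+x. ennreal (exp (- repart (hquad ?I (schur i0 F) x))) \<partial>(\<Pi>\<^sub>M i\<in>?I. lborel)) =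
    ennreal (pi powr (?b * real (length is) / 2) * pivot_prod is (schur i0 F) powr - (?b / 2))"
    using Cons.prems schur_hermitian[OF herm] by (intro Cons.IH) auto
  also have "ennreal ((pi / ?s) powr (?b / 2)) * \<dots> =
    ennreal (pi powr (?b * real (length (i0 # is)) / 2) * pivot_prod (i0 # is) F powr - (?b / 2))"
  proof -
    have p: "pivot_prod is (schur i0 F) > 0" using Cons.prems pivot_prod_pos by auto
    have "?b * real (length (i0 # is)) / 2 = ?b / 2 + ?b * real (length is) / 2"
      by (simp add: field_simps)
    then have "pi powr (?b * real (length (i0 # is)) / 2) = pi powr (?b / 2) * pi powr (?b * real (length is) / 2)"
      by (simp only: powr_add)
    moreover have "(pi / ?s) powr (?b / 2) = pi powr (?b / 2) * ?s powr - (?b / 2)"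
      using s by (simp add: powr_divide powr_minus_divide)
    ultimately show ?thesis using s p by (simp add: powr_mult mult_ac flip: ennreal_mult)
  qed
  finally show ?case by simp
qed

text \<open>Both sides are read off from the Gaussian integral of the form: from the pivots by
  \<open>nn_integral_exp_hquad\<close>, and from an orthonormal eigenbasis of the underlying real operator by
  \<open>nn_integral_exp_symmetric_form\<close>.\<close>
theorem pivot_prod_eq_hdet:
  fixes F :: "'a::conj_div_algebra^('m::finite)^('m::finite)"
  assumes "distinct is" "set is = UNIV" and herm: "F = ctranspose F" and pp: "pivots_pos is F"
  shows "pivot_prod is F = hdet F"
proof -
  let ?A = "\<lambda>x. F *v x" and ?b = "real DIM('a)"
  have lin: "linear ?A"
    by (rule linearI) (simp_all add: vec_eq_iff matrix_vector_mult_def algebra_simps sum.distrib scaleR_sum_right)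
  have form: "y \<bullet> ?A x = (\<Sum>i\<in>UNIV. \<Sum>j\<in>UNIV. y $ i \<bullet> (F $ i $ j * x $ j))" for x y
    by (simp add: inner_vec_def matrix_vector_mult_def inner_sum_right)
  have sym: "x \<bullet> ?A y = ?A x \<bullet> y" for x y
  proof -
    have "x \<bullet> ?A y = (\<Sum>i\<in>UNIV. \<Sum>j\<in>UNIV. y $ j \<bullet> (F $ j $ i * x $ i))"
      unfolding form
      by (intro sum.cong refl) (simp add: inner_commute[of "x $ _"] inner_mult_left_hconj hermitian_nth[OF herm])
    also have "\<dots> = y \<bullet> ?A x" unfolding form by (rule sum.swap)
    finally show ?thesis by (simp add: inner_commute)
  qed
  have quad: "x \<bullet> ?A x = repart (hquad UNIV F (\<lambda>i. x $ i))" for x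
  proof -
    have "inner a b = repart (hconj a * b)" for a b :: 'a
      using inner_mult_left_hconj[of "hconj a" b 1] by (simp add: repart_def inner_commute)
    then show ?thesis by (simp add: form hquad_def repart_def inner_sum_left)
  qed
  have Apos: "x \<bullet> ?A x > 0" if "x \<noteq> 0" for x
    using pp that unfolding quad pivots_pos_iff[OF assms(1) herm] assms(2)
    by (auto simp: vec_eq_iff)
  obtain B where B: "finite B" "pairwise orthogonal B" "\<And>b. b \<in> B \<Longrightarrow> norm b = 1" "span B = UNIV"
    and ex: "\<And>b. b \<in> B \<Longrightarrow> \<exists>l. ?A b = l *\<^sub>R b"
    using spectral_invariant_subspace[OF lin sym subspace_UNIV] by auto
  define \<mu> where "\<mu> b = b \<bullet> ?A b" for b
  have eig: "?A b = \<mu> b *\<^sub>R b" if b: "b \<in> B" for b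
  proof -
    obtain l where l: "?A b = l *\<^sub>R b" using ex[OF b] by blast
    then have "\<mu> b = l" using B(3)[OF b] by (simp add: \<mu>_def dot_square_norm)
    then show ?thesis using l by simp
  qed
  have \<mu>: "\<mu> b > 0" if "b \<in> B" for b
    unfolding \<mu>_def using B(3)[OF that] by (intro Apos) auto
  have space: "eigenspace F l = {x. ?A x = l *\<^sub>R x}" for l by (simp add: eigenspace_def)
  have dim: "dim (eigenspace F l) = card {b \<in> B. \<mu> b = l}" for l
    unfolding space by (rule eigenspace_of_orthonormal_eigenbasis[OF B lin eig])
  have nonzero: "eigenspace F l \<noteq> {0} \<longleftrightarrow> l \<in> \<mu> ` B" for l
  proof -
    have "eigenspace F l = span {b \<in> B. \<mu> b = l}"
      unfolding space by (rule eigenspace_of_orthonormal_eigenbasis[OF B lin eig])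
    moreover have "b \<in> span {b \<in> B. \<mu> b = l}" "b \<noteq> 0" if "b \<in> B" "\<mu> b = l" for b
      using B(3)[OF that(1)] that by (auto intro: span_base)
    moreover have "span {b \<in> B. \<mu> b = l} = {0}" if "l \<notin> \<mu> ` B"
    proof -
      have empty: "{b \<in> B. \<mu> b = l} = {}" using that by blast
      show ?thesis unfolding empty by simp
    qed
    ultimately show ?thesis by (cases "l \<in> \<mu> ` B") blast+
  qed
  have dvd: "DIM('a) dvd dim (eigenspace F l)" for l
  proof (rule dim_right_module)
    show "subspace (eigenspace F l)"
      unfolding space using lin by (auto simp: subspace_def linear_add linear_scale linear_0 scaleR_add_right)
    show "(\<chi> i. v $ i * q) \<in> eigenspace F l" if v: "v \<in> eigenspace F l" for v q
    proof -
      have v': "(\<Sum>j\<in>UNIV. F $ i $ j * v $ j) = l *\<^sub>R v $ i" for i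
        using v by (simp add: eigenspace_def vec_eq_iff matrix_vector_mult_def)
      have "(\<Sum>j\<in>UNIV. F $ i $ j * (v $ j * q)) = l *\<^sub>R (v $ i * q)" for i
        using arg_cong[OF v'[of i], of "\<lambda>x. x * q"] by (simp add: sum_distrib_right mult.assoc)
      then show ?thesis by (simp add: eigenspace_def vec_eq_iff matrix_vector_mult_def)
    qed
  qed
  have "(\<Prod>b\<in>B. \<mu> b) = (\<Prod>l\<in>\<mu> ` B. \<Prod>b\<in>{b \<in> B. \<mu> b = l}. \<mu> b)"
    using B(1) by (rule prod.image_gen)
  also have "\<dots> = (\<Prod>l\<in>\<mu> ` B. l ^ card {b \<in> B. \<mu> b = l})"
    by (intro prod.cong refl) simp
  also have "\<dots> = (\<Prod>l\<in>\<mu> ` B. (l ^ (dim (eigenspace F l) div DIM('a))) ^ DIM('a))"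
    by (intro prod.cong refl) (simp add: dvd_div_mult_self[OF dvd] flip: dim power_mult)
  also have "\<dots> = hdet F ^ DIM('a)"
    by (simp add: hdet_def nonzero prod_power_distrib)
  finally have prod_mu: "(\<Prod>b\<in>B. \<mu> b) = hdet F ^ DIM('a)" .
  have hpos: "hdet F > 0"
    unfolding hdet_def nonzero using \<mu> by (auto intro!: prod_pos)
  have "ennreal (pi powr (?b * real CARD('m) / 2) * pivot_prod is F powr - (?b / 2)) =
    (\<integral>\<^sup>+x. ennreal (exp (- repart (hquad UNIV F x))) \<partial>(\<Pi>\<^sub>M i\<in>UNIV. lborel))"
    using nn_integral_exp_hquad[OF assms(1) herm pp] assms(2) distinct_card[OF assms(1)] by simp
  also have "\<dots> = (\<integral>\<^sup>+x. ennreal (exp (- (x \<bullet> ?A x))) \<partial>lborel)"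
  proof -
    have "continuous_on UNIV (\<lambda>x. x \<bullet> ?A x)"
      using lin by (intro continuous_intros linear_continuous_on) (simp add: linear_conv_bounded_linear)
    then have [measurable]: "(\<lambda>x. x \<bullet> ?A x) \<in> borel_measurable borel" by (rule borel_measurable_continuous_onI)
    show ?thesis
      by (subst nn_integral_lborel_vec, measurable) (simp add: quad vec_nth_vec_lambda)
  qed
  also have "\<dots> = ennreal (pi powr (DIM('a^'m) / 2) * (\<Prod>b\<in>B. \<mu> b) powr - (1 / 2))"
    by (rule nn_integral_exp_symmetric_form[OF B lin eig \<mu>])
  also have "\<dots> = ennreal (pi powr (?b * real CARD('m) / 2) * hdet F powr - (?b / 2))"
    using hpos by (simp add: prod_mu mult.commute powr_powr flip: powr_realpow)
  finally have "pivot_prod is F powr - (?b / 2) = hdet F powr - (?b / 2)"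
    by simp
  then have "(pivot_prod is F powr - (?b / 2)) powr (- (2 / ?b)) = (hdet F powr - (?b / 2)) powr (- (2 / ?b))"
    by simp
  then show ?thesis
    using pivot_prod_pos[OF pp] hpos by (simp add: powr_powr)
qed

lemma posdef_hermitian_iff:
  fixes F :: "'a::conj_div_algebra^('m::finite)^('m::finite)"
  assumes "distinct is" "set is = UNIV"
  shows "F \<in> posdef_hermitian \<longleftrightarrow> F = ctranspose F \<and> pivots_pos is F"
proof (cases "F = ctranspose F")
  case True
  have "(\<Sum>i\<in>UNIV. hconj (x $ i) * (F *v x) $ i) = hquad UNIV F (\<lambda>i. x $ i)" for x
    by (simp add: hquad_def matrix_vector_mult_def sum_distrib_left)
  then have "(\<exists>r>0. (\<Sum>i\<in>UNIV. hconj (x $ i) * (F *v x) $ i) = of_real r) \<longleftrightarrow> repart (hquad UNIV F (\<lambda>i. x $ i)) > 0" for x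
    using hquad_real[OF True, of UNIV "\<lambda>i. x $ i"] by (metis repart_of_real)
  then have "F \<in> posdef_hermitian \<longleftrightarrow> (\<forall>x. x \<noteq> 0 \<longrightarrow> repart (hquad UNIV F (\<lambda>i. x $ i)) > 0)"
    using True by (simp add: posdef_hermitian_def)
  also have "\<dots> \<longleftrightarrow> (\<forall>x. (\<exists>i. x i \<noteq> 0) \<longrightarrow> repart (hquad UNIV F x) > 0)"
  proof (intro iffI allI impI)
    fix x :: "'m \<Rightarrow> 'a"
    assume "\<forall>x. x \<noteq> 0 \<longrightarrow> repart (hquad UNIV F (\<lambda>i. x $ i)) > 0" "\<exists>i. x i \<noteq> 0"
    from this(1)[rule_format, of "vec_lambda x"] this(2)
    show "repart (hquad UNIV F x) > 0" by (auto simp: vec_eq_iff vec_nth_vec_lambda)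
  qed (auto simp: vec_eq_iff)
  finally show ?thesis
    using True pivots_pos_iff[OF assms(1) True] assms(2) by simp
next
  case False
  then show ?thesis by (simp add: posdef_hermitian_def)
qed


section \<open>The matrix multivariate beta type II density\<close>

lemma nn_integral_hermitian_lborel:
  fixes h :: "'a::conj_div_algebra^('m::{finite,linorder})^('m::{finite,linorder}) \<Rightarrow> ennreal"
  assumes h: "h \<in> borel_measurable borel"
  shows "(\<integral>\<^sup>+F. h F \<partial>hermitian_lborel) = hermitian_integral UNIV h"
proof -
  let ?D = "Pi\<^sub>M UNIV (\<lambda>_::'m. lborel :: real measure)" and ?U = "Pi\<^sub>M {(i, j). i < j} (\<lambda>_::'m \<times> 'm. lborel :: 'a measure)"
  have on: "hermitian_on UNIV d u = hermitian_of (d, u)" for d and u :: "'m \<times> 'm \<Rightarrow> 'a"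
    by (simp add: hermitian_on_def vec_eq_iff)
  have pairs: "pairs_above UNIV = {(i, j :: 'm). i < j}" by (simp add: pairs_above_def)
  have "(\<integral>\<^sup>+F. h F \<partial>hermitian_lborel) = (\<integral>\<^sup>+p. h (hermitian_of p) \<partial>(?D \<Otimes>\<^sub>M ?U))"
    unfolding hermitian_lborel_def by (rule nn_integral_distr[OF borel_measurable_hermitian_of]) (simp add: h)
  also have "\<dots> = (\<integral>\<^sup>+d. (\<integral>\<^sup>+u. h (hermitian_of (d, u)) \<partial>?U) \<partial>?D)"
    by (rule sigma_finite_measure.nn_integral_fst[OF lborel_prod.sigma_finite, symmetric])
       (use measurable_compose[OF borel_measurable_hermitian_of h] in auto)
  finally show ?thesis by (simp add: hermitian_integral_def on pairs)
qed

lemma mult_ctranspose_nth: "(X ** ctranspose X) $ i $ j = hform (X $ i) (X $ j)"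
  by (simp add: matrix_matrix_mult_def ctranspose_def hform_def)

lemma mult_ctranspose_measurable [measurable]:
  "(\<lambda>X :: 'a::conj_div_algebra^'n^'m. X ** ctranspose X) \<in> borel_measurable borel"
  by (intro borel_measurable_vecI) (unfold mult_ctranspose_nth, measurable)

lemma ctranspose_measurable [measurable]:
  "(ctranspose :: 'a::conj_div_algebra^'n^'m \<Rightarrow> _) \<in> borel_measurable borel"
  by (intro borel_measurable_vecI) (unfold ctranspose_nth, measurable)

lemma trace_measurable [measurable]:
  "(trace :: 'a::conj_div_algebra^'m^'m \<Rightarrow> 'a) \<in> borel_measurable borel"
  unfolding trace_def by measurable

text \<open>All rows are peeled off in increasing order of their indices, starting from the empty set of directions.\<close>
theorem gram_matrix_law:
  fixes g :: "'a::conj_div_algebra^('m::{finite,linorder})^('m::{finite,linorder}) \<Rightarrow> ennreal"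
  assumes le: "CARD('m) \<le> CARD('n)" and g: "g \<in> borel_measurable borel"
  defines "\<beta> \<equiv> real DIM('a)"
  shows "(\<integral>\<^sup>+(X :: 'a^'n::finite^('m::{finite,linorder})). g (X ** ctranspose X) \<partial>lborel) =
    ennreal (pi powr (\<beta> * real (CARD('m) * CARD('n)) / 2) / mgamma \<beta> CARD('m) (\<beta> * real CARD('n) / 2)) *
    hermitian_integral UNIV (\<lambda>F. ennreal (pivot_weight
      (\<beta> * (real CARD('n) - real CARD('m) + 1) / 2 - 1) (sorted_list_of_set UNIV) F) * g F)"
proof -
  let ?is = "sorted_list_of_set (UNIV :: 'm set)"
  have gram: "vec_lambda y ** ctranspose (vec_lambda y) = gram {} UNIV y" for y :: "'m \<Rightarrow> 'a^'n"
    by (simp add: vec_eq_iff mult_ctranspose_nth gram_def residual_def)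
  have "(\<integral>\<^sup>+(X :: 'a^'n^('m::{finite,linorder})). g (X ** ctranspose X) \<partial>lborel) =
    (\<integral>\<^sup>+y. (\<Prod>i\<in>set ?is. ennreal (exp (- energy ({} :: ('a^'n) set) (y i)))) * g (gram {} (set ?is) y) \<partial>(\<Pi>\<^sub>M i\<in>set ?is. lborel))"
    using measurable_compose[OF mult_ctranspose_measurable g]
    by (subst nn_integral_lborel_vec) (simp_all add: gram energy_def)
  also have "\<dots> = ennreal (pi powr (\<beta> * real (CARD('n) * length ?is) / 2) /
      mgamma \<beta> (length ?is) (\<beta> * (real CARD('n) - real (card ({} :: ('a^'n) set))) / 2)) *
    hermitian_integral (set ?is) (\<lambda>F.
      ennreal (pivot_weight (\<beta> * (real CARD('n) - real (card ({} :: ('a^'n) set)) - real (length ?is) + 1) / 2 - 1) ?is F) * g F)"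
    unfolding \<beta>_def
    by (rule gram_law[OF _ _ _ g]) (use le in \<open>simp_all add: orthonormal_def strict_sorted_iff\<close>)
  finally show ?thesis by (simp add: mult.commute)
qed

text \<open>The form of the density that appears in \<open>gram_matrix_law\<close>. In contrast to eigenvalues, pivots make its
  measurability evident.\<close>
lemma matrix_betaII_density_eq:
  fixes F :: "'a::conj_div_algebra^('m::{finite,linorder})^('m::{finite,linorder})"
  defines "\<beta> \<equiv> real DIM('a)"
  shows "matrix_betaII_density \<beta> \<nu> n F = (if F = ctranspose F then
     mgamma \<beta> 1 (\<beta> * (\<nu> + real (CARD('m) * n)) / 2) /
       (mgamma \<beta> 1 (\<beta> * \<nu> / 2) * mgamma \<beta> CARD('m) (\<beta> * real n / 2)) *
     pivot_weight (\<beta> * (real n - real CARD('m) + 1) / 2 - 1) (sorted_list_of_set UNIV) F *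
     (1 + repart (trace F)) powr (- \<beta> * (\<nu> + real (CARD('m) * n)) / 2) else 0)"
proof -
  have d: "distinct (sorted_list_of_set (UNIV :: 'm set))" "set (sorted_list_of_set (UNIV :: 'm set)) = UNIV"
    by simp_all
  show ?thesis
    using posdef_hermitian_iff[OF d, of F] pivot_prod_eq_hdet[OF d, of F]
    by (auto simp: matrix_betaII_density_def pivot_weight_eq)
qed

lemma matrix_betaII_density_measurable:
  "(matrix_betaII_density (real DIM('a)) \<nu> n :: 'a::conj_div_algebra^('m::{finite,linorder})^('m::{finite,linorder}) \<Rightarrow> real) \<in> borel_measurable borel"
proof -
  have [measurable]: "Measurable.pred borel (\<lambda>F :: 'a^('m::{finite,linorder})^('m::{finite,linorder}). F = ctranspose F)"
  proof -
    have "(F = ctranspose F) = (norm (F - ctranspose F) = 0)" for F :: "'a^('m::{finite,linorder})^('m::{finite,linorder})"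
      by simp
    then show ?thesis by (simp only:) measurable
  qed
  show ?thesis unfolding matrix_betaII_density_eq[abs_def] by measurable
qed

lemma mgamma_1: "mgamma \<beta> 1 a = Gamma a"
  by (simp add: mgamma_def)

text \<open>The density of \<open>T\<close> is a function \<open>D\<close> of the Gram matrix, so the density of the Gram matrix is \<open>D\<close> times
  that of the image of Lebesgue measure.\<close>
theorem matrix_T_gram_distributed:
  fixes T :: "'w \<Rightarrow> 'a::conj_div_algebra^'n::finite^('m::{finite,linorder})"
  assumes le: "CARD('m) \<le> CARD('n)" and \<nu>: "\<nu> > 0" and T: "matrix_T M (real DIM('a)) \<nu> T"
  shows "distributed M hermitian_lborel (\<lambda>\<omega>. T \<omega> ** ctranspose (T \<omega>))
    (\<lambda>F. ennreal (matrix_betaII_density (real DIM('a)) \<nu> CARD('n) F))"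
proof -
  let ?\<beta> = "real DIM('a)" and ?H = "hermitian_lborel :: ('a^('m::{finite,linorder})^('m::{finite,linorder})) measure"
  let ?f = "\<lambda>F :: 'a^('m::{finite,linorder})^('m::{finite,linorder}). ennreal (matrix_betaII_density ?\<beta> \<nu> CARD('n) F)"
  let ?is = "sorted_list_of_set (UNIV :: 'm set)"
  define a where "a = ?\<beta> * (real CARD('n) - real CARD('m) + 1) / 2 - 1"
  define K where "K = pi powr (?\<beta> * real (CARD('m) * CARD('n)) / 2) / mgamma ?\<beta> CARD('m) (?\<beta> * real CARD('n) / 2)"
  define c where "c = mgamma ?\<beta> 1 (?\<beta> * (\<nu> + real (CARD('m) * CARD('n))) / 2) /
       (pi powr (?\<beta> * real (CARD('m) * CARD('n)) / 2) * mgamma ?\<beta> 1 (?\<beta> * \<nu> / 2))"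
  define D where "D F = c * (1 + repart (trace F)) powr (- ?\<beta> * (\<nu> + real (CARD('m) * CARD('n))) / 2)" for F :: "'a^('m::{finite,linorder})^('m::{finite,linorder})"
  have \<beta>: "?\<beta> > 0" by simp
  have c: "c \<ge> 0"
    unfolding c_def mgamma_1 using \<beta> \<nu>
    by (intro divide_nonneg_nonneg mult_nonneg_nonneg less_imp_le[OF Gamma_real_pos]) (auto intro!: mult_pos_pos add_pos_nonneg)
  have mg: "mgamma ?\<beta> CARD('m) (?\<beta> * real CARD('n) / 2) > 0"
  proof (rule mgamma_pos[OF \<beta>])
    have "(real CARD('m) - 1) * ?\<beta> < real CARD('n) * ?\<beta>"
      using le by (intro mult_strict_right_mono \<beta>) simp
    then show "(real CARD('m) - 1) * ?\<beta> / 2 < ?\<beta> * real CARD('n) / 2" by (simp add: mult.commute)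
  qed
  then have K: "K \<ge> 0" by (simp add: K_def)
  have D: "D F \<ge> 0" for F using c by (simp add: D_def)
  have D_meas [measurable]: "D \<in> borel_measurable borel" unfolding D_def by measurable
  have dist: "distr M lborel T = density lborel (\<lambda>X. ennreal (D (X ** ctranspose X)))"
    and T_meas [measurable]: "T \<in> M \<rightarrow>\<^sub>M borel"
    using T by (simp_all add: matrix_T_def distributed_def matrix_T_density_def[abs_def] D_def c_def)
  have sets_H: "sets ?H = sets borel" by (simp add: hermitian_lborel_def)
  have f_meas: "?f \<in> borel_measurable borel" using matrix_betaII_density_measurable by measurable
  have dens: "?f F = ennreal K * (ennreal (pivot_weight a ?is F) * ennreal (D F))" if "F = ctranspose F" for F
  proof -
    have "matrix_betaII_density ?\<beta> \<nu> CARD('n) F = K * (pivot_weight a ?is F * D F)"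
      using that by (simp add: matrix_betaII_density_eq K_def D_def c_def a_def mult_ac)
    then show ?thesis using K D[of F] pivot_weight_nonneg[of a ?is F] by (simp add: ennreal_mult)
  qed
  have herm: "hermitian_on UNIV d u = ctranspose (hermitian_on UNIV d u)" for d and u :: "'m \<times> 'm \<Rightarrow> 'a"
    by (auto simp: vec_eq_iff ctranspose_nth hermitian_on_nth not_less dest: order.antisym)
  have "distr M ?H (\<lambda>\<omega>. T \<omega> ** ctranspose (T \<omega>)) = density ?H ?f"
  proof (rule measure_eqI)
    show "sets (distr M ?H (\<lambda>\<omega>. T \<omega> ** ctranspose (T \<omega>))) = sets (density ?H ?f)" by simp
    fix A assume "A \<in> sets (distr M ?H (\<lambda>\<omega>. T \<omega> ** ctranspose (T \<omega>)))"
    then have A [measurable]: "A \<in> sets borel" by (simp add: sets_H)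
    let ?g = "\<lambda>F. ennreal (D F) * indicator A F"
    have g: "?g \<in> borel_measurable borel" by measurable
    have "emeasure (distr M ?H (\<lambda>\<omega>. T \<omega> ** ctranspose (T \<omega>))) A = emeasure (distr M borel (\<lambda>\<omega>. T \<omega> ** ctranspose (T \<omega>))) A"
      by (simp add: sets_H cong: distr_cong)
    also have "\<dots> = emeasure (distr (distr M lborel T) borel (\<lambda>X. X ** ctranspose X)) A"
      by (subst distr_distr) (simp_all add: comp_def)
    also have "\<dots> = (\<integral>\<^sup>+F. indicator A F \<partial>distr (distr M lborel T) borel (\<lambda>X. X ** ctranspose X))"
      by simp
    also have "\<dots> = (\<integral>\<^sup>+X. indicator A (X ** ctranspose X) \<partial>distr M lborel T)"
      by (rule nn_integral_distr) (simp_all cong: measurable_cong_sets)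
    also have "\<dots> = (\<integral>\<^sup>+(X :: 'a^'n^('m::{finite,linorder})). ?g (X ** ctranspose X) \<partial>lborel)"
      unfolding dist by (subst nn_integral_density) simp_all
    also have "\<dots> = ennreal K * hermitian_integral UNIV (\<lambda>F. ennreal (pivot_weight a ?is F) * ?g F)"
      unfolding K_def a_def by (rule gram_matrix_law[OF le g])
    also have "\<dots> = hermitian_integral UNIV (\<lambda>F. ennreal K * (ennreal (pivot_weight a ?is F) * ?g F))"
      by (rule hermitian_integral_cmult[symmetric]) measurable
    also have "\<dots> = hermitian_integral UNIV (\<lambda>F. ?f F * indicator A F)"
      by (rule hermitian_integral_cong) (simp only: dens[OF herm] mult.assoc)
    also have "\<dots> = (\<integral>\<^sup>+F. ?f F * indicator A F \<partial>?H)"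
      by (rule nn_integral_hermitian_lborel[symmetric]) (use f_meas in measurable)
    also have "\<dots> = emeasure (density ?H ?f) A"
      by (rule emeasure_density[symmetric]) (use f_meas A in \<open>simp_all add: sets_H cong: measurable_cong_sets\<close>)
    finally show "emeasure (distr M ?H (\<lambda>\<omega>. T \<omega> ** ctranspose (T \<omega>))) A = emeasure (density ?H ?f) A" .
  qed
  moreover have "(\<lambda>\<omega>. T \<omega> ** ctranspose (T \<omega>)) \<in> M \<rightarrow>\<^sub>M ?H"
    using measurable_compose[OF T_meas mult_ctranspose_measurable] by (simp add: sets_H cong: measurable_cong_sets)
  moreover have "?f \<in> borel_measurable ?H"
    using f_meas by (simp add: sets_H cong: measurable_cong_sets)
  ultimately show ?thesis by (simp add: distributed_def)
qed

theorem theorem3p2: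
  fixes M :: "'w measure" and \<nu> :: real
  assumes "CARD('m::{finite,linorder}) \<le> CARD('n::finite)" and "\<nu> > 0"
  shows "(\<forall>T1 :: 'w \<Rightarrow> real^'n^('m::{finite,linorder}). matrix_T M 1 \<nu> T1 \<longrightarrow>
            distributed M hermitian_lborel (\<lambda>\<omega>. T1 \<omega> ** ctranspose (T1 \<omega>))
              (\<lambda>F. ennreal (matrix_betaII_density 1 \<nu> CARD('n) F))) \<and>
         (\<forall>T1 :: 'w \<Rightarrow> complex^'n^('m::{finite,linorder}). matrix_T M 2 \<nu> T1 \<longrightarrow>
            distributed M hermitian_lborel (\<lambda>\<omega>. T1 \<omega> ** ctranspose (T1 \<omega>))
              (\<lambda>F. ennreal (matrix_betaII_density 2 \<nu> CARD('n) F))) \<and>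
         (\<forall>T1 :: 'w \<Rightarrow> quat^'n^('m::{finite,linorder}). matrix_T M 4 \<nu> T1 \<longrightarrow>
            distributed M hermitian_lborel (\<lambda>\<omega>. T1 \<omega> ** ctranspose (T1 \<omega>))
              (\<lambda>F. ennreal (matrix_betaII_density 4 \<nu> CARD('n) F)))"
proof (intro conjI allI impI)
  fix T1 :: "'w \<Rightarrow> real^'n^('m::{finite,linorder})" assume "matrix_T M 1 \<nu> T1"
  then show "distributed M hermitian_lborel (\<lambda>\<omega>. T1 \<omega> ** ctranspose (T1 \<omega>))
      (\<lambda>F. ennreal (matrix_betaII_density 1 \<nu> CARD('n) F))"
    using matrix_T_gram_distributed[OF assms, of M T1] by simp
next
  fix T1 :: "'w \<Rightarrow> complex^'n^('m::{finite,linorder})" assume "matrix_T M 2 \<nu> T1"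
  then show "distributed M hermitian_lborel (\<lambda>\<omega>. T1 \<omega> ** ctranspose (T1 \<omega>))
      (\<lambda>F. ennreal (matrix_betaII_density 2 \<nu> CARD('n) F))"
    using matrix_T_gram_distributed[OF assms, of M T1] by simp
next
  fix T1 :: "'w \<Rightarrow> quat^'n^('m::{finite,linorder})" assume "matrix_T M 4 \<nu> T1"
  then show "distributed M hermitian_lborel (\<lambda>\<omega>. T1 \<omega> ** ctranspose (T1 \<omega>))
      (\<lambda>F. ennreal (matrix_betaII_density 4 \<nu> CARD('n) F))"
    using matrix_T_gram_distributed[OF assms, of M T1] by simp
qed

end
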